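(* Let $\Gamma$ be an arbitrary domain of $\mathbf{R}^d$. Then the Dirichlet form $(\frac12\mathbf{D},H^1_0(\Gamma))$ on $L^2(\Gamma)$ of the absorbing Brownian motion $B^\Gamma$ on $\Gamma$ possesses a proper regular subspace.
   Context: $H^1(\Gamma)=\{u\in L^2(\Gamma):\int_\Gamma|\nabla u|^2dx<\infty\}$; $H^1_0(\Gamma)$ is the closure of $C_\mathrm{c}^\infty(\Gamma)$ in $H^1(\Gamma)$; $\mathbf{D}(u,v)=\int_\Gamma\nabla u\cdot\nabla v\,dx$. $(\frac12\mathbf{D},H^1_0(\Gamma))$ is a regular Dirichlet form on $L^2(\Gamma)$ with core $C_\mathrm{c}^\infty(\Gamma)$. A Dirichlet form $(\mathcal{E},\mathcal{F})$ on $L^2(E,m)$ is regular if $\mathcal{F}\cap C_\mathrm{c}(E)$ is dense in $\mathcal{F}$ in the norm $(\mathcal{E}(u,u)+\|u\|_{L^2}^2)^{1/2}$ and uniformly dense in $C_\mathrm{c}(E)$. A regular subspace of a regular Dirichlet form $(\mathcal{E},\mathcal{F})$ on $L^2(E,m)$ is a regular Dirichlet form $(\mathcal{E}',\mathcal{F}')$ on $L^2(E,m)$ with $\mathcal{F}'\subset\mathcal{F}$ and $\mathcal{E}'=\mathcal{E}$ on $\mathcal{F}'\times\mathcal{F}'$; it is proper if $\mathcal{F}'\ne\mathcal{F}$. *)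

theory Defs
  imports "HOL-Analysis.Analysis"
begin

section \<open>Dirichlet forms\<close>

text \<open>
  Elements of \<open>L\<^sup>2(E,m)\<close> are represented by functions rather than by classes of functions, and
  \<open>E\<close> is \<open>space M\<close>; values outside \<open>space M\<close> are irrelevant. The form domains below are required
  to be closed under modification on null sets, so two domains are equal as sets of
  functions iff they are equal as subsets of \<open>L\<^sup>2(E,m)\<close>. The usual standing assumptions on
  \<open>E\<close> (locally compact separable metric) and \<open>m\<close> (Radon, full support) are not part of the
  definitions; they hold for Lebesgue measure on a nonempty open set.
\<close>

definition L2 :: "'a measure \<Rightarrow> ('a \<Rightarrow> real) set" where
  "L2 M = {u \<in> borel_measurable M. integrable M (\<lambda>x. (u x)\<^sup>2)}"

definition L2_norm :: "'a measure \<Rightarrow> ('a \<Rightarrow> real) \<Rightarrow> real" where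
  "L2_norm M u = sqrt (LINT x|M. (u x)\<^sup>2)"

definition form_norm ::
    "'a measure \<Rightarrow> (('a \<Rightarrow> real) \<Rightarrow> ('a \<Rightarrow> real) \<Rightarrow> real) \<Rightarrow> ('a \<Rightarrow> real) \<Rightarrow> real" where
  "form_norm M \<E> u = sqrt (\<E> u u + (L2_norm M u)\<^sup>2)"

text \<open>
  A densely defined, closed, Markovian symmetric form; the Markov property is that the unit
  contraction operates. Condition \<open>form_AE_cong\<close> makes \<open>\<E>\<close> well defined on classes.
\<close>

locale dirichlet_form =
  fixes M :: "'a measure"
    and \<E> :: "('a \<Rightarrow> real) \<Rightarrow> ('a \<Rightarrow> real) \<Rightarrow> real"
    and \<F> :: "('a \<Rightarrow> real) set"
  assumes domain_L2: "\<F> \<subseteq> L2 M"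
    and domain_AE: "\<lbrakk>u \<in> \<F>; v \<in> borel_measurable M; AE x in M. u x = v x\<rbrakk> \<Longrightarrow> v \<in> \<F>"
    and domain_zero: "(\<lambda>x. 0) \<in> \<F>"
    and domain_add: "\<lbrakk>u \<in> \<F>; v \<in> \<F>\<rbrakk> \<Longrightarrow> (\<lambda>x. u x + v x) \<in> \<F>"
    and domain_scale: "u \<in> \<F> \<Longrightarrow> (\<lambda>x. c * u x) \<in> \<F>"
    and domain_dense: "\<lbrakk>f \<in> L2 M; \<epsilon> > 0\<rbrakk> \<Longrightarrow> \<exists>u\<in>\<F>. L2_norm M (\<lambda>x. f x - u x) < \<epsilon>"
    and form_AE_cong:
      "\<lbrakk>u \<in> \<F>; u' \<in> \<F>; v \<in> \<F>; AE x in M. u x = u' x\<rbrakk> \<Longrightarrow> \<E> u v = \<E> u' v"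
    and form_sym: "\<lbrakk>u \<in> \<F>; v \<in> \<F>\<rbrakk> \<Longrightarrow> \<E> u v = \<E> v u"
    and form_add: "\<lbrakk>u \<in> \<F>; v \<in> \<F>; w \<in> \<F>\<rbrakk> \<Longrightarrow> \<E> (\<lambda>x. u x + v x) w = \<E> u w + \<E> v w"
    and form_scale: "\<lbrakk>u \<in> \<F>; v \<in> \<F>\<rbrakk> \<Longrightarrow> \<E> (\<lambda>x. c * u x) v = c * \<E> u v"
    and form_nonneg: "u \<in> \<F> \<Longrightarrow> \<E> u u \<ge> 0"
    and closed:
      "\<lbrakk>\<And>n::nat. s n \<in> \<F>;
        \<And>\<epsilon>. \<epsilon> > 0 \<Longrightarrow> \<exists>N. \<forall>m\<ge>N. \<forall>n\<ge>N. form_norm M \<E> (\<lambda>x. s m x - s n x) < \<epsilon>\<rbrakk>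
       \<Longrightarrow> \<exists>w\<in>\<F>. (\<lambda>n. form_norm M \<E> (\<lambda>x. s n x - w x)) \<longlonglongrightarrow> 0"
    and markovian:
      "u \<in> \<F> \<Longrightarrow> (\<lambda>x. min 1 (max 0 (u x))) \<in> \<F> \<and>
         \<E> (\<lambda>x. min 1 (max 0 (u x))) (\<lambda>x. min 1 (max 0 (u x))) \<le> \<E> u u"

definition Cc :: "'a::topological_space set \<Rightarrow> ('a \<Rightarrow> real) set" where
  "Cc E = {f. continuous_on E f \<and> (\<exists>K. compact K \<and> K \<subseteq> E \<and> (\<forall>x\<in>E - K. f x = 0))}"

locale regular_dirichlet_form = dirichlet_form M \<E> \<F>
  for M :: "'a::topological_space measure" and \<E> \<F> +
  assumes form_norm_dense:
      "\<lbrakk>u \<in> \<F>; \<epsilon> > 0\<rbrakk> \<Longrightarrow> \<exists>f \<in> \<F> \<inter> Cc (space M). form_norm M \<E> (\<lambda>x. u x - f x) < \<epsilon>"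
    and uniformly_dense:
      "\<lbrakk>g \<in> Cc (space M); \<epsilon> > 0\<rbrakk>
        \<Longrightarrow> \<exists>f \<in> \<F> \<inter> Cc (space M). \<forall>x\<in>space M. \<bar>g x - f x\<bar> < \<epsilon>"

text \<open>\<open>(\<E>', \<F>')\<close> is a regular subspace of the regular Dirichlet form \<open>(\<E>, \<F>)\<close> on \<open>L\<^sup>2(M)\<close>.\<close>

definition regular_subspace ::
    "'a::topological_space measure \<Rightarrow>
     (('a \<Rightarrow> real) \<Rightarrow> ('a \<Rightarrow> real) \<Rightarrow> real) \<Rightarrow> ('a \<Rightarrow> real) set \<Rightarrow>
     (('a \<Rightarrow> real) \<Rightarrow> ('a \<Rightarrow> real) \<Rightarrow> real) \<Rightarrow> ('a \<Rightarrow> real) set \<Rightarrow> bool" where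
  "regular_subspace M \<E>' \<F>' \<E> \<F> \<longleftrightarrow>
     regular_dirichlet_form M \<E> \<F> \<and> regular_dirichlet_form M \<E>' \<F>' \<and>
     \<F>' \<subseteq> \<F> \<and> (\<forall>u\<in>\<F>'. \<forall>v\<in>\<F>'. \<E>' u v = \<E> u v)"

definition proper_regular_subspace ::
    "'a::topological_space measure \<Rightarrow>
     (('a \<Rightarrow> real) \<Rightarrow> ('a \<Rightarrow> real) \<Rightarrow> real) \<Rightarrow> ('a \<Rightarrow> real) set \<Rightarrow>
     (('a \<Rightarrow> real) \<Rightarrow> ('a \<Rightarrow> real) \<Rightarrow> real) \<Rightarrow> ('a \<Rightarrow> real) set \<Rightarrow> bool" where
  "proper_regular_subspace M \<E>' \<F>' \<E> \<F> \<longleftrightarrow> regular_subspace M \<E>' \<F>' \<E> \<F> \<and> \<F>' \<noteq> \<F>"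

section \<open>Sobolev spaces\<close>

primrec Ck :: "nat \<Rightarrow> ('a::real_normed_vector \<Rightarrow> real) \<Rightarrow> bool" where
  "Ck 0 f \<longleftrightarrow> continuous_on UNIV f"
| "Ck (Suc k) f \<longleftrightarrow>
     (\<forall>x. f differentiable (at x)) \<and> (\<forall>v. Ck k (\<lambda>x. frechet_derivative f (at x) v))"

text \<open>
  \<open>C\<^sub>c\<^sup>\<infinity>(\<Gamma>)\<close>, its elements being extended by zero to the whole space.
\<close>

definition test_functions :: "'a::euclidean_space set \<Rightarrow> ('a \<Rightarrow> real) set" where
  "test_functions \<Gamma> =
     {\<phi>. (\<forall>k. Ck k \<phi>) \<and> (\<exists>K. compact K \<and> K \<subseteq> \<Gamma> \<and> (\<forall>x. x \<notin> K \<longrightarrow> \<phi> x = 0))}"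

definition locally_integrable ::
    "'a::euclidean_space set \<Rightarrow> ('a \<Rightarrow> 'b::euclidean_space) \<Rightarrow> bool" where
  "locally_integrable \<Gamma> f \<longleftrightarrow>
     f \<in> borel_measurable (lebesgue_on \<Gamma>) \<and>
     (\<forall>K. compact K \<and> K \<subseteq> \<Gamma> \<longrightarrow> integrable (lebesgue_on K) f)"

definition has_weak_gradient ::
    "'a::euclidean_space set \<Rightarrow> ('a \<Rightarrow> real) \<Rightarrow> ('a \<Rightarrow> 'a) \<Rightarrow> bool" where
  "has_weak_gradient \<Gamma> u g \<longleftrightarrow>
     locally_integrable \<Gamma> u \<and> locally_integrable \<Gamma> g \<and>
     (\<forall>\<phi>\<in>test_functions \<Gamma>. \<forall>b\<in>Basis.
        (LINT x|lebesgue_on \<Gamma>. u x * frechet_derivative \<phi> (at x) b) =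
        - (LINT x|lebesgue_on \<Gamma>. (g x \<bullet> b) * \<phi> x))"

text \<open>For open \<open>\<Gamma>\<close> the weak gradient is unique up to a null set; this picks a version of it.\<close>

definition weak_gradient :: "'a::euclidean_space set \<Rightarrow> ('a \<Rightarrow> real) \<Rightarrow> 'a \<Rightarrow> 'a" where
  "weak_gradient \<Gamma> u = (SOME g. has_weak_gradient \<Gamma> u g)"

definition H1 :: "'a::euclidean_space set \<Rightarrow> ('a \<Rightarrow> real) set" where
  "H1 \<Gamma> = {u \<in> L2 (lebesgue_on \<Gamma>). (\<exists>g. has_weak_gradient \<Gamma> u g) \<and>
     integrable (lebesgue_on \<Gamma>) (\<lambda>x. (norm (weak_gradient \<Gamma> u x))\<^sup>2)}"

definition dirichlet_integral ::
    "'a::euclidean_space set \<Rightarrow> ('a \<Rightarrow> real) \<Rightarrow> ('a \<Rightarrow> real) \<Rightarrow> real" where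
  "dirichlet_integral \<Gamma> u v = (LINT x|lebesgue_on \<Gamma>. weak_gradient \<Gamma> u x \<bullet> weak_gradient \<Gamma> v x)"

text \<open>The closure of \<open>C\<^sub>c\<^sup>\<infinity>(\<Gamma>)\<close> in \<open>H\<^sup>1(\<Gamma>)\<close> with respect to the \<open>H\<^sup>1\<close> norm.\<close>

definition H10 :: "'a::euclidean_space set \<Rightarrow> ('a \<Rightarrow> real) set" where
  "H10 \<Gamma> = {u \<in> H1 \<Gamma>. \<forall>\<epsilon>>0. \<exists>\<phi>\<in>test_functions \<Gamma>.
     form_norm (lebesgue_on \<Gamma>) (dirichlet_integral \<Gamma>) (\<lambda>x. u x - \<phi> x) < \<epsilon>}"

end

theory Submission
  imports Defs
begin

text \<open>
  For an open dense set \<open>U \<subseteq> \<real>\<close> let \<open>core U \<Gamma>\<close> be the space of all test functions \<open>\<phi>\<close> on \<open>\<Gamma>\<close> such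
  that, for every coordinate direction \<open>b\<close>, the derivative \<open>\<partial>\<^sub>b \<phi>\<close> vanishes at all points whose
  \<open>b\<close>-th coordinate lies outside \<open>U\<close>, and let \<open>core_domain U \<Gamma>\<close> be its closure in \<open>H\<^sup>1(\<Gamma>)\<close>. For
  \<open>U = \<real>\<close> the condition is void and the closure is \<open>H\<^sup>1\<^sub>0(\<Gamma>)\<close>. The proof rests on two opposite effects.

  Density. However small \<open>U\<close> is in measure, between two distinct reals there is an interval inside
  \<open>U\<close>, hence a smooth step function whose derivative lives in \<open>U\<close>. Such steps of the
  coordinates separate points, and the smooth functions that are flat outside \<open>U\<close> form an algebra, so
  they are uniformly dense on compact sets by Stone-Weierstrass. Composing an approximant with a
  smooth function that kills small values forces its support into that of the target
  (\<open>core_uniform_approx\<close>), and this also gives density in \<open>L\<^sup>2\<close> (\<open>core_dense_L2\<close>). Consequently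
  half the Dirichlet integral on \<open>core_domain U \<Gamma>\<close> is a regular Dirichlet form for every open dense \<open>U\<close>
  (\<open>core_domain_regular_dirichlet_form\<close>); applied to \<open>U = \<real>\<close> and to a small \<open>U\<close> this covers both the
  form on \<open>H\<^sup>1\<^sub>0(\<Gamma>)\<close> and its subspace.

  Properness. The set \<open>U\<close> can be chosen so small that \<open>{x. x \<bullet> b \<notin> U}\<close> meets a given cube in a set
  of positive measure (\<open>open_dense_thin\<close>). There \<open>\<partial>\<^sub>b\<close> of every core function
  is zero, and this survives \<open>H\<^sup>1\<close> limits, whereas a test function that agrees with \<open>x \<bullet> b\<close> on the cube
  has \<open>\<partial>\<^sub>b = 1\<close> (\<open>core_domain_proper\<close>).

  Of the remaining axioms of a Dirichlet form, closedness comes from completeness of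
  \<open>L\<^sup>2\<close> (\<open>L2v_complete\<close>) together with the stability of weak gradients under \<open>L\<^sup>2\<close> limits, and
  that the form is well defined on classes of functions comes from the uniqueness of weak
  gradients (\<open>fundamental_lemma_of_variations\<close>).
  For the Markov property the unit contraction is replaced by smooth contractions, under which the
  core is stable; the resulting functions converge to the contracted one only in \<open>L\<^sup>2\<close>, with bounded
  energies, and \<open>core_closure_lower_semicontinuous\<close> upgrades this to membership in the domain with the
  right energy bound.
\<close>

section \<open>Calculus of smooth functions\<close>

lemma Ck_SucI:
  assumes "\<And>x. (f has_derivative f' x) (at x)" and "\<And>v. Ck k (\<lambda>x. f' x v)"
  shows "Ck (Suc k) f"
proof -
  have "frechet_derivative f (at x) = f' x" for x
    using assms(1) frechet_derivative_at by metis
  then show ?thesis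
    using assms by (auto simp: differentiable_def)
qed

lemma Ck_Suc_has_derivative:
  "Ck (Suc k) f \<Longrightarrow> (f has_derivative frechet_derivative f (at x)) (at x)"
  by (simp add: frechet_derivative_works)

lemma Ck_Suc_derivative: "Ck (Suc k) f \<Longrightarrow> Ck k (\<lambda>x. frechet_derivative f (at x) v)"
  by simp

lemma Ck_continuous_on: "Ck k f \<Longrightarrow> continuous_on S f"
proof (cases k)
  case (Suc j)
  assume "Ck k f"
  then show ?thesis
    unfolding Suc by (auto intro!: continuous_at_imp_continuous_on differentiable_imp_continuous_within)
qed (auto intro: continuous_on_subset)

lemma Ck_SucD: "Ck (Suc k) f \<Longrightarrow> Ck k f"
proof (induction k arbitrary: f)
  case 0
  then show ?case using Ck_continuous_on[OF 0] by simp
next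
  case (Suc k)
  then show ?case by (metis Ck.simps(2))
qed

lemma Ck_const: "Ck k (\<lambda>x. c)"
  by (induction k arbitrary: c) (auto intro!: Ck_SucI[where f' = "\<lambda>x v. 0"])

lemma Ck_inner: "Ck k (\<lambda>x. x \<bullet> b)"
proof (cases k)
  case (Suc j)
  show ?thesis unfolding Suc
    by (rule Ck_SucI[where f' = "\<lambda>x v. v \<bullet> b"])
       (auto intro!: derivative_eq_intros Ck_const)
qed (auto intro!: continuous_intros)

lemma Ck_add: "Ck k f \<Longrightarrow> Ck k g \<Longrightarrow> Ck k (\<lambda>x. f x + g x)"
proof (induction k arbitrary: f g)
  case 0
  then show ?case by (simp add: continuous_on_add)
next
  case (Suc k)
  show ?case
  proof (rule Ck_SucI)
    show "((\<lambda>x. f x + g x) has_derivative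
        (\<lambda>v. frechet_derivative f (at x) v + frechet_derivative g (at x) v)) (at x)" for x
      by (rule has_derivative_add[OF Suc.prems[THEN Ck_Suc_has_derivative]])
    show "Ck k (\<lambda>x. frechet_derivative f (at x) v + frechet_derivative g (at x) v)" for v
      by (intro Suc.IH Ck_Suc_derivative Suc.prems)
  qed
qed

lemma Ck_mult: "Ck k f \<Longrightarrow> Ck k g \<Longrightarrow> Ck k (\<lambda>x. f x * g x)"
proof (induction k arbitrary: f g)
  case 0
  then show ?case by (simp add: continuous_on_mult)
next
  case (Suc k)
  show ?case
  proof (rule Ck_SucI)
    show "((\<lambda>x. f x * g x) has_derivative
        (\<lambda>v. f x * frechet_derivative g (at x) v + frechet_derivative f (at x) v * g x)) (at x)" for x
      by (rule has_derivative_mult[OF Suc.prems[THEN Ck_Suc_has_derivative]])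
    show "Ck k (\<lambda>x. f x * frechet_derivative g (at x) v + frechet_derivative f (at x) v * g x)" for v
      by (intro Ck_add Suc.IH Ck_Suc_derivative Suc.prems Suc.prems[THEN Ck_SucD])
  qed
qed

lemma Ck_diff: "Ck k f \<Longrightarrow> Ck k g \<Longrightarrow> Ck k (\<lambda>x. f x - g x)"
  using Ck_add[of k f "\<lambda>x. (-1) * g x"] Ck_mult[OF Ck_const[of k "-1"], of g] by simp

lemma Ck_compose:
  fixes \<psi> :: "real \<Rightarrow> real"
  shows "Ck k \<psi> \<Longrightarrow> Ck k f \<Longrightarrow> Ck k (\<lambda>x. \<psi> (f x))"
proof (induction k arbitrary: \<psi> f)
  case 0
  then show ?case by (auto intro!: continuous_on_compose2[of UNIV \<psi> UNIV f])
next
  case (Suc k)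
  note d = Suc.prems[THEN Ck_Suc_has_derivative]
  have eq: "frechet_derivative \<psi> (at t) s = s * frechet_derivative \<psi> (at t) 1" for s t
    using linear_scale[OF has_derivative_linear[OF d(1)], of t s 1] by simp
  show ?case
  proof (rule Ck_SucI)
    show "((\<lambda>x. \<psi> (f x)) has_derivative (\<lambda>v. frechet_derivative f (at x) v * frechet_derivative \<psi> (at (f x)) 1)) (at x)" for x
      using has_derivative_compose[OF d(2) d(1)] by (subst eq[symmetric])
    show "Ck k (\<lambda>x. frechet_derivative f (at x) v * frechet_derivative \<psi> (at (f x)) 1)" for v
      by (intro Ck_mult Suc.IH[of "\<lambda>t. frechet_derivative \<psi> (at t) 1"] Ck_Suc_derivative Suc.prems Suc.prems(2)[THEN Ck_SucD])
  qed
qed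

text \<open>The derivative of \<open>1/f\<close> is \<open>- f' (1/f)\<^sup>2\<close>, a product of factors that the induction
  hypothesis covers.\<close>
lemma Ck_inverse: "Ck k f \<Longrightarrow> (\<And>x. f x \<noteq> 0) \<Longrightarrow> Ck k (\<lambda>x. inverse (f x))"
proof (induction k)
  case 0
  then show ?case by (simp add: continuous_on_inverse)
next
  case (Suc k)
  note d = Suc.prems(1)[THEN Ck_Suc_has_derivative]
  show ?case
  proof (rule Ck_SucI)
    show "((\<lambda>x. inverse (f x)) has_derivative
        (\<lambda>v. (-1) * (inverse (f x) * frechet_derivative f (at x) v * inverse (f x)))) (at x)" for x
      using Deriv.has_derivative_inverse[OF Suc.prems(2) d] by simp
    show "Ck k (\<lambda>x. (-1) * (inverse (f x) * frechet_derivative f (at x) v * inverse (f x)))" for v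
      by (intro Ck_mult Ck_const Suc.IH Ck_Suc_derivative Suc.prems Suc.prems(1)[THEN Ck_SucD])
  qed
qed

text \<open>Smoothness is local: this allows a smooth function to be extended by zero once it vanishes near
  the boundary of the set on which it is given.\<close>
lemma Ck_local:
  assumes "\<And>x. \<exists>S g. open S \<and> x \<in> S \<and> Ck k g \<and> (\<forall>y\<in>S. f y = g y)"
  shows "Ck k f"
  using assms
proof (induction k arbitrary: f)
  case 0
  have "isCont f x" for x
  proof -
    obtain S g where S: "open S" "x \<in> S" "Ck 0 g" "\<forall>y\<in>S. f y = g y"
      using 0 by blast
    then have "continuous_on S f"
      using continuous_on_cong[of S S f g] continuous_on_subset[of UNIV g S] by auto
    then show ?thesis using S continuous_on_eq_continuous_at by blast
  qed
  then show ?case by (simp add: continuous_at_imp_continuous_on)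
next
  case (Suc k)
  have d: "(f has_derivative frechet_derivative g (at x)) (at x)"
    if "open S" "x \<in> S" "Ck (Suc k) g" "\<forall>y\<in>S. f y = g y" for S g x
    using has_derivative_transform_within_open[OF Ck_Suc_has_derivative[OF that(3)] that(1,2)] that(4)
    by metis
  have d': "frechet_derivative f (at x) = frechet_derivative g (at x)"
    if "open S" "x \<in> S" "Ck (Suc k) g" "\<forall>y\<in>S. f y = g y" for S g x
    using frechet_derivative_at[OF d[OF that]] by simp
  show ?case
  proof (rule Ck_SucI[where f' = "\<lambda>x. frechet_derivative f (at x)"])
    show "(f has_derivative frechet_derivative f (at x)) (at x)" for x
      using Suc.prems[of x] d d' by metis
    show "Ck k (\<lambda>x. frechet_derivative f (at x) v)" for v
    proof (rule Suc.IH)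
      fix x
      obtain S g where S: "open S" "x \<in> S" "Ck (Suc k) g" "\<forall>y\<in>S. f y = g y"
        using Suc.prems by blast
      then have "\<forall>y\<in>S. frechet_derivative f (at y) v = frechet_derivative g (at y) v"
        using d' by metis
      then show "\<exists>S g. open S \<and> x \<in> S \<and> Ck k g \<and> (\<forall>y\<in>S. frechet_derivative f (at y) v = g y)"
        using S(1,2) Ck_Suc_derivative[OF S(3)] by blast
    qed
  qed
qed

lemma Ck_real_SucI:
  fixes f :: "real \<Rightarrow> real"
  assumes "\<And>t. (f has_real_derivative f' t) (at t)" and "Ck k f'"
  shows "Ck (Suc k) f"
  by (rule Ck_SucI[where f' = "\<lambda>t v. f' t * v"])
     (use assms in \<open>auto simp: has_field_derivative_def intro: Ck_mult Ck_const\<close>)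

lemma Ck_real_from_derivative:
  fixes f :: "real \<Rightarrow> real"
  assumes "\<And>t. (f has_real_derivative f' t) (at t)" and "\<And>k. Ck k f'"
  shows "Ck k f"
  using Ck_real_SucI[OF assms] Ck_SucD by blast

lemma Ck_exp: "Ck k (exp :: real \<Rightarrow> real)"
proof (induction k)
  case (Suc k)
  show ?case by (rule Ck_real_SucI[OF DERIV_exp Suc])
qed (auto intro!: continuous_intros)

section \<open>Smooth functions of one variable\<close>

text \<open>The functions \<open>t\<^sup>-\<^sup>n exp (-1/t)\<close>, extended by zero. The whole family is closed under
  differentiation up to linear combinations, so that all its members can be shown to be smooth at once.\<close>
definition flat_exp :: "nat \<Rightarrow> real \<Rightarrow> real" where
  "flat_exp n t = (if t \<le> 0 then 0 else exp (- inverse t) * inverse t ^ n)"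

lemma flat_exp_tendsto_0: "(flat_exp n \<longlongrightarrow> 0) (at 0)"
proof -
  have lim: "((\<lambda>s::real. s ^ n / exp s) \<longlongrightarrow> 0) at_top"
    by (rule tendsto_power_div_exp_0)
  have "((\<lambda>t. (inverse t)^n / exp (inverse t)) \<longlongrightarrow> 0) (at_right (0::real))"
    by (rule filterlim_compose[OF lim filterlim_inverse_at_top_right])
  moreover have "\<forall>\<^sub>F t in at_right 0. (inverse t)^n / exp (inverse t) = flat_exp n t"
    unfolding eventually_at_right_field
    by (intro exI[of _ 1]) (auto simp: flat_exp_def exp_minus field_simps)
  ultimately have R: "(flat_exp n \<longlongrightarrow> 0) (at_right 0)"
    by (rule Lim_transform_eventually)
  have "\<forall>\<^sub>F t in at_left 0. flat_exp n t = 0"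
    unfolding eventually_at_left_field
    by (intro exI[of _ "-1"]) (auto simp: flat_exp_def)
  then have L: "(flat_exp n \<longlongrightarrow> 0) (at_left 0)"
    by (rule tendsto_eventually)
  show ?thesis using L R by (rule filterlim_split_at)
qed

lemma flat_exp_has_derivative:
  "(flat_exp n has_real_derivative (flat_exp (n + 2) t - real n * flat_exp (n + 1) t)) (at t)"
proof -
  consider "t < 0" | "t = 0" | "t > 0" by linarith
  then show ?thesis
  proof cases
    case 1
    have "((\<lambda>t. 0) has_real_derivative 0) (at t)" by simp
    then have "(flat_exp n has_real_derivative 0) (at t)"
      by (rule has_field_derivative_transform_within_open[where S = "{..<0}"])
         (use 1 in \<open>auto simp: flat_exp_def\<close>)
    then show ?thesis using 1 by (simp add: flat_exp_def)
  next
    case 2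
    have "flat_exp n h / h = flat_exp (Suc n) h" for h
      by (simp add: flat_exp_def divide_inverse)
    then have "(flat_exp n has_real_derivative 0) (at 0)"
      using flat_exp_tendsto_0[of "Suc n"]
      by (simp add: DERIV_def flat_exp_def[of _ 0])
    then show ?thesis using 2 by (simp add: flat_exp_def)
  next
    case 3
    define r where "r = inverse t"
    have d1: "((\<lambda>t. exp (- inverse t)) has_real_derivative exp (- r) * r\<^sup>2) (at t)"
      using 3 by (auto intro!: derivative_eq_intros simp: r_def power2_eq_square)
    have d2: "((\<lambda>t. inverse t ^ n) has_real_derivative - (real n * r ^ (n + 1))) (at t)"
    proof -
      have "(inverse has_real_derivative - (r * r)) (at t)"
        using 3 DERIV_inverse[of t UNIV] by (simp add: r_def power2_eq_square)
      from DERIV_power[OF this, of n] show ?thesis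
        by (cases n) (auto simp: r_def mult.assoc)
    qed
    have "((\<lambda>t. exp (- inverse t) * inverse t ^ n) has_real_derivative
        exp (- inverse t) * inverse t ^ (n + 2) - real n * (exp (- inverse t) * inverse t ^ (n + 1))) (at t)"
      using DERIV_mult[OF d1 d2] by (simp add: r_def power_add algebra_simps power2_eq_square)

    then have "(flat_exp n has_real_derivative
        exp (- inverse t) * inverse t ^ (n + 2) - real n * (exp (- inverse t) * inverse t ^ (n + 1))) (at t)"
      by (rule has_field_derivative_transform_within_open[where S = "{0<..}"])
         (use 3 in \<open>auto simp: flat_exp_def\<close>)
    then show ?thesis using 3 by (simp add: flat_exp_def)
  qed
qed

lemma Ck_flat_exp: "Ck k (flat_exp n)"
proof (induction k arbitrary: n)
  case 0
  then show ?case
    using DERIV_continuous[OF flat_exp_has_derivative]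
    by (auto intro!: continuous_at_imp_continuous_on)
next
  case (Suc k)
  show ?case
    by (rule Ck_real_SucI[OF flat_exp_has_derivative]) (intro Ck_diff Ck_mult Ck_const Suc)
qed

text \<open>A smooth transition from \<open>0\<close> on \<open>{..a}\<close> to \<open>1\<close> on \<open>{b..}\<close>.\<close>
definition smooth_step :: "real \<Rightarrow> real \<Rightarrow> real \<Rightarrow> real" where
  "smooth_step a b t = flat_exp 0 (t - a) * inverse (flat_exp 0 (t - a) + flat_exp 0 (b - t))"

lemma smooth_step_denominator_pos:
  "a < b \<Longrightarrow> flat_exp 0 (t - a) + flat_exp 0 (b - t) > 0"
  by (simp add: flat_exp_def add_pos_pos)

lemma smooth_step_left: "t \<le> a \<Longrightarrow> smooth_step a b t = 0"
  by (simp add: smooth_step_def flat_exp_def)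

lemma smooth_step_right: "a < b \<Longrightarrow> b \<le> t \<Longrightarrow> smooth_step a b t = 1"
  by (simp add: smooth_step_def flat_exp_def)

lemma smooth_step_bounds: "a < b \<Longrightarrow> 0 \<le> smooth_step a b t \<and> smooth_step a b t \<le> 1"
  using smooth_step_denominator_pos[of a b t]
  by (auto simp: smooth_step_def flat_exp_def field_simps)

lemma Ck_affine: "Ck k (\<lambda>t::real. c * t + d)"
  by (intro Ck_add Ck_mult Ck_const) (use Ck_inner[of k "1::real"] in simp)

lemma Ck_smooth_step: "a < b \<Longrightarrow> Ck k (smooth_step a b)"
proof -
  assume ab: "a < b"
  have 1: "Ck k (\<lambda>t. flat_exp 0 (t - a))"
    using Ck_compose[OF Ck_flat_exp Ck_affine[of k 1 "-a"]] by simp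
  have 2: "Ck k (\<lambda>t. flat_exp 0 (b - t))"
    using Ck_compose[OF Ck_flat_exp Ck_affine[of k "-1" b]] by (simp add: algebra_simps)
  have "Ck k (\<lambda>t. flat_exp 0 (t - a) * inverse (flat_exp 0 (t - a) + flat_exp 0 (b - t)))"
    by (intro Ck_mult Ck_inverse Ck_add 1 2) (use smooth_step_denominator_pos[OF ab] in \<open>metis less_irrefl\<close>)
  then show ?thesis by (simp add: smooth_step_def[abs_def])
qed

lemma frechet_derivative_local_const:
  assumes "open S" "x \<in> S" "\<And>y. y \<in> S \<Longrightarrow> f y = (c::real)"
  shows "frechet_derivative f (at x) v = 0"
proof -
  have "(f has_derivative (\<lambda>v. 0)) (at x)"
    by (rule has_derivative_transform_within_open[OF has_derivative_const[of c] assms(1,2)])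
       (use assms(3) in auto)
  then show ?thesis by (metis frechet_derivative_at)
qed

text \<open>Off \<open>{a..b}\<close> the step is locally constant; at the two end points the derivative vanishes
  because it is continuous.\<close>
lemma smooth_step_flat:
  assumes "a < b" "t \<notin> {a<..<b}"
  shows "frechet_derivative (smooth_step a b) (at t) v = 0"
proof -
  let ?d = "\<lambda>t. frechet_derivative (smooth_step a b) (at t) v"
  have c: "continuous_on UNIV ?d"
    using Ck_smooth_step[OF assms(1), of "Suc 0"] by simp
  have l: "?d s = 0" if "s < a" for s
    by (rule frechet_derivative_local_const[where S = "{..<a}" and c = 0])
       (use that smooth_step_left in auto)
  have r: "?d s = 0" if "s > b" for s
    by (rule frechet_derivative_local_const[where S = "{b<..}" and c = 1])
       (use that smooth_step_right assms in auto)
  have cl: "closed {s. ?d s = 0}"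
    using c by (intro closed_Collect_eq continuous_intros)
  have "{..a} \<subseteq> {s. ?d s = 0}"
    using closure_minimal[OF _ cl, of "{..<a}"] l by (auto simp: subset_iff)
  moreover have "{b..} \<subseteq> {s. ?d s = 0}"
    using closure_minimal[OF _ cl, of "{b<..}"] r by (auto simp: subset_iff)
  ultimately show ?thesis using assms(2)
    by (metis (mono_tags, lifting) atLeast_iff atMost_iff greaterThanLessThan_iff mem_Collect_eq not_less subsetD)
qed

text \<open>A smooth approximation of \<open>max 0 t\<close> with error at most \<open>e\<close>; its derivative is the logistic
  function, which lies between \<open>0\<close> and \<open>1\<close>.\<close>
definition softplus :: "real \<Rightarrow> real \<Rightarrow> real" where
  "softplus e t = e * ln (1 + exp (t / e))"

lemma softplus_bounds:
  assumes "e > 0"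
  shows "max 0 t \<le> softplus e t" "softplus e t \<le> max 0 t + e"
proof -
  have e2: "softplus e t = e * ln (1 + exp (t/e))" by (simp add: softplus_def)
  have "ln (exp (t/e)) \<le> ln (1 + exp (t/e))"
    by (subst ln_le_cancel_iff) (auto simp: add_pos_pos)
  then have "t \<le> softplus e t" using assms by (simp add: e2 field_simps)
  moreover have "0 \<le> softplus e t" using assms by (simp add: e2 add_pos_pos)
  ultimately show "max 0 t \<le> softplus e t" by simp
  have "1 + exp (t/e) \<le> exp (max 0 t / e) * exp 1"
  proof -
    have "0 \<le> max 0 t / e" "t / e \<le> max 0 t / e"
      using assms by (auto simp: divide_right_mono)
    then have "1 \<le> exp (max 0 t / e)" "exp (t/e) \<le> exp (max 0 t / e)"
      by (simp_all only: one_le_exp_iff exp_le_cancel_iff)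
    then have "1 + exp (t/e) \<le> exp (max 0 t/e) * 2" by linarith
    also have "\<dots> \<le> exp (max 0 t / e) * exp 1"
      using exp_ge_add_one_self[of 1] by (intro mult_left_mono) auto
    finally show ?thesis .
  qed
  then have "ln (1 + exp (t/e)) \<le> ln (exp (max 0 t / e) * exp 1)"
    by (subst ln_le_cancel_iff) (auto simp: add_pos_pos)
  also have "\<dots> = max 0 t / e + 1" by (simp add: ln_mult)
  finally show "softplus e t \<le> max 0 t + e" using assms by (simp add: e2 field_simps)
qed

definition logistic :: "real \<Rightarrow> real" where
  "logistic t = inverse (1 + exp (- t))"

lemma softplus_has_derivative:
  assumes "e > 0"
  shows "(softplus e has_real_derivative logistic (t / e)) (at t)"
proof -
  have p: "1 + exp (t/e) > 0" by (simp add: add_pos_pos)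
  have "((\<lambda>t. e * ln (1 + exp (t / e))) has_real_derivative e * (exp (t/e) * inverse e / (1 + exp (t/e)))) (at t)"
    using p assms by (auto intro!: derivative_eq_intros simp: divide_inverse)
  moreover have "e * (exp (t/e) * inverse e / (1 + exp (t/e))) = exp (t/e) / (1 + exp (t/e))"
    using assms by simp
  moreover have "exp (t/e) / (1 + exp (t/e)) = logistic (t/e)"
  proof -
    have "exp (t/e) * (1 + exp (- (t/e))) = 1 + exp (t/e)"
      by (simp add: distrib_left exp_minus)
    from this[symmetric] show ?thesis
      by (simp only: logistic_def) (simp add: divide_inverse)
  qed
  ultimately show ?thesis by (simp add: softplus_def[abs_def])
qed

text \<open>Since \<open>min 1 (max 0 t) = max 0 t - max 0 (t - 1)\<close>, a difference of two softplus functions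
  approximates the unit contraction; the subtracted constant makes it vanish at \<open>0\<close>, so that
  composition with it preserves compact supports.\<close>
definition smooth_unit_cut :: "real \<Rightarrow> real \<Rightarrow> real" where
  "smooth_unit_cut e t = softplus e t - softplus e (t - 1) - (softplus e 0 - softplus e (- 1))"

lemma smooth_unit_cut_0: "smooth_unit_cut e 0 = 0"
  by (simp add: smooth_unit_cut_def)

lemma smooth_unit_cut_approx:
  assumes "e > 0"
  shows "\<bar>smooth_unit_cut e t - min 1 (max 0 t)\<bar> \<le> 4 * e"
proof -
  have "min 1 (max 0 t) = max 0 t - max 0 (t - 1)" by (auto simp: min_def max_def)
  then show ?thesis
    using softplus_bounds[OF assms, of t] softplus_bounds[OF assms, of "t-1"]
      softplus_bounds[OF assms, of 0] softplus_bounds[OF assms, of "-1"]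
    unfolding smooth_unit_cut_def by (simp only:) linarith
qed

definition smooth_unit_cut' :: "real \<Rightarrow> real \<Rightarrow> real" where
  "smooth_unit_cut' e t = logistic (t / e) - logistic ((t - 1) / e)"

lemma smooth_unit_cut_has_derivative:
  assumes "e > 0"
  shows "(smooth_unit_cut e has_real_derivative smooth_unit_cut' e t) (at t)"
proof -
  have "((\<lambda>t. softplus e (t - 1)) has_real_derivative logistic ((t - 1) / e)) (at t)"
    using DERIV_shift[of "softplus e" "logistic ((t-1)/e)" t "-1"] softplus_has_derivative[OF assms] by simp
  from DERIV_diff[OF DERIV_diff[OF softplus_has_derivative[OF assms] this] DERIV_const]
  show ?thesis
    unfolding smooth_unit_cut_def[abs_def] smooth_unit_cut'_def by simp
qed

text \<open>The logistic function is increasing with values in \<open>[0, 1]\<close>; hence the smooth cut is itself a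
  contraction, and composition with it does not increase the energy of a function.\<close>
lemma smooth_unit_cut'_bounds:
  assumes "e > 0"
  shows "0 \<le> smooth_unit_cut' e t" "smooth_unit_cut' e t \<le> 1"
proof -
  have p: "1 + exp (- s) > 0" for s :: real by (simp add: add_pos_pos)
  have b: "0 \<le> logistic s" "logistic s \<le> 1" for s
    using p[of s] by (auto simp: logistic_def field_simps)
  have "logistic ((t - 1) / e) \<le> logistic (t / e)"
    unfolding logistic_def using assms p by (intro le_imp_inverse_le) (auto simp: divide_right_mono)
  then show "0 \<le> smooth_unit_cut' e t" "smooth_unit_cut' e t \<le> 1"
    using b[of "t/e"] b[of "(t-1)/e"] unfolding smooth_unit_cut'_def by linarith+
qed

lemma smooth_unit_cut_lipschitz:
  assumes "e > 0" shows "\<bar>smooth_unit_cut e s - smooth_unit_cut e t\<bar> \<le> \<bar>s - t\<bar>"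
proof -
  have *: "\<bar>smooth_unit_cut e b - smooth_unit_cut e a\<bar> \<le> \<bar>b - a\<bar>" if ab: "a < b" for a b
  proof -
    obtain z where z: "smooth_unit_cut e b - smooth_unit_cut e a = (b - a) * smooth_unit_cut' e z"
      using MVT2[OF ab, of "smooth_unit_cut e" "smooth_unit_cut' e"] smooth_unit_cut_has_derivative[OF assms] by blast
    have "\<bar>b - a\<bar> * \<bar>smooth_unit_cut' e z\<bar> \<le> \<bar>b - a\<bar> * 1"
      using smooth_unit_cut'_bounds[OF assms, of z] by (intro mult_left_mono) auto
    then show ?thesis by (simp add: z abs_mult)
  qed
  consider "s < t" | "s = t" | "t < s" by linarith
  then show ?thesis using *[of s t] *[of t s] by cases (simp_all add: abs_minus_commute)
qed

lemma Ck_smooth_unit_cut: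
  assumes "e > 0" shows "Ck k (smooth_unit_cut e)"
proof (rule Ck_real_from_derivative[OF smooth_unit_cut_has_derivative[OF assms]])
  fix k
  have "Ck k logistic"
    unfolding logistic_def[abs_def]
    by (intro Ck_inverse Ck_add Ck_const) 
       (use Ck_compose[OF Ck_exp Ck_affine[of k "-1" 0]] add_pos_pos[OF zero_less_one exp_gt_zero] in \<open>simp, metis less_irrefl\<close>)
  then have "Ck k (\<lambda>t. logistic (c * t + d))" for c d
    by (rule Ck_compose[OF _ Ck_affine])
  from Ck_diff[OF this[of "inverse e" 0] this[of "inverse e" "- inverse e"]]
  have "Ck k (\<lambda>t. logistic (inverse e * t + 0) - logistic (inverse e * t + - inverse e))" .
  moreover have "logistic (inverse e * t + 0) - logistic (inverse e * t + - inverse e) = smooth_unit_cut' e t" for t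
    by (simp add: smooth_unit_cut'_def divide_inverse algebra_simps)
  ultimately show "Ck k (smooth_unit_cut' e)" by simp
qed

section \<open>Test functions that are flat outside an open set of coordinates\<close>

lemma frechet_derivative_add_Ck:
  assumes "Ck (Suc 0) f" "Ck (Suc 0) g"
  shows "frechet_derivative (\<lambda>x. f x + g x) (at x) v = frechet_derivative f (at x) v + frechet_derivative g (at x) v"
  using frechet_derivative_at[OF has_derivative_add[OF assms[THEN Ck_Suc_has_derivative]]] by metis

lemma frechet_derivative_mult_Ck:
  assumes "Ck (Suc 0) f" "Ck (Suc 0) g"
  shows "frechet_derivative (\<lambda>x. f x * g x) (at x) v = f x * frechet_derivative g (at x) v + frechet_derivative f (at x) v * g x"
  using frechet_derivative_at[OF has_derivative_mult[OF assms[THEN Ck_Suc_has_derivative]]] by metis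

lemma frechet_derivative_compose_Ck:
  fixes \<psi> :: "real \<Rightarrow> real"
  assumes "Ck (Suc 0) \<psi>" "Ck (Suc 0) f"
  shows "frechet_derivative (\<lambda>x. \<psi> (f x)) (at x) v = frechet_derivative \<psi> (at (f x)) (frechet_derivative f (at x) v)"
  using frechet_derivative_at[OF has_derivative_compose[OF assms(2,1)[THEN Ck_Suc_has_derivative]]] by metis

lemma frechet_derivative_linear_Ck:
  "Ck (Suc 0) f \<Longrightarrow> linear (frechet_derivative f (at x))"
  by (rule has_derivative_linear[OF Ck_Suc_has_derivative])

lemma frechet_derivative_inner: "frechet_derivative (\<lambda>x. x \<bullet> b) (at x) v = v \<bullet> b"
proof -
  have "((\<lambda>x. x \<bullet> b) has_derivative (\<lambda>v. v \<bullet> b)) (at x)" by (auto intro!: derivative_eq_intros)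
  then show ?thesis by (metis frechet_derivative_at)
qed

text \<open>Requiring flatness in all coordinate directions, rather than in a single one, keeps the definition
  free of a chosen direction.\<close>
definition smooth_flat :: "real set \<Rightarrow> ('a::euclidean_space \<Rightarrow> real) \<Rightarrow> bool" where
  "smooth_flat U a \<longleftrightarrow>
     (\<forall>k. Ck k a) \<and> (\<forall>b\<in>Basis. \<forall>x. x \<bullet> b \<notin> U \<longrightarrow> frechet_derivative a (at x) b = 0)"

lemma smooth_flat_Ck: "smooth_flat U a \<Longrightarrow> Ck k a"
  by (simp add: smooth_flat_def)

lemma smooth_flat_const: "smooth_flat U (\<lambda>x. c)"
  unfolding smooth_flat_def by (simp add: Ck_const)

lemma smooth_flat_add: "smooth_flat U f \<Longrightarrow> smooth_flat U g \<Longrightarrow> smooth_flat U (\<lambda>x. f x + g x)"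
  unfolding smooth_flat_def by (simp only: Ck_add frechet_derivative_add_Ck) simp

lemma smooth_flat_mult: "smooth_flat U f \<Longrightarrow> smooth_flat U g \<Longrightarrow> smooth_flat U (\<lambda>x. f x * g x)"
  unfolding smooth_flat_def by (simp only: Ck_mult frechet_derivative_mult_Ck) simp

lemma smooth_flat_compose:
  fixes \<psi> :: "real \<Rightarrow> real"
  assumes "\<And>k. Ck k \<psi>" "smooth_flat U f"
  shows "smooth_flat U (\<lambda>x. \<psi> (f x))"
proof -
  have "frechet_derivative \<psi> (at t) 0 = 0" for t
    by (rule linear_0[OF frechet_derivative_linear_Ck[OF assms(1)]])
  then show ?thesis
    using assms unfolding smooth_flat_def by (simp only: Ck_compose frechet_derivative_compose_Ck) simp
qed

lemma smooth_flat_step_coordinate: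
  assumes "b \<in> Basis" "c < d" "{c<..<d} \<subseteq> U"
  shows "smooth_flat U (\<lambda>x. smooth_step c d (x \<bullet> b))"
  unfolding smooth_flat_def
proof (intro conjI allI ballI impI)
  show "Ck k (\<lambda>x. smooth_step c d (x \<bullet> b))" for k
    by (rule Ck_compose[OF Ck_smooth_step[OF assms(2)] Ck_inner])
  fix e x :: 'a assume e: "e \<in> Basis" "x \<bullet> e \<notin> U"
  have eq: "frechet_derivative (\<lambda>x. smooth_step c d (x \<bullet> b)) (at x) e =
      frechet_derivative (smooth_step c d) (at (x \<bullet> b)) (e \<bullet> b)"
    by (simp only: frechet_derivative_compose_Ck[OF Ck_smooth_step[OF assms(2)] Ck_inner] frechet_derivative_inner)
  show "frechet_derivative (\<lambda>x. smooth_step c d (x \<bullet> b)) (at x) e = 0"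
  proof (cases "e = b")
    case True
    then show ?thesis unfolding eq using smooth_step_flat[OF assms(2)] assms(3) e(2) by blast
  next
    case False
    then have "e \<bullet> b = 0" using e assms(1) by (simp add: inner_Basis)
    then show ?thesis unfolding eq
      using linear_0[OF frechet_derivative_linear_Ck[OF Ck_smooth_step[OF assms(2)]]] by metis
  qed
qed

text \<open>Two distinct points differ in some coordinate; by density \<open>U\<close> contains an interval between the
  two coordinates, and a smooth step across that interval separates the points.\<close>
lemma smooth_flat_separates:
  assumes "open U" "closure U = UNIV" "x \<noteq> y"
  shows "\<exists>f. smooth_flat U f \<and> f x \<noteq> f y"
proof -
  have *: "\<exists>f. smooth_flat U f \<and> f x \<noteq> f y" if "b \<in> Basis" "x \<bullet> b < y \<bullet> b" for b x y :: 'a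
  proof -
    have "{x \<bullet> b<..<y \<bullet> b} \<inter> U \<noteq> {}"
      using open_Int_closure_eq_empty[of "{x \<bullet> b<..<y \<bullet> b}" U] assms(2) that(2) by simp
    then obtain t where t: "t \<in> U \<inter> {x \<bullet> b<..<y \<bullet> b}" by blast
    moreover have "open (U \<inter> {x \<bullet> b<..<y \<bullet> b})" using assms(1) by auto
    ultimately obtain r where r: "r > 0" "ball t r \<subseteq> U \<inter> {x \<bullet> b<..<y \<bullet> b}"
      by (meson openE)
    let ?c = "t - r/2" and ?d = "t + r/2"
    have in_ball: "s \<in> ball t r" if "?c \<le> s" "s \<le> ?d" for s
      using that r(1) by (auto simp: dist_real_def)
    have cd: "?c < ?d" "?c \<in> ball t r" "?d \<in> ball t r" using r(1) by (auto simp: dist_real_def)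
    have sf: "smooth_flat U (\<lambda>x. smooth_step ?c ?d (x \<bullet> b))"
      using in_ball r(2) by (intro smooth_flat_step_coordinate[OF that(1) cd(1)]) fastforce
    have "x \<bullet> b \<le> ?c" "?d \<le> y \<bullet> b"
      using subsetD[OF r(2) cd(2)] subsetD[OF r(2) cd(3)] by simp_all
    then have "smooth_step ?c ?d (x \<bullet> b) = 0" "smooth_step ?c ?d (y \<bullet> b) = 1"
      using smooth_step_left smooth_step_right[OF cd(1)] by auto
    then show ?thesis using sf by (intro exI[of _ "\<lambda>x. smooth_step ?c ?d (x \<bullet> b)"]) simp
  qed
  obtain b where "b \<in> Basis" "x \<bullet> b \<noteq> y \<bullet> b"
    using assms(3) euclidean_eq_iff by blast
  then consider "x \<bullet> b < y \<bullet> b" | "y \<bullet> b < x \<bullet> b" by linarith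
  then show ?thesis
    using *[OF \<open>b \<in> Basis\<close>, of x y] *[OF \<open>b \<in> Basis\<close>, of y x] by cases metis+
qed

lemma smooth_flat_dense:
  fixes g :: "'a::euclidean_space \<Rightarrow> real"
  assumes "open U" "closure U = UNIV" "compact S" "continuous_on S g" "\<epsilon> > 0"
  obtains a where "smooth_flat U a" "\<And>x. x \<in> S \<Longrightarrow> \<bar>g x - a x\<bar> < \<epsilon>"
proof -
  interpret function_ring_on "Collect (smooth_flat U)" S
    by standard (use assms smooth_flat_separates[OF assms(1,2)] in
      \<open>auto intro: smooth_flat_add smooth_flat_mult smooth_flat_const Ck_continuous_on[OF smooth_flat_Ck]\<close>)
  show ?thesis
    using Stone_Weierstrass_basic[OF assms(4,5)] that by auto
qed

definition core :: "real set \<Rightarrow> 'a::euclidean_space set \<Rightarrow> ('a \<Rightarrow> real) set" where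
  "core U \<Gamma> = {\<phi> \<in> test_functions \<Gamma>. smooth_flat U \<phi>}"

lemma core_UNIV: "core UNIV \<Gamma> = test_functions \<Gamma>"
  by (auto simp: core_def smooth_flat_def test_functions_def)

lemma core_iff:
  "\<phi> \<in> core U \<Gamma> \<longleftrightarrow>
     smooth_flat U \<phi> \<and> (\<exists>K. compact K \<and> K \<subseteq> \<Gamma> \<and> (\<forall>x. x \<notin> K \<longrightarrow> \<phi> x = 0))"
  by (auto simp: core_def smooth_flat_def test_functions_def)

lemma core_subset_test_functions: "core U \<Gamma> \<subseteq> test_functions \<Gamma>"
  by (auto simp: core_def)

lemma core_zero: "(\<lambda>x. 0) \<in> core U \<Gamma>"
  unfolding core_iff by (intro conjI exI[of _ "{}"] smooth_flat_const) auto

lemma core_add: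
  assumes "\<phi> \<in> core U \<Gamma>" "\<psi> \<in> core U \<Gamma>" shows "(\<lambda>x. \<phi> x + \<psi> x) \<in> core U \<Gamma>"
proof -
  obtain K L where "compact K" "K \<subseteq> \<Gamma>" "\<forall>x. x \<notin> K \<longrightarrow> \<phi> x = 0"
    and "compact L" "L \<subseteq> \<Gamma>" "\<forall>x. x \<notin> L \<longrightarrow> \<psi> x = 0"
    using assms unfolding core_iff by blast
  then show ?thesis
    using assms unfolding core_iff
    by (intro conjI smooth_flat_add exI[of _ "K \<union> L"]) (auto intro: compact_Un)
qed

lemma core_mult:
  assumes "smooth_flat U a" "\<phi> \<in> core U \<Gamma>" shows "(\<lambda>x. a x * \<phi> x) \<in> core U \<Gamma>"
proof -
  obtain K where "compact K" "K \<subseteq> \<Gamma>" "\<forall>x. x \<notin> K \<longrightarrow> \<phi> x = 0" and "smooth_flat U \<phi>"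
    using assms(2) unfolding core_iff by blast
  then show ?thesis
    unfolding core_iff by (intro conjI smooth_flat_mult assms(1) exI[of _ K]) auto
qed

lemma core_scale: "\<phi> \<in> core U \<Gamma> \<Longrightarrow> (\<lambda>x. c * \<phi> x) \<in> core U \<Gamma>"
  by (rule core_mult[OF smooth_flat_const])

lemma core_compose:
  fixes \<psi> :: "real \<Rightarrow> real"
  assumes "\<And>k. Ck k \<psi>" "\<psi> 0 = 0" "\<phi> \<in> core U \<Gamma>"
  shows "(\<lambda>x. \<psi> (\<phi> x)) \<in> core U \<Gamma>"
proof -
  obtain K where K: "compact K" "K \<subseteq> \<Gamma>" "\<forall>x. x \<notin> K \<longrightarrow> \<phi> x = 0" and f: "smooth_flat U \<phi>"
    using assms(3) unfolding core_iff by blast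
  have "smooth_flat U (\<lambda>x. \<psi> (\<phi> x))"
    by (rule smooth_flat_compose[OF assms(1) f])
  moreover have "\<forall>x. x \<notin> K \<longrightarrow> \<psi> (\<phi> x) = 0" using K(3) assms(2) by simp
  ultimately show ?thesis
    unfolding core_iff using K(1,2) by iprover
qed

text \<open>Stone-Weierstrass gives a flat smooth \<open>a\<close> near \<open>g\<close> on a large ball, but without compact support.
  Outside \<open>Q\<close> the values of \<open>a\<close> are small, so composing \<open>a\<close> with a smooth \<open>\<Phi>\<close> that vanishes near
  \<open>0\<close> and stays close to the identity repairs this: \<open>\<Phi> \<circ> a\<close> vanishes on the part of the ball outside
  \<open>Q\<close> and can be continued by zero. The approximant vanishes outside \<open>Q\<close> just as \<open>g\<close> does,
  so that uniform estimates turn into \<open>L\<^sup>2\<close> estimates.\<close>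
lemma core_uniform_approx:
  fixes g :: "'a::euclidean_space \<Rightarrow> real"
  assumes U: "open U" "closure U = UNIV"
    and Q: "compact Q" "Q \<subseteq> \<Gamma>"
    and g: "continuous_on UNIV g" "\<And>x. x \<notin> Q \<Longrightarrow> g x = 0" and "\<epsilon> > 0"
  obtains \<phi> where "\<phi> \<in> core U \<Gamma>" "\<And>x. x \<notin> Q \<Longrightarrow> \<phi> x = 0" "\<And>x. \<bar>\<phi> x - g x\<bar> < \<epsilon>"
proof -
  obtain R where R: "Q \<subseteq> ball 0 R"
    using bounded_subset_ballD[OF compact_imp_bounded[OF Q(1)], of 0] by blast
  \<comment> \<open>the error of the approximant is at most \<open>2 * d\<close> from \<open>\<Phi>\<close> plus \<open>d\<close> from \<open>a\<close>\<close>
  define d where "d = \<epsilon> / 4"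
  have d: "d > 0" using \<open>\<epsilon> > 0\<close> by (simp add: d_def)
  obtain a where a: "smooth_flat U a" "\<And>x. x \<in> cball 0 R \<Longrightarrow> \<bar>g x - a x\<bar> < d"
    using smooth_flat_dense[OF U compact_cball continuous_on_subset[OF g(1) subset_UNIV] d] by metis
  \<comment> \<open>the step is applied to \<open>t\<^sup>2\<close> because \<open>\<bar>t\<bar>\<close> is not smooth\<close>
  define \<Phi> where "\<Phi> t = t * smooth_step (d\<^sup>2) ((2*d)\<^sup>2) (t * t)" for t
  have dd: "d\<^sup>2 < (2*d)\<^sup>2" using d by (simp add: power2_eq_square)
  have \<Phi>_smooth: "Ck k \<Phi>" for k
  proof -
    have id: "Ck k (\<lambda>t::real. t)" using Ck_inner[of k "1::real"] by simp
    show ?thesis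
      unfolding \<Phi>_def by (rule Ck_mult[OF id Ck_compose[OF Ck_smooth_step[OF dd] Ck_mult[OF id id]]])
  qed
  have \<Phi>_0: "\<Phi> t = 0" if "\<bar>t\<bar> \<le> d" for t
  proof -
    have "t * t \<le> d\<^sup>2" using that d power2_le_iff_abs_le[of d t] by (simp add: power2_eq_square)
    then show ?thesis by (simp add: \<Phi>_def smooth_step_left)
  qed
  have \<Phi>_approx: "\<bar>\<Phi> t - t\<bar> \<le> 2 * d" for t
  proof (cases "\<bar>t\<bar> \<le> 2*d")
    case True
    have "\<bar>\<Phi> t - t\<bar> = \<bar>t\<bar> * \<bar>smooth_step (d\<^sup>2) ((2*d)\<^sup>2) (t * t) - 1\<bar>"
      by (simp add: \<Phi>_def abs_mult[symmetric] right_diff_distrib)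
    also have "\<dots> \<le> \<bar>t\<bar> * 1"
      using smooth_step_bounds[OF dd, of "t * t"] by (intro mult_left_mono) auto
    finally show ?thesis using True by simp
  next
    case False
    then have "(2*d)\<^sup>2 \<le> t * t" using d abs_le_square_iff[of "2*d" t] by (simp add: power2_eq_square)
    then have "\<Phi> t = t" unfolding \<Phi>_def by (simp only: smooth_step_right[OF dd] mult_1_right)
    then show ?thesis using d by simp
  qed
  define \<phi> where "\<phi> x = (if x \<in> Q then \<Phi> (a x) else 0)" for x
  have eq1: "\<phi> x = \<Phi> (a x)" if "x \<in> ball 0 R" for x
    using a(2)[of x] g(2)[of x] that \<Phi>_0[of "a x"] by (auto simp: \<phi>_def)
  have comp: "smooth_flat U (\<lambda>x. \<Phi> (a x))"
    by (rule smooth_flat_compose[OF \<Phi>_smooth a(1)])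
  have cover: "x \<in> ball 0 R \<or> x \<in> - Q" for x using R by blast
  have opQ: "open (- Q)" using Q(1) compact_imp_closed by blast
  have "smooth_flat U \<phi>"
    unfolding smooth_flat_def
  proof (intro conjI allI ballI impI)
    fix k
    show "Ck k \<phi>"
    proof (rule Ck_local)
      fix x
      show "\<exists>S g. open S \<and> x \<in> S \<and> Ck k g \<and> (\<forall>y\<in>S. \<phi> y = g y)"
        using cover[of x]
      proof
        assume "x \<in> ball 0 R"
        then show ?thesis using eq1 smooth_flat_Ck[OF comp] open_ball by blast
      next
        assume "x \<in> - Q"
        then show ?thesis using opQ Ck_const[of k 0] by (intro exI[of _ "- Q"] exI[of _ "\<lambda>x. 0"]) (auto simp: \<phi>_def)
      qed
    qed
  next
    fix b x :: 'a assume b: "b \<in> Basis" "x \<bullet> b \<notin> U"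
    show "frechet_derivative \<phi> (at x) b = 0"
      using cover[of x]
    proof
      assume x: "x \<in> ball 0 R"
      have "(\<phi> has_derivative frechet_derivative (\<lambda>x. \<Phi> (a x)) (at x)) (at x)"
        by (rule has_derivative_transform_within_open[OF Ck_Suc_has_derivative[OF smooth_flat_Ck[OF comp]] open_ball x])
           (use eq1 in auto)
      then have "frechet_derivative \<phi> (at x) = frechet_derivative (\<lambda>x. \<Phi> (a x)) (at x)"
        by (metis frechet_derivative_at)
      then show ?thesis using comp b by (simp add: smooth_flat_def)
    next
      assume "x \<in> - Q"
      then show ?thesis
        using frechet_derivative_local_const[OF opQ, of x \<phi> 0] by (simp add: \<phi>_def)
    qed
  qed
  moreover have z: "\<phi> x = 0" if "x \<notin> Q" for x using that by (simp add: \<phi>_def)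
  ultimately have "\<phi> \<in> core U \<Gamma>" using Q unfolding core_iff by blast
  moreover have "\<bar>\<phi> x - g x\<bar> < \<epsilon>" for x
  proof (cases "x \<in> Q")
    case True
    then have "x \<in> cball 0 R" using R by auto
    then have "\<bar>\<Phi> (a x) - g x\<bar> < 4 * d"
      using \<Phi>_approx[of "a x"] a(2)[of x] d by linarith
    then show ?thesis using True by (simp add: \<phi>_def d_def)
  next
    case False
    then show ?thesis using g(2) z \<open>\<epsilon> > 0\<close> by simp
  qed
  ultimately show ?thesis using that z by blast
qed

lemma continuous_cutoff:
  fixes K :: "'a::euclidean_space set"
  assumes "open \<Gamma>" "compact K" "K \<subseteq> \<Gamma>"
  obtains \<theta> Q where "continuous_on UNIV \<theta>" "compact Q" "Q \<subseteq> \<Gamma>" "\<And>x. x \<notin> Q \<Longrightarrow> \<theta> x = (0::real)"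
    "\<And>x. x \<in> K \<Longrightarrow> \<theta> x = 1" "\<And>x. 0 \<le> \<theta> x \<and> \<theta> x \<le> 1"
proof -
  have "\<exists>C. (\<forall>n. compact (C n)) \<and> (\<forall>n. C n \<subseteq> \<Gamma>) \<and> (\<forall>n::nat. C n \<subseteq> interior (C (Suc n))) \<and>
      (\<exists>N. \<forall>n\<ge>N. K \<subseteq> C n)"
  proof (rule open_Union_compact_subsets[OF assms(1)])
    fix C assume C: "\<And>n. compact (C n)" "\<And>n. C n \<subseteq> \<Gamma>" "\<And>n::nat. C n \<subseteq> interior (C (Suc n))"
      and "\<And>K. compact K \<Longrightarrow> K \<subseteq> \<Gamma> \<Longrightarrow> \<exists>N. \<forall>n\<ge>N. K \<subseteq> C n"
    then show ?thesis using assms(2,3) by (intro exI[of _ C]) simp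
  qed
  then obtain C N where C: "\<forall>n. compact (C n)" "\<forall>n. C n \<subseteq> \<Gamma>" "\<forall>n::nat. C n \<subseteq> interior (C (Suc n))"
    and ex: "\<forall>n\<ge>N. K \<subseteq> C n" by blast
  have N: "K \<subseteq> C N" using ex by simp
  have cl: "closed (- interior (C (Suc N)))" and disj: "K \<inter> - interior (C (Suc N)) = {}"
    using spec[OF C(3), of N] N by auto
  show ?thesis
  proof (rule Urysohn[OF compact_imp_closed[OF assms(2)] cl disj, of 1 "0::real"])
    fix \<theta> :: "'a \<Rightarrow> real"
    assume \<theta>: "continuous_on UNIV \<theta>" "\<And>x. \<theta> x \<in> closed_segment 1 0"
      "\<And>x. x \<in> K \<Longrightarrow> \<theta> x = 1" "\<And>x. x \<in> - interior (C (Suc N)) \<Longrightarrow> \<theta> x = 0"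
    show ?thesis
    proof (rule that[OF \<theta>(1) C(1)[rule_format] C(2)[rule_format]])
      show "\<theta> x = 0" if "x \<notin> C (Suc N)" for x
        using that \<theta>(4) interior_subset by blast
      show "\<theta> x = 1" if "x \<in> K" for x using that by (rule \<theta>(3))
      show "0 \<le> \<theta> x \<and> \<theta> x \<le> 1" for x
        using \<theta>(2)[of x] by (simp add: closed_segment_eq_real_ivl)
    qed
  qed
qed

lemma smooth_cutoff:
  fixes K :: "'a::euclidean_space set"
  assumes "open \<Gamma>" "compact K" "K \<subseteq> \<Gamma>"
  obtains \<theta> where "\<theta> \<in> test_functions \<Gamma>" "\<And>x. x \<in> K \<Longrightarrow> \<theta> x = 1"
proof -
  obtain \<eta> Q where \<eta>: "continuous_on UNIV \<eta>" "compact Q" "Q \<subseteq> \<Gamma>" "\<And>x. x \<notin> Q \<Longrightarrow> \<eta> x = (0::real)"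
    "\<And>x. x \<in> K \<Longrightarrow> \<eta> x = 1" "\<And>x. 0 \<le> \<eta> x \<and> \<eta> x \<le> 1"
    by (rule continuous_cutoff[OF assms]) blast
  have "(0::real) < 1/4" by simp
  then obtain \<phi> where \<phi>: "\<phi> \<in> core UNIV \<Gamma>" "\<And>x. x \<notin> Q \<Longrightarrow> \<phi> x = 0" "\<And>x. \<bar>\<phi> x - \<eta> x\<bar> < 1/4"
    using core_uniform_approx[OF open_UNIV closure_UNIV \<eta>(2,3,1,4)] by blast
  have "(\<lambda>x. smooth_step (1/4) (3/4) (\<phi> x)) \<in> core UNIV \<Gamma>"
    by (rule core_compose[OF Ck_smooth_step _ \<phi>(1)]) (auto simp: smooth_step_left)
  moreover have "smooth_step (1/4) (3/4) (\<phi> x) = 1" if "x \<in> K" for x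
  proof -
    have "3/4 \<le> \<phi> x" using \<phi>(3)[of x] \<eta>(5)[OF that] by linarith
    then show ?thesis by (intro smooth_step_right) auto
  qed
  ultimately show ?thesis using that unfolding core_UNIV by blast
qed

section \<open>Square integrable vector fields\<close>

text \<open>Gradients take values in the underlying Euclidean space, so the \<open>L\<^sup>2\<close> theory is developed for
  vector-valued functions; for real functions this is the space \<open>L2\<close>.\<close>
definition L2v :: "'a measure \<Rightarrow> ('a \<Rightarrow> 'b::euclidean_space) set" where
  "L2v M = {f \<in> borel_measurable M. integrable M (\<lambda>x. (norm (f x))\<^sup>2)}"

abbreviation sq :: "'a measure \<Rightarrow> ('a \<Rightarrow> 'b::euclidean_space) \<Rightarrow> real" where
  "sq M f \<equiv> (LINT x|M. (norm (f x))\<^sup>2)"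

lemma L2_eq_L2v: "L2 M = L2v M"
  by (simp add: L2_def L2v_def)

lemma L2v_measurable: "f \<in> L2v M \<Longrightarrow> f \<in> borel_measurable M"
  by (simp add: L2v_def)

lemma L2v_integrable: "f \<in> L2v M \<Longrightarrow> integrable M (\<lambda>x. (norm (f x))\<^sup>2)"
  by (simp add: L2v_def)

lemma L2v_I:
  assumes "f \<in> borel_measurable M" "integrable M g" "AE x in M. (norm (f x))\<^sup>2 \<le> g x"
  shows "f \<in> L2v M"
proof -
  have "integrable M (\<lambda>x. (norm (f x))\<^sup>2)"
  proof (rule Bochner_Integration.integrable_bound[OF assms(2)])
    show "(\<lambda>x. (norm (f x))\<^sup>2) \<in> borel_measurable M" using assms(1) by measurable
    show "AE x in M. norm ((norm (f x))\<^sup>2) \<le> norm (g x)"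
      using assms(3) by eventually_elim simp
  qed
  then show ?thesis using assms(1) by (simp add: L2v_def)
qed

text \<open>This weighted inequality replaces the Minkowski inequality throughout: for \<open>t = 1\<close> it is a
  quasi-triangle inequality, and for \<open>t\<close> tending to \<open>0\<close> it recovers sharp limits of norms.\<close>
lemma norm_add_square_le:
  fixes a b :: "'b::real_inner"
  assumes "t > 0"
  shows "(norm (a + b))\<^sup>2 \<le> (1 + t) * (norm a)\<^sup>2 + (1 + 1/t) * (norm b)\<^sup>2"
proof -
  have "0 \<le> (norm (t *\<^sub>R a - b))\<^sup>2 / t" using assms by simp
  also have "(norm (t *\<^sub>R a - b))\<^sup>2 / t = t * (norm a)\<^sup>2 - 2 * (a \<bullet> b) + (norm b)\<^sup>2 / t"
    using assms by (simp add: power2_norm_eq_inner inner_diff_left inner_diff_right inner_commute[of b a] field_simps)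
  finally have "2 * (a \<bullet> b) \<le> t * (norm a)\<^sup>2 + (norm b)\<^sup>2 / t" by simp
  moreover have "(norm (a + b))\<^sup>2 = (norm a)\<^sup>2 + 2 * (a \<bullet> b) + (norm b)\<^sup>2"
    by (simp add: power2_norm_eq_inner inner_add_left inner_add_right inner_commute[of b a])
  ultimately show ?thesis by (simp add: distrib_right)
qed

lemma norm_parallelogram:
  fixes a b :: "'b::real_inner"
  shows "(norm (a + b))\<^sup>2 + (norm (a - b))\<^sup>2 = 2 * (norm a)\<^sup>2 + 2 * (norm b)\<^sup>2"
  by (simp add: power2_norm_eq_inner inner_add_left inner_add_right inner_diff_left inner_diff_right)

lemma L2v_add:
  assumes "f \<in> L2v M" "g \<in> L2v M" shows "(\<lambda>x. f x + g x) \<in> L2v M"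
proof (rule L2v_I)
  show "(\<lambda>x. f x + g x) \<in> borel_measurable M" 
    using assms by (intro borel_measurable_add L2v_measurable)
  show "integrable M (\<lambda>x. (1 + 1) * (norm (f x))\<^sup>2 + (1 + 1/1) * (norm (g x))\<^sup>2)"
    using assms[THEN L2v_integrable] by (intro Bochner_Integration.integrable_add integrable_mult_right)
qed (intro AE_I2 norm_add_square_le zero_less_one)

lemma L2v_scaleR: "f \<in> L2v M \<Longrightarrow> (\<lambda>x. c *\<^sub>R f x) \<in> L2v M"
  by (auto simp: L2v_def power_mult_distrib)

lemma L2v_mult: "f \<in> L2v M \<Longrightarrow> (\<lambda>x. c * f x :: real) \<in> L2v M"
  using L2v_scaleR[of f M c] by simp

lemma L2v_diff: "f \<in> L2v M \<Longrightarrow> g \<in> L2v M \<Longrightarrow> (\<lambda>x. f x - g x) \<in> L2v M"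
  using L2v_add[of f M "\<lambda>x. (-1) *\<^sub>R g x"] L2v_scaleR[of g M "-1"] by simp

lemma L2v_cong_AE:
  assumes "f \<in> L2v M" "g \<in> borel_measurable M" "AE x in M. f x = g x"
  shows "g \<in> L2v M"
  by (rule L2v_I[OF assms(2) L2v_integrable[OF assms(1)]]) (use assms(3) in eventually_elim, simp)

lemma sq_cong_AE:
  assumes "f \<in> borel_measurable M" "g \<in> borel_measurable M" "AE x in M. f x = g x"
  shows "sq M f = sq M g"
  by (rule integral_cong_AE) (use assms in auto)

lemma sq_nonneg: "0 \<le> sq M f"
  by simp

lemma sq_scaleR: "sq M (\<lambda>x. c *\<^sub>R f x) = c\<^sup>2 * sq M f"
  by (simp add: power_mult_distrib)

lemma sq_mult: "sq M (\<lambda>x. c * f x :: real) = c\<^sup>2 * sq M f"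
  using sq_scaleR[of M c f] by simp

lemma sq_minus_commute: "sq M (\<lambda>x. f x - g x) = sq M (\<lambda>x. g x - f x)"
  by (simp add: norm_minus_commute)

lemma sq_add_le:
  assumes "f \<in> L2v M" "g \<in> L2v M" "t > 0"
  shows "sq M (\<lambda>x. f x + g x) \<le> (1 + t) * sq M f + (1 + 1/t) * sq M g"
proof -
  note i = assms(1,2)[THEN L2v_integrable]
  have "sq M (\<lambda>x. f x + g x) \<le> (LINT x|M. (1 + t) * (norm (f x))\<^sup>2 + (1 + 1/t) * (norm (g x))\<^sup>2)"
    by (intro integral_mono L2v_integrable L2v_add assms norm_add_square_le
        Bochner_Integration.integrable_add integrable_mult_right i)
  also have "\<dots> = (1 + t) * sq M f + (1 + 1/t) * sq M g"
    using i by (subst Bochner_Integration.integral_add) auto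
  finally show ?thesis .
qed

lemma sq_add_le2:
  assumes "f \<in> L2v M" "g \<in> L2v M"
  shows "sq M (\<lambda>x. f x + g x) \<le> 2 * sq M f + 2 * sq M g"
  using sq_add_le[OF assms zero_less_one] by simp

lemma sq_diff_triangle:
  assumes "f \<in> L2v M" "g \<in> L2v M" "h \<in> L2v M"
  shows "sq M (\<lambda>x. f x - h x) \<le> 2 * sq M (\<lambda>x. f x - g x) + 2 * sq M (\<lambda>x. g x - h x)"
  using sq_add_le2[OF L2v_diff[OF assms(1,2)] L2v_diff[OF assms(2,3)]] by simp

lemma sq_parallelogram:
  assumes "f \<in> L2v M" "g \<in> L2v M"
  shows "sq M (\<lambda>x. f x + g x) + sq M (\<lambda>x. f x - g x) = 2 * sq M f + 2 * sq M g"
proof -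
  note i = assms[THEN L2v_integrable] L2v_integrable[OF L2v_add[OF assms]] L2v_integrable[OF L2v_diff[OF assms]]
  have "sq M (\<lambda>x. f x + g x) + sq M (\<lambda>x. f x - g x) =
      (LINT x|M. (norm (f x + g x))\<^sup>2 + (norm (f x - g x))\<^sup>2)"
    using i(3,4) by simp
  also have "\<dots> = (LINT x|M. 2 * (norm (f x))\<^sup>2 + 2 * (norm (g x))\<^sup>2)"
    by (simp only: norm_parallelogram)
  also have "\<dots> = 2 * sq M f + 2 * sq M g" using i(1,2) by simp
  finally show ?thesis .
qed

lemma L2v_inner_bound:
  fixes a b :: "'b::real_inner"
  assumes "t > 0"
  shows "\<bar>a \<bullet> b\<bar> \<le> t * (norm a)\<^sup>2 + (norm b)\<^sup>2 / t"
proof -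
  have "0 \<le> (t * norm a - norm b)\<^sup>2 / t" using assms by simp
  also have "\<dots> = t * (norm a)\<^sup>2 + (norm b)\<^sup>2 / t - 2 * (norm a * norm b)"
    using assms by (simp add: power2_diff field_simps power2_eq_square)
  finally have "2 * (norm a * norm b) \<le> t * (norm a)\<^sup>2 + (norm b)\<^sup>2 / t" by simp
  moreover have "\<bar>a \<bullet> b\<bar> \<le> norm a * norm b" by (rule Cauchy_Schwarz_ineq2)
  moreover have "0 \<le> norm a * norm b" by simp
  ultimately show ?thesis by linarith
qed

lemma L2v_inner_integrable:
  assumes "f \<in> L2v M" "g \<in> L2v M" shows "integrable M (\<lambda>x. f x \<bullet> g x)"
proof (rule Bochner_Integration.integrable_bound)
  show "integrable M (\<lambda>x. 1 * (norm (f x))\<^sup>2 + (norm (g x))\<^sup>2 / 1)"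
    using assms[THEN L2v_integrable] by simp
  show "(\<lambda>x. f x \<bullet> g x) \<in> borel_measurable M"
    using assms[THEN L2v_measurable] by measurable
  show "AE x in M. norm (f x \<bullet> g x) \<le> norm (1 * (norm (f x))\<^sup>2 + (norm (g x))\<^sup>2 / 1)"
    using L2v_inner_bound[OF zero_less_one] by (intro AE_I2) auto
qed

text \<open>By \<open>L2v_inner_bound\<close>, the difference of the integrals is at most
  \<open>t * sq M (F n - f) + sq M g / t\<close>; first \<open>t\<close> is chosen large and then \<open>n\<close>.\<close>
lemma sq_tendsto_inner:
  fixes f :: "'a \<Rightarrow> 'b::euclidean_space"
  assumes F: "\<And>n. F n \<in> L2v M" "f \<in> L2v M" "g \<in> L2v M"
    and lim: "(\<lambda>n. sq M (\<lambda>x. F n x - f x)) \<longlonglongrightarrow> 0"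
  shows "(\<lambda>n. LINT x|M. F n x \<bullet> g x) \<longlonglongrightarrow> (LINT x|M. f x \<bullet> g x)"
proof (rule LIMSEQ_I)
  fix r :: real assume r: "r > 0"
  define t where "t = 2 * (sq M g + 1) / r"
  have t: "t > 0" using r by (simp add: t_def add_nonneg_pos)
  have "sq M g / t = r / 2 * (sq M g / (sq M g + 1))" by (simp add: t_def)
  also have "\<dots> \<le> r / 2 * 1"
    using r by (intro mult_left_mono) (auto simp: divide_simps add_nonneg_pos add_nonneg_eq_0_iff)
  finally have small: "sq M g / t \<le> r / 2" by simp
  obtain N where N: "\<And>n. n \<ge> N \<Longrightarrow> sq M (\<lambda>x. F n x - f x) < r / (2 * t)"
    using LIMSEQ_D[OF lim, of "r / (2 * t)"] r t by auto
  show "\<exists>N. \<forall>n\<ge>N. norm ((LINT x|M. F n x \<bullet> g x) - (LINT x|M. f x \<bullet> g x)) < r"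
  proof (intro exI allI impI)
    fix n assume n: "n \<ge> N"
    note d = L2v_diff[OF F(1)[of n] F(2)]
    have "(LINT x|M. F n x \<bullet> g x) - (LINT x|M. f x \<bullet> g x) = (LINT x|M. (F n x - f x) \<bullet> g x)"
      using F by (simp add: inner_diff_left L2v_inner_integrable)
    also have "\<bar>\<dots>\<bar> \<le> (LINT x|M. \<bar>(F n x - f x) \<bullet> g x\<bar>)" by (rule integral_abs_bound)
    also have "\<dots> \<le> (LINT x|M. t * (norm (F n x - f x))\<^sup>2 + (norm (g x))\<^sup>2 / t)"
      by (intro integral_mono integrable_abs L2v_inner_integrable d F L2v_inner_bound t
          Bochner_Integration.integrable_add integrable_mult_right integrable_divide L2v_integrable)
    also have "\<dots> = t * sq M (\<lambda>x. F n x - f x) + sq M g / t"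
      using L2v_integrable[OF d] L2v_integrable[OF F(3)] by simp
    also have "\<dots> < t * (r / (2 * t)) + r / 2"
      using N[OF n] small t by (intro add_less_le_mono mult_strict_left_mono) auto
    also have "\<dots> = r" using t by simp
    finally show "norm ((LINT x|M. F n x \<bullet> g x) - (LINT x|M. f x \<bullet> g x)) < r" by simp
  qed
qed

text \<open>Comparing \<open>g\<close> with \<open>h n\<close> by \<open>sq_add_le\<close> costs a factor \<open>1 + t\<close>, which is removed at the end
  by letting \<open>t\<close> tend to \<open>0\<close>.\<close>
lemma sq_lsc:
  assumes "\<And>n. h n \<in> L2v M" "g \<in> L2v M" "(\<lambda>n. sq M (\<lambda>x. h n x - g x)) \<longlonglongrightarrow> 0"
    and "\<And>n. sq M (h n) \<le> b n" "b \<longlonglongrightarrow> B" "B \<ge> 0"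
  shows "sq M g \<le> B"
proof (rule field_le_epsilon)
  fix e :: real assume "e > 0"
  define t where "t = e / (B + 1)"
  have t: "t > 0" using \<open>e > 0\<close> assms(6) by (simp add: t_def)
  have "sq M g \<le> (1 + t) * b n + (1 + 1/t) * sq M (\<lambda>x. h n x - g x)" for n
  proof -
    have "sq M g = sq M (\<lambda>x. h n x + (g x - h n x))" by simp
    also have "\<dots> \<le> (1 + t) * sq M (h n) + (1 + 1/t) * sq M (\<lambda>x. g x - h n x)"
      by (intro sq_add_le assms(1) L2v_diff assms(2) t)
    also have "\<dots> \<le> (1 + t) * b n + (1 + 1/t) * sq M (\<lambda>x. h n x - g x)"
      using t assms(4)[of n] by (intro add_mono mult_left_mono) (auto simp: norm_minus_commute)
    finally show ?thesis .
  qed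
  moreover have "(\<lambda>n. (1 + t) * b n + (1 + 1/t) * sq M (\<lambda>x. h n x - g x)) \<longlonglongrightarrow> (1 + t) * B + (1 + 1/t) * 0"
    by (intro tendsto_intros assms)
  ultimately have "sq M g \<le> (1 + t) * B + (1 + 1/t) * 0"
    by (intro LIMSEQ_le_const) auto
  also have "\<dots> = B + e * (B / (B + 1))" by (simp add: t_def distrib_right)
  also have "\<dots> \<le> B + e * 1"
    using \<open>e > 0\<close> assms(6) by (intro add_left_mono mult_left_mono) auto
  finally show "sq M g \<le> B + e" by simp
qed

lemma sq_dominated_tendsto_0:
  fixes d :: "nat \<Rightarrow> 'a \<Rightarrow> real"
  assumes "\<And>n. d n \<in> borel_measurable M" "integrable M (\<lambda>x. (w x)\<^sup>2)"
    and "\<And>n x. x \<in> space M \<Longrightarrow> \<bar>d n x\<bar> \<le> w x" "AE x in M. (\<lambda>n. d n x) \<longlonglongrightarrow> 0"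
  shows "(\<lambda>n. sq M (d n)) \<longlonglongrightarrow> 0"
proof -
  have "(\<lambda>n. sq M (d n)) \<longlonglongrightarrow> (LINT x|M. 0)"
  proof (rule integral_dominated_convergence[OF _ _ assms(2)])
    show "(\<lambda>x. (norm (d n x))\<^sup>2) \<in> borel_measurable M" for n using assms(1)[of n] by measurable
    show "AE x in M. (\<lambda>n. (norm (d n x))\<^sup>2) \<longlonglongrightarrow> 0"
      using assms(4)
    proof eventually_elim
      fix x assume "(\<lambda>n. d n x) \<longlonglongrightarrow> 0"
      then have "(\<lambda>n. (norm (d n x))\<^sup>2) \<longlonglongrightarrow> (norm (0::real))\<^sup>2" by (intro tendsto_intros)
      then show "(\<lambda>n. (norm (d n x))\<^sup>2) \<longlonglongrightarrow> 0" by simp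
    qed
    show "AE x in M. norm ((norm (d n x))\<^sup>2) \<le> (w x)\<^sup>2" for n
      using power_mono[OF assms(3)[of _ n], of _ 2] by (intro AE_I2) auto
  qed simp
  then show ?thesis by simp
qed

lemma nn_integral_norm_square:
  assumes "f \<in> L2v M" shows "(\<integral>\<^sup>+x. ennreal ((norm (f x))\<^sup>2) \<partial>M) = ennreal (sq M f)"
  using L2v_integrable[OF assms] by (intro nn_integral_eq_integral) auto

text \<open>The Riesz-Fischer theorem. Along a subsequence with increments \<open>h k\<close> satisfying
  \<open>sq M (h k) \<le> 4\<^sup>-\<^sup>k\<close> the sum of \<open>2\<^sup>k (norm (h k x))\<^sup>2\<close> is integrable, hence finite almost everywhere, and
  the inequality \<open>a \<le> 2\<^sup>k a\<^sup>2 + 2\<^sup>-\<^sup>k\<close> makes the increments summable. The subsequence thus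
  converges almost everywhere, and Fatou's lemma compares its limit with the whole sequence.\<close>
lemma L2v_complete:
  fixes f :: "nat \<Rightarrow> 'a \<Rightarrow> 'b::euclidean_space"
  assumes f: "\<And>n. f n \<in> L2v M"
    and cauchy: "\<And>\<epsilon>. \<epsilon> > 0 \<Longrightarrow> \<exists>N. \<forall>m\<ge>N. \<forall>n\<ge>N. sq M (\<lambda>x. f m x - f n x) < \<epsilon>"
  obtains g where "g \<in> L2v M" "(\<lambda>n. sq M (\<lambda>x. f n x - g x)) \<longlonglongrightarrow> 0"
proof -
  have meas [measurable]: "f n \<in> borel_measurable M" for n by (rule L2v_measurable[OF f])
  have "\<forall>k::nat. \<exists>N. \<forall>m\<ge>N. \<forall>n\<ge>N. sq M (\<lambda>x. f m x - f n x) < (1/4)^k"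
    using cauchy by simp
  then obtain N where N: "\<And>k m n. m \<ge> N k \<Longrightarrow> n \<ge> N k \<Longrightarrow> sq M (\<lambda>x. f m x - f n x) < (1/4)^k"
    by metis
  \<comment> \<open>\<open>N\<close> made monotone, so that \<open>r j\<close> also serves every precision \<open>k \<le> j\<close>\<close>
  define r where "r k = Max (N ` {..k})" for k
  have rN: "N k \<le> r j" if "k \<le> j" for k j
    unfolding r_def using that by (intro Max_ge) auto
  define h where "h k x = f (r (Suc k)) x - f (r k) x" for k x
  have h: "h k \<in> L2v M" "sq M (h k) \<le> (1/4)^k" for k
    unfolding h_def using L2v_diff f N[OF rN[of k "Suc k"] rN[of k k]] by (auto simp: less_imp_le)
  have hm [measurable]: "h k \<in> borel_measurable M" for k by (rule L2v_measurable[OF h(1)])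
  have "(\<integral>\<^sup>+x. (\<Sum>k. ennreal (2^k * (norm (h k x))\<^sup>2)) \<partial>M) = (\<Sum>k. \<integral>\<^sup>+x. ennreal (2^k * (norm (h k x))\<^sup>2) \<partial>M)"
    by (rule nn_integral_suminf) measurable
  also have "\<dots> \<le> (\<Sum>k. ennreal ((1/2)^k))"
  proof (rule suminf_le)
    fix k
    have "(\<integral>\<^sup>+x. ennreal (2^k * (norm (h k x))\<^sup>2) \<partial>M) = ennreal (2^k * sq M (h k))"
      using L2v_integrable[OF h(1)[of k]] by (subst nn_integral_eq_integral) auto
    also have "\<dots> \<le> ennreal (2^k * (1/4)^k)"
      using h(2)[of k] by (intro ennreal_leI mult_left_mono) auto
    also have "(2::real)^k * (1/4)^k = (1/2)^k"
      by (simp add: power_mult_distrib[symmetric])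
    finally show "(\<integral>\<^sup>+x. ennreal (2^k * (norm (h k x))\<^sup>2) \<partial>M) \<le> ennreal ((1/2)^k)" .
  qed auto
  also have "\<dots> = ennreal (\<Sum>k. (1/2)^k)"
    by (intro suminf_ennreal2) (auto simp: summable_geometric)
  also have "\<dots> < \<infinity>" by simp
  finally have "AE x in M. (\<Sum>k. ennreal (2^k * (norm (h k x))\<^sup>2)) \<noteq> \<infinity>"
    by (intro nn_integral_PInf_AE) auto
  then have conv: "AE x in M. convergent (\<lambda>k. f (r k) x)"
  proof eventually_elim
    fix x assume "(\<Sum>k. ennreal (2^k * (norm (h k x))\<^sup>2)) \<noteq> \<infinity>"
    then have s: "summable (\<lambda>k. 2^k * (norm (h k x))\<^sup>2)"
      by (intro summable_suminf_not_top) auto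
    have "summable (\<lambda>k. h k x)"
    proof (rule summable_comparison_test')
      show "summable (\<lambda>k. (1/2)^k + 2^k * (norm (h k x))\<^sup>2)"
        using s by (intro summable_add summable_geometric) auto
      fix k :: nat
      have "\<bar>norm (h k x) \<bullet> (1::real)\<bar> \<le> 2^k * (norm (norm (h k x)))\<^sup>2 + (norm (1::real))\<^sup>2 / 2^k"
        by (rule L2v_inner_bound) simp
      then show "norm (h k x) \<le> (1/2)^k + 2^k * (norm (h k x))\<^sup>2"
        by (simp add: power_divide)
    qed
    then have "convergent (\<lambda>n. \<Sum>k<n. h k x)" by (simp add: summable_iff_convergent)
    moreover have "(\<Sum>k<n. h k x) = f (r n) x - f (r 0) x" for n
      unfolding h_def by (rule sum_lessThan_telescope)
    ultimately have "convergent (\<lambda>n. f (r n) x - f (r 0) x)" by simp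
    from convergent_add[OF this convergent_const[of "f (r 0) x"]]
    show "convergent (\<lambda>n. f (r n) x)" by simp
  qed
  define g where "g x = lim (\<lambda>k. f (r k) x)" for x
  have gm [measurable]: "g \<in> borel_measurable M" unfolding g_def[abs_def] by measurable
  have lim: "AE x in M. (\<lambda>k. f (r k) x) \<longlonglongrightarrow> g x"
    using conv by eventually_elim (simp add: g_def convergent_LIMSEQ_iff)
  have fatou: "(\<integral>\<^sup>+x. ennreal ((norm (f n x - g x))\<^sup>2) \<partial>M) \<le> ennreal ((1/4)^k)" if n: "n \<ge> N k" for n k
  proof -
    have "(\<integral>\<^sup>+x. ennreal ((norm (f n x - g x))\<^sup>2) \<partial>M) =
        (\<integral>\<^sup>+x. liminf (\<lambda>j. ennreal ((norm (f n x - f (r j) x))\<^sup>2)) \<partial>M)"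
    proof (rule nn_integral_cong_AE)
      show "AE x in M. ennreal ((norm (f n x - g x))\<^sup>2) = liminf (\<lambda>j. ennreal ((norm (f n x - f (r j) x))\<^sup>2))"
        using lim
      proof eventually_elim
        fix x assume "(\<lambda>k. f (r k) x) \<longlonglongrightarrow> g x"
        then have "(\<lambda>j. ennreal ((norm (f n x - f (r j) x))\<^sup>2)) \<longlonglongrightarrow> ennreal ((norm (f n x - g x))\<^sup>2)"
          by (intro tendsto_intros) auto
        then show "ennreal ((norm (f n x - g x))\<^sup>2) = liminf (\<lambda>j. ennreal ((norm (f n x - f (r j) x))\<^sup>2))"
          using lim_imp_Liminf[OF sequentially_bot, symmetric] by fast
      qed
    qed
    also have "\<dots> \<le> liminf (\<lambda>j. \<integral>\<^sup>+x. ennreal ((norm (f n x - f (r j) x))\<^sup>2) \<partial>M)"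
      by (rule nn_integral_liminf) measurable
    also have "\<dots> \<le> liminf (\<lambda>j. ennreal ((1/4)^k))"
    proof (rule Liminf_mono)
      show "\<forall>\<^sub>F j in sequentially. (\<integral>\<^sup>+x. ennreal ((norm (f n x - f (r j) x))\<^sup>2) \<partial>M) \<le> ennreal ((1/4)^k)"
        using eventually_ge_at_top[of k]
      proof eventually_elim
        fix j assume "k \<le> j"
        then have "sq M (\<lambda>x. f n x - f (r j) x) < (1/4)^k" by (intro N n rN)
        then show "(\<integral>\<^sup>+x. ennreal ((norm (f n x - f (r j) x))\<^sup>2) \<partial>M) \<le> ennreal ((1/4)^k)"
          by (simp add: nn_integral_norm_square[OF L2v_diff[OF f f]] ennreal_leI)
      qed
    qed
    also have "\<dots> = ennreal ((1/4)^k)" by (simp add: Liminf_const)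
    finally show ?thesis .
  qed
  have d: "(\<lambda>x. f n x - g x) \<in> L2v M" "sq M (\<lambda>x. f n x - g x) \<le> (1/4)^k" if "n \<ge> N k" for n k
  proof -
    have "integrable M (\<lambda>x. (norm (f n x - g x))\<^sup>2)"
    proof (rule integrableI_bounded)
      have "(\<integral>\<^sup>+x. ennreal ((norm (f n x - g x))\<^sup>2) \<partial>M) < \<infinity>"
        using fatou[OF that] by (rule le_less_trans) simp
      then show "(\<integral>\<^sup>+x. ennreal (norm ((norm (f n x - g x))\<^sup>2)) \<partial>M) < \<infinity>" by simp
    qed measurable
    then show l: "(\<lambda>x. f n x - g x) \<in> L2v M" by (simp add: L2v_def)
    show "sq M (\<lambda>x. f n x - g x) \<le> (1/4)^k"
      using fatou[OF that] unfolding nn_integral_norm_square[OF l] by (simp add: ennreal_le_iff)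
  qed
  have "g \<in> L2v M"
    using L2v_diff[OF f[of "N 0"] d(1)[OF order_refl, of 0]] by simp
  moreover have "(\<lambda>n. sq M (\<lambda>x. f n x - g x)) \<longlonglongrightarrow> 0"
  proof (rule LIMSEQ_I)
    fix e :: real assume "e > 0"
    then obtain k where k: "(1/4::real)^k < e"
      using real_arch_pow_inv[of e "1/4"] by auto
    show "\<exists>n0. \<forall>n\<ge>n0. norm (sq M (\<lambda>x. f n x - g x) - 0) < e"
      using d(2)[of k] k by (intro exI[of _ "N k"]) fastforce
  qed
  ultimately show ?thesis using that by blast
qed

section \<open>Integration of compactly supported functions\<close>

lemma continuous_lebesgue_measurable:
  fixes f :: "'a::euclidean_space \<Rightarrow> 'b::euclidean_space"
  assumes "continuous_on UNIV f" shows "f \<in> borel_measurable (lebesgue_on S)"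
  using borel_measurable_continuous_onI[OF assms] 
  by (intro measurable_restrict_space1 measurable_completion) simp

lemma continuous_compact_bounded:
  fixes f :: "'a::euclidean_space \<Rightarrow> 'b::euclidean_space"
  assumes "continuous_on UNIV f" "compact K" "\<And>x. x \<notin> K \<Longrightarrow> f x = 0"
  obtains B where "B > 0" "\<And>x. norm (f x) \<le> B"
proof -
  have "bounded (f ` K)"
    by (intro compact_imp_bounded compact_continuous_image continuous_on_subset[OF assms(1)] assms(2)) auto
  then obtain B where B: "B > 0" "\<And>x. x \<in> K \<Longrightarrow> norm (f x) \<le> B"
    unfolding bounded_pos by auto
  have "norm (f x) \<le> B" for x
    using B assms(3)[of x] by (cases "x \<in> K") auto
  then show ?thesis using that B(1) by blast
qed

lemma integrable_indicator_compact:
  fixes K :: "'a::euclidean_space set"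
  assumes "compact K" "K \<subseteq> \<Gamma>" "\<Gamma> \<in> sets lebesgue"
  shows "integrable (lebesgue_on \<Gamma>) (\<lambda>x. indicator K x :: real)"
proof -
  have K: "K \<in> sets lebesgue" "emeasure lebesgue K < \<infinity>"
    using lmeasurable_compact[OF assms(1)] by (auto simp: fmeasurable_def)
  have "integrable lebesgue (\<lambda>x. indicator K x :: real)"
    using K by (simp add: integrable_indicator_iff)
  moreover have "(\<lambda>x. indicator \<Gamma> x *\<^sub>R (indicator K x :: real)) = (\<lambda>x. indicator K x)"
    using assms(2) by (auto simp: fun_eq_iff indicator_def)
  ultimately show ?thesis
    using assms(3) by (subst integrable_restrict_space) auto
qed

lemma integrable_bounded_compact_support:
  fixes f :: "'a::euclidean_space \<Rightarrow> 'b::euclidean_space"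
  assumes "f \<in> borel_measurable (lebesgue_on \<Gamma>)" "compact K" "K \<subseteq> \<Gamma>" "\<Gamma> \<in> sets lebesgue"
    and "\<And>x. x \<in> \<Gamma> \<Longrightarrow> norm (f x) \<le> B" "\<And>x. x \<notin> K \<Longrightarrow> f x = 0"
  shows "integrable (lebesgue_on \<Gamma>) f"
proof (rule Bochner_Integration.integrable_bound)
  show "integrable (lebesgue_on \<Gamma>) (\<lambda>x. B * indicator K x :: real)"
    by (intro integrable_mult_right integrable_indicator_compact assms)
  show "AE x in lebesgue_on \<Gamma>. norm (f x) \<le> norm (B * indicator K x :: real)"
  proof (rule AE_I2)
    fix x assume "x \<in> space (lebesgue_on \<Gamma>)"
    then have "norm (f x) \<le> B" using assms(5) by simp
    then show "norm (f x) \<le> norm (B * indicator K x :: real)"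
      using assms(6)[of x] by (cases "x \<in> K") auto
  qed
qed fact

lemma integrable_continuous_compact_support:
  fixes f :: "'a::euclidean_space \<Rightarrow> 'b::euclidean_space"
  assumes "continuous_on UNIV f" "compact K" "K \<subseteq> \<Gamma>" "\<Gamma> \<in> sets lebesgue"
    and "\<And>x. x \<notin> K \<Longrightarrow> f x = 0"
  shows "integrable (lebesgue_on \<Gamma>) f"
proof -
  obtain B where "B > 0" "\<And>x. norm (f x) \<le> B"
    using continuous_compact_bounded[OF assms(1,2,5)] by blast
  then show ?thesis
    by (intro integrable_bounded_compact_support[OF continuous_lebesgue_measurable[OF assms(1)] assms(2,3,4)]
        assms(5)) auto
qed

lemma L2v_continuous_compact_support:
  fixes f :: "'a::euclidean_space \<Rightarrow> 'b::euclidean_space"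
  assumes "continuous_on UNIV f" "compact K" "K \<subseteq> \<Gamma>" "\<Gamma> \<in> sets lebesgue"
    and "\<And>x. x \<notin> K \<Longrightarrow> f x = 0"
  shows "f \<in> L2v (lebesgue_on \<Gamma>)"
proof -
  have "integrable (lebesgue_on \<Gamma>) (\<lambda>x. (norm (f x))\<^sup>2)"
    by (rule integrable_continuous_compact_support[OF _ assms(2,3,4)])
       (auto intro!: continuous_on_power continuous_on_norm assms)
  then show ?thesis
    using continuous_lebesgue_measurable[OF assms(1)] by (simp add: L2v_def)
qed

lemma integral_lebesgue_on_eq_UNIV:
  fixes f :: "'a::euclidean_space \<Rightarrow> 'b::euclidean_space"
  assumes "\<Gamma> \<in> sets lebesgue" "\<And>x. x \<notin> \<Gamma> \<Longrightarrow> f x = 0"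
  shows "(LINT x|lebesgue_on \<Gamma>. f x) = (LINT x|lebesgue. f x)"
proof -
  have "indicator \<Gamma> x *\<^sub>R f x = f x" for x using assms(2)[of x] by (auto simp: indicator_def)
  then show ?thesis using assms(1) by (subst integral_restrict_space) auto
qed

lemma integral_lebesgue_translate:
  fixes f :: "'a::euclidean_space \<Rightarrow> real"
  assumes "continuous_on UNIV f"
  shows "(LINT x|lebesgue. f (a + x)) = (LINT x|lebesgue. f x)"
proof -
  have f: "f \<in> borel_measurable borel" by (rule borel_measurable_continuous_onI[OF assms])
  have "(LINT x|lebesgue. f (a + x)) = (LINT x|lborel. f (a + x))"
    by (intro integral_completion) (use f in measurable)
  also have "\<dots> = (LINT x|distr lborel borel ((+) a). f x)"
    using f by (subst integral_distr) auto
  also have "\<dots> = (LINT x|lborel. f x)" by (simp add: lborel_distr_plus)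
  also have "\<dots> = (LINT x|lebesgue. f x)"
    by (intro integral_completion[symmetric]) (use f in measurable)
  finally show ?thesis .
qed

lemma frechet_derivative_outside_support:
  assumes "compact K" "\<And>x. x \<notin> K \<Longrightarrow> f x = (0::real)" "x \<notin> K"
  shows "frechet_derivative f (at x) v = 0"
  by (rule frechet_derivative_local_const[where S = "- K" and c = 0])
     (use assms compact_imp_closed in auto)

text \<open>Difference quotients of \<open>f\<close> have integral zero because Lebesgue measure is translation
  invariant. They converge to the directional derivative and, by the mean value theorem, are bounded by
  the maximum of its modulus and supported in one fixed compact set, so dominated convergence applies.\<close>
lemma integral_directional_derivative_zero:
  fixes f :: "'a::euclidean_space \<Rightarrow> real"
  assumes f: "Ck (Suc 0) f" and K: "compact K" "\<And>x. x \<notin> K \<Longrightarrow> f x = 0"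
  shows "(LINT x|lebesgue. frechet_derivative f (at x) v) = 0"
proof -
  let ?D = "\<lambda>x. frechet_derivative f (at x) v"
  note cf = Ck_continuous_on[OF f, of UNIV]
  have cD: "continuous_on UNIV ?D" using f by simp
  have D0: "?D x = 0" if "x \<notin> K" for x
    using frechet_derivative_outside_support[OF K that] .
  obtain B where B: "B > 0" "\<And>x. norm (?D x) \<le> B"
    using continuous_compact_bounded[OF cD K(1) D0] by blast
  obtain R where R: "\<And>x. x \<in> K \<Longrightarrow> norm x \<le> R"
    using compact_imp_bounded[OF K(1)] unfolding bounded_iff by blast
  \<comment> \<open>contains the supports of all translates of \<open>f\<close> by at most \<open>v\<close>\<close>
  define L where "L = cball (0::'a) (R + norm v)"
  define t where "t n = inverse (real (Suc n))" for n
  have t: "0 < t n" "t n \<le> 1" for n by (auto simp: t_def field_simps)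
  have t0: "t \<longlonglongrightarrow> 0" unfolding t_def by (rule LIMSEQ_inverse_real_of_nat)
  define q where "q n x = (f (t n *\<^sub>R v + x) - f x) / t n" for n x
  have line: "((\<lambda>s. f (s *\<^sub>R v + x)) has_real_derivative ?D (s *\<^sub>R v + x)) (at s)" for s x
  proof -
    have "((\<lambda>s. s *\<^sub>R v + x) has_derivative (\<lambda>h. h *\<^sub>R v)) (at s)"
      by (auto intro!: derivative_eq_intros)
    from has_derivative_compose[OF this Ck_Suc_has_derivative[OF f]]
    have "((\<lambda>s. f (s *\<^sub>R v + x)) has_derivative
        (\<lambda>h. frechet_derivative f (at (s *\<^sub>R v + x)) (h *\<^sub>R v))) (at s)" .
    moreover have "frechet_derivative f (at (s *\<^sub>R v + x)) (h *\<^sub>R v) = ?D (s *\<^sub>R v + x) * h" for h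
      using linear_scale[OF frechet_derivative_linear_Ck[OF f]] by (simp add: mult.commute)
    ultimately show ?thesis by (simp add: has_field_derivative_def)
  qed
  have q_bound: "norm (q n x) \<le> B * indicator L x" for n x
  proof (cases "x \<in> L")
    case True
    obtain s where "f (t n *\<^sub>R v + x) - f (0 *\<^sub>R v + x) = (t n - 0) * ?D (s *\<^sub>R v + x)"
      using MVT2[of 0 "t n" "\<lambda>s. f (s *\<^sub>R v + x)" "\<lambda>s. ?D (s *\<^sub>R v + x)"] t line by blast
    then have "q n x = ?D (s *\<^sub>R v + x)" using t(1)[of n] by (simp add: q_def)
    then show ?thesis using B(2) True by simp
  next
    case False
    then have x: "norm x > R + norm v" by (simp add: L_def)
    have "norm (t n *\<^sub>R v) \<le> 1 * norm v" using t[of n] by (simp add: mult_left_le_one_le)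
    then have "norm (t n *\<^sub>R v + x) > R"
      using x norm_triangle_ineq2[of x "- (t n *\<^sub>R v)"] by (simp add: add.commute)
    moreover have "norm x > R" using x norm_ge_zero[of v] by linarith
    ultimately have "t n *\<^sub>R v + x \<notin> K" "x \<notin> K" using R by force+
    then show ?thesis using K(2) False by (simp add: q_def)
  qed
  have zero: "(LINT x|lebesgue. q n x) = 0" for n
  proof -
    have 1: "integrable lebesgue f"
      using integrable_continuous_compact_support[OF cf K(1) subset_UNIV, OF _ K(2)] by (simp add: lebesgue_on_UNIV_eq)
    have c2: "continuous_on UNIV (\<lambda>x. f (t n *\<^sub>R v + x))"
      by (intro continuous_on_compose2[OF cf] continuous_intros) auto
    have "compact ((+) (- (t n *\<^sub>R v)) ` K)"
      by (intro compact_continuous_image continuous_intros K(1))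
    moreover have "f (t n *\<^sub>R v + x) = 0" if "x \<notin> (+) (- (t n *\<^sub>R v)) ` K" for x
      using that K(2)[of "t n *\<^sub>R v + x"] by (force simp: image_iff)
    ultimately have 2: "integrable lebesgue (\<lambda>x. f (t n *\<^sub>R v + x))"
      using integrable_continuous_compact_support[OF c2 _ subset_UNIV] by (simp add: lebesgue_on_UNIV_eq)
    have "(LINT x|lebesgue. q n x) = ((LINT x|lebesgue. f (t n *\<^sub>R v + x)) - (LINT x|lebesgue. f x)) / t n"
      using 1 2 by (simp add: q_def)
    then show ?thesis by (simp add: integral_lebesgue_translate[OF cf])
  qed
  have "(\<lambda>n. LINT x|lebesgue. q n x) \<longlonglongrightarrow> (LINT x|lebesgue. ?D x)"
  proof (rule integral_dominated_convergence)
    show "?D \<in> borel_measurable lebesgue"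
      using continuous_lebesgue_measurable[OF cD, of UNIV] by (simp add: lebesgue_on_UNIV_eq)
    show "q n \<in> borel_measurable lebesgue" for n
      unfolding q_def using t(1)[of n] 
      by (subst lebesgue_on_UNIV_eq[symmetric], intro continuous_lebesgue_measurable continuous_intros
          continuous_on_compose2[OF cf]) auto
    show "integrable lebesgue (\<lambda>x. B * indicator L x :: real)"
      using integrable_indicator_compact[of L UNIV] by (simp add: L_def lebesgue_on_UNIV_eq)
    show "AE x in lebesgue. (\<lambda>n. q n x) \<longlonglongrightarrow> ?D x"
    proof (rule AE_I2)
      fix x
      have "((\<lambda>h. (f (h *\<^sub>R v + x) - f x) / h) \<longlongrightarrow> ?D x) (at 0)"
        using line[of x 0] by (simp add: DERIV_def)
      moreover have "filterlim t (at 0) sequentially"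
        using t0 t(1) by (auto simp: filterlim_at intro!: always_eventually less_imp_neq[symmetric])
      ultimately show "(\<lambda>n. q n x) \<longlonglongrightarrow> ?D x"
        unfolding q_def by (rule filterlim_compose)
    qed
    show "AE x in lebesgue. norm (q n x) \<le> B * indicator L x" for n
      using q_bound by simp
  qed
  then have "(\<lambda>n::nat. 0) \<longlonglongrightarrow> (LINT x|lebesgue. ?D x)" by (simp add: zero)
  then show ?thesis using LIMSEQ_const_iff by metis
qed

lemma test_function_support:
  assumes "\<phi> \<in> test_functions \<Gamma>"
  obtains K where "compact K" "K \<subseteq> \<Gamma>" "\<And>x. x \<notin> K \<Longrightarrow> \<phi> x = 0"
  using assms unfolding test_functions_def by blast

lemma test_function_Ck: "\<phi> \<in> test_functions \<Gamma> \<Longrightarrow> Ck k \<phi>"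
  by (simp add: test_functions_def)

lemma test_function_continuous: "\<phi> \<in> test_functions \<Gamma> \<Longrightarrow> continuous_on S \<phi>"
  by (rule Ck_continuous_on[OF test_function_Ck])

lemma test_function_derivative_continuous:
  "\<phi> \<in> test_functions \<Gamma> \<Longrightarrow> continuous_on UNIV (\<lambda>x. frechet_derivative \<phi> (at x) v)"
  using test_function_Ck[of \<phi> \<Gamma> "Suc 0"] by simp

lemma test_function_integration_by_parts:
  fixes \<phi> \<theta> :: "'a::euclidean_space \<Rightarrow> real"
  assumes "\<phi> \<in> test_functions \<Gamma>" "\<theta> \<in> test_functions \<Gamma>" "open \<Gamma>"
  shows "(LINT x|lebesgue_on \<Gamma>. \<phi> x * frechet_derivative \<theta> (at x) v) =
       - (LINT x|lebesgue_on \<Gamma>. frechet_derivative \<phi> (at x) v * \<theta> x)"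
proof -
  obtain K where K: "compact K" "K \<subseteq> \<Gamma>" "\<And>x. x \<notin> K \<Longrightarrow> \<phi> x = 0"
    using test_function_support[OF assms(1)] by blast
  have \<Gamma>: "\<Gamma> \<in> sets lebesgue" using assms(3) by simp
  note C = test_function_Ck[OF assms(1), of "Suc 0"] test_function_Ck[OF assms(2), of "Suc 0"]
  note c = test_function_continuous[OF assms(1)] test_function_continuous[OF assms(2)]
    test_function_derivative_continuous[OF assms(1)] test_function_derivative_continuous[OF assms(2)]
  have D0: "frechet_derivative \<phi> (at x) v = 0" if "x \<notin> K" for x
    using frechet_derivative_outside_support[OF K(1,3) that] .
  have 1: "integrable (lebesgue_on \<Gamma>) (\<lambda>x. \<phi> x * frechet_derivative \<theta> (at x) v)"
    by (rule integrable_continuous_compact_support[OF _ K(1,2) \<Gamma>]) (auto intro!: continuous_on_mult c simp: K)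
  have 2: "integrable (lebesgue_on \<Gamma>) (\<lambda>x. frechet_derivative \<phi> (at x) v * \<theta> x)"
    by (rule integrable_continuous_compact_support[OF _ K(1,2) \<Gamma>]) (auto intro!: continuous_on_mult c simp: D0)
  have "(LINT x|lebesgue_on \<Gamma>. \<phi> x * frechet_derivative \<theta> (at x) v) +
      (LINT x|lebesgue_on \<Gamma>. frechet_derivative \<phi> (at x) v * \<theta> x) =
      (LINT x|lebesgue_on \<Gamma>. frechet_derivative (\<lambda>x. \<phi> x * \<theta> x) (at x) v)"
    using 1 2 by (simp add: frechet_derivative_mult_Ck[OF C] Bochner_Integration.integral_add)
  also have "\<dots> = (LINT x|lebesgue. frechet_derivative (\<lambda>x. \<phi> x * \<theta> x) (at x) v)"
  proof (rule integral_lebesgue_on_eq_UNIV[OF \<Gamma>])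
    fix x assume "x \<notin> \<Gamma>"
    then have "x \<notin> K" using K(2) by blast
    then show "frechet_derivative (\<lambda>x. \<phi> x * \<theta> x) (at x) v = 0"
      unfolding frechet_derivative_mult_Ck[OF C] by (simp add: K(3) D0)
  qed
  also have "\<dots> = 0"
    by (rule integral_directional_derivative_zero[OF Ck_mult[OF C] K(1)]) (simp add: K(3))
  finally show ?thesis by simp
qed

section \<open>The fundamental lemma and density in the space of square integrable functions\<close>

lemma AE_lebesgue_on_negligible:
  assumes "\<Gamma> \<in> sets lebesgue" "negligible N" "\<And>x. x \<in> \<Gamma> \<Longrightarrow> x \<notin> N \<Longrightarrow> P x"
  shows "AE x in lebesgue_on \<Gamma>. P x"
proof -
  have "AE x in lebesgue. x \<notin> N"
    using assms(2) by (intro AE_not_in) (simp add: negligible_iff_null_sets)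
  then have "AE x in lebesgue. x \<in> \<Gamma> \<longrightarrow> P x"
    by eventually_elim (use assms(3) in blast)
  then show ?thesis using assms(1) by (subst AE_restrict_space_iff) auto
qed

text \<open>This is one half of the equivalence of Lebesgue measurability with the property of being an
  almost everywhere limit of continuous functions.\<close>
lemma lebesgue_measurable_limit_continuous:
  fixes f :: "'a::euclidean_space \<Rightarrow> real"
  assumes "\<Gamma> \<in> sets lebesgue" "f \<in> borel_measurable (lebesgue_on \<Gamma>)"
  obtains s where "\<And>n::nat. continuous_on UNIV (s n)" "AE x in lebesgue_on \<Gamma>. (\<lambda>n. s n x) \<longlonglongrightarrow> f x"
proof -
  have "f measurable_on \<Gamma>"
    using measurable_on_iff_borel_measurable[OF assms(1)] assms(2) by blast
  then obtain N s where s: "negligible N" "\<forall>n. continuous_on UNIV (s n)"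
    "\<forall>x. x \<notin> N \<longrightarrow> (\<lambda>n. s n x) \<longlonglongrightarrow> (if x \<in> \<Gamma> then f x else 0)"
    unfolding measurable_on_def by blast
  have "AE x in lebesgue_on \<Gamma>. (\<lambda>n. s n x) \<longlonglongrightarrow> f x"
  proof (rule AE_lebesgue_on_negligible[OF assms(1) s(1)])
    fix x assume "x \<in> \<Gamma>" "x \<notin> N"
    then show "(\<lambda>n. s n x) \<longlonglongrightarrow> f x" using s(3) by (metis (full_types))
  qed
  then show ?thesis using that s(2) by blast
qed

lemma clamp_continuous_tendsto:
  fixes f :: "'a::euclidean_space \<Rightarrow> real"
  assumes "\<Gamma> \<in> sets lebesgue" "f \<in> borel_measurable (lebesgue_on \<Gamma>)" "k \<ge> 0"
  obtains s where "\<And>n::nat. continuous_on UNIV (s n)" "\<And>n x. \<bar>s n x\<bar> \<le> k"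
    "AE x in lebesgue_on \<Gamma>. (\<lambda>n. s n x) \<longlonglongrightarrow> max (- k) (min k (f x))"
proof -
  obtain s where s: "\<And>n::nat. continuous_on UNIV (s n)" "AE x in lebesgue_on \<Gamma>. (\<lambda>n. s n x) \<longlonglongrightarrow> f x"
    using lebesgue_measurable_limit_continuous[OF assms(1,2)] by blast
  show ?thesis
  proof
    show "continuous_on UNIV (\<lambda>x. max (- k) (min k (s n x)))" for n
      by (intro continuous_intros s)
    show "\<bar>max (- k) (min k (s n x))\<bar> \<le> k" for n x using assms(3) by auto
    show "AE x in lebesgue_on \<Gamma>. (\<lambda>n. max (- k) (min k (s n x))) \<longlonglongrightarrow> max (- k) (min k (f x))"
      using s(2) by eventually_elim (intro tendsto_intros)
  qed
qed

lemma locally_integrable_integrable_mult: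
  fixes f g :: "'a::euclidean_space \<Rightarrow> real"
  assumes "open \<Gamma>" "locally_integrable \<Gamma> f" "compact Q" "Q \<subseteq> \<Gamma>"
    and "g \<in> borel_measurable (lebesgue_on \<Gamma>)" "\<And>x. x \<notin> Q \<Longrightarrow> g x = 0" "\<And>x. \<bar>g x\<bar> \<le> B"
  shows "integrable (lebesgue_on \<Gamma>) (\<lambda>x. f x * g x)"
    and "integrable (lebesgue_on \<Gamma>) (\<lambda>x. indicator Q x * f x)"
proof -
  have \<Gamma>: "\<Gamma> \<in> sets lebesgue" using assms(1) by simp
  have Q: "Q \<in> sets lebesgue" using lmeasurable_compact[OF assms(3)] by auto
  have "integrable (lebesgue_on Q) f" using assms by (simp add: locally_integrable_def)
  then have "integrable lebesgue (\<lambda>x. indicator Q x *\<^sub>R f x)"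
    using Q by (subst (asm) integrable_restrict_space) auto
  moreover have "(\<lambda>x. indicator \<Gamma> x *\<^sub>R (indicator Q x * f x)) = (\<lambda>x. indicator Q x *\<^sub>R f x)"
    using assms(4) by (auto simp: fun_eq_iff indicator_def)
  ultimately show i: "integrable (lebesgue_on \<Gamma>) (\<lambda>x. indicator Q x * f x)"
    using \<Gamma> by (subst integrable_restrict_space) auto
  have fm: "f \<in> borel_measurable (lebesgue_on \<Gamma>)" using assms(2) by (simp add: locally_integrable_def)
  show "integrable (lebesgue_on \<Gamma>) (\<lambda>x. f x * g x)"
  proof (rule Bochner_Integration.integrable_bound)
    show "integrable (lebesgue_on \<Gamma>) (\<lambda>x. B * (indicator Q x * f x))"
      using i by (rule integrable_mult_right)
    show "(\<lambda>x. f x * g x) \<in> borel_measurable (lebesgue_on \<Gamma>)"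
      by (intro borel_measurable_times fm assms(5))
    have "\<bar>f x\<bar> * \<bar>g x\<bar> \<le> \<bar>B\<bar> * \<bar>f x\<bar>" for x
      using assms(7)[of x] by (subst mult.commute) (auto intro!: mult_right_mono)
    then show "AE x in lebesgue_on \<Gamma>. norm (f x * g x) \<le> norm (B * (indicator Q x * f x))"
      using assms(6) by (intro AE_I2) (auto simp: abs_mult indicator_def)
  qed
qed

text \<open>Approximating \<open>g\<close> uniformly by test functions with support in \<open>Q\<close> changes the integral by at most
  the error times the integral of \<open>\<bar>f\<bar>\<close> over \<open>Q\<close>.\<close>
lemma integral_against_continuous_zero:
  fixes f g :: "'a::euclidean_space \<Rightarrow> real"
  assumes "open \<Gamma>" and f: "locally_integrable \<Gamma> f"
    and orth: "\<And>\<phi>. \<phi> \<in> test_functions \<Gamma> \<Longrightarrow> (LINT x|lebesgue_on \<Gamma>. f x * \<phi> x) = 0"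
    and Q: "compact Q" "Q \<subseteq> \<Gamma>" and g: "continuous_on UNIV g" "\<And>x. x \<notin> Q \<Longrightarrow> g x = 0"
  shows "(LINT x|lebesgue_on \<Gamma>. f x * g x) = 0"
proof (rule ccontr)
  let ?M = "lebesgue_on \<Gamma>" let ?I = "LINT x|lebesgue_on \<Gamma>. f x * g x"
  assume ne: "?I \<noteq> 0"
  obtain B where B: "\<And>x. norm (g x) \<le> B" using continuous_compact_bounded[OF g(1) Q(1) g(2)] by blast
  note gm = continuous_lebesgue_measurable[OF g(1)]
  have fg: "integrable ?M (\<lambda>x. f x * g x)"
    by (rule locally_integrable_integrable_mult(1)[OF assms(1) f Q gm g(2)]) (use B in auto)
  have fQ: "integrable ?M (\<lambda>x. indicator Q x * f x)"
    by (rule locally_integrable_integrable_mult(2)[OF assms(1) f Q gm g(2)]) (use B in auto)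
  define J where "J = (LINT x|?M. \<bar>indicator Q x * f x\<bar>)"
  have J: "J \<ge> 0" by (simp add: J_def)
  \<comment> \<open>small enough for \<open>e * J < \<bar>?I\<bar>\<close>\<close>
  define e where "e = \<bar>?I\<bar> / (2 * (J + 1))"
  have e: "e > 0" using ne J by (simp add: e_def)
  obtain \<phi> where \<phi>: "\<phi> \<in> core UNIV \<Gamma>" "\<And>x. x \<notin> Q \<Longrightarrow> \<phi> x = 0" "\<And>x. \<bar>\<phi> x - g x\<bar> < e"
    using core_uniform_approx[OF open_UNIV closure_UNIV Q g e] by blast
  have test: "\<phi> \<in> test_functions \<Gamma>" using \<phi>(1) by (simp add: core_UNIV)
  obtain B' where B': "\<And>x. norm (\<phi> x) \<le> B'"
    using continuous_compact_bounded[OF test_function_continuous[OF test] Q(1) \<phi>(2)] by blast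
  have f\<phi>: "integrable ?M (\<lambda>x. f x * \<phi> x)"
    by (rule locally_integrable_integrable_mult(1)[OF assms(1) f Q
        continuous_lebesgue_measurable[OF test_function_continuous[OF test]] \<phi>(2)]) (use B' in auto)
  have "?I = (LINT x|?M. f x * g x) - (LINT x|?M. f x * \<phi> x)" using orth[OF test] by simp
  also have "\<dots> = (LINT x|?M. f x * (g x - \<phi> x))" using fg f\<phi> by (simp add: right_diff_distrib)
  finally have "\<bar>?I\<bar> \<le> (LINT x|?M. \<bar>f x * (g x - \<phi> x)\<bar>)" using integral_abs_bound by metis
  also have "\<dots> \<le> (LINT x|?M. e * \<bar>indicator Q x * f x\<bar>)"
  proof (rule integral_mono)
    show "integrable ?M (\<lambda>x. \<bar>f x * (g x - \<phi> x)\<bar>)"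
      using fg f\<phi> by (auto simp: right_diff_distrib intro!: integrable_abs)
    show "integrable ?M (\<lambda>x. e * \<bar>indicator Q x * f x\<bar>)"
      using fQ by (intro integrable_mult_right integrable_abs)
    show "\<bar>f x * (g x - \<phi> x)\<bar> \<le> e * \<bar>indicator Q x * f x\<bar>" for x
    proof (cases "x \<in> Q")
      case True
      have "\<bar>f x\<bar> * \<bar>g x - \<phi> x\<bar> \<le> \<bar>f x\<bar> * e"
        using \<phi>(3)[of x] by (intro mult_left_mono) auto
      then show ?thesis using True by (simp add: abs_mult mult.commute)
    qed (simp add: g(2) \<phi>(2))
  qed
  also have "\<dots> = e * J" by (simp add: J_def)
  also have "\<dots> < \<bar>?I\<bar>"
  proof -
    have "\<bar>?I\<bar> * (J / (2 * (J + 1))) < \<bar>?I\<bar> * 1"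
      using ne J by (intro mult_strict_left_mono) (auto simp: divide_simps)
    then show ?thesis by (simp add: e_def)
  qed
  finally show False by simp
qed

text \<open>The orthogonality extends from test functions to continuous functions of compact support. Testing
  with bounded continuous functions that converge almost everywhere to the sign of \<open>f\<close>, times a cutoff,
  shows that \<open>\<bar>f\<bar>\<close> has integral zero over every compact subset, and these exhaust \<open>\<Gamma>\<close>.\<close>
lemma fundamental_lemma_of_variations:
  fixes f :: "'a::euclidean_space \<Rightarrow> real"
  assumes "open \<Gamma>" and f: "locally_integrable \<Gamma> f"
    and orth: "\<And>\<phi>. \<phi> \<in> test_functions \<Gamma> \<Longrightarrow> (LINT x|lebesgue_on \<Gamma>. f x * \<phi> x) = 0"
  shows "AE x in lebesgue_on \<Gamma>. f x = 0"
proof -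
  let ?M = "lebesgue_on \<Gamma>"
  have \<Gamma>: "\<Gamma> \<in> sets lebesgue" using assms(1) by simp
  have fm [measurable]: "f \<in> borel_measurable ?M" using f by (simp add: locally_integrable_def)
  have on_compact: "AE x in ?M. x \<in> K \<longrightarrow> f x = 0" if K: "compact K" "K \<subseteq> \<Gamma>" for K
  proof -
    obtain \<theta> Q where \<theta>: "continuous_on UNIV \<theta>" and Q: "compact Q" "Q \<subseteq> \<Gamma>"
      and \<theta>0: "\<And>x. x \<notin> Q \<Longrightarrow> \<theta> x = (0::real)" and \<theta>1: "\<And>x. x \<in> K \<Longrightarrow> \<theta> x = 1"
      and \<theta>b: "\<And>x. 0 \<le> \<theta> x \<and> \<theta> x \<le> 1"
      by (rule continuous_cutoff[OF assms(1) K]) blast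
    have sm: "(\<lambda>x. sgn (f x)) \<in> borel_measurable ?M" by measurable
    obtain s where s: "\<And>n::nat. continuous_on UNIV (s n)" "\<And>n x. \<bar>s n x\<bar> \<le> 1"
      "AE x in ?M. (\<lambda>n. s n x) \<longlonglongrightarrow> max (- 1) (min 1 (sgn (f x)))"
      using clamp_continuous_tendsto[OF \<Gamma> sm zero_le_one] by blast
    have clamp: "max (- 1) (min 1 (sgn (f x))) = sgn (f x)" for x by (simp add: sgn_if)
    note \<theta>m = continuous_lebesgue_measurable[OF \<theta>]
    note iQ = locally_integrable_integrable_mult[OF assms(1) f Q \<theta>m \<theta>0, of 1]
    have "(\<lambda>n. LINT x|?M. f x * (s n x * \<theta> x)) \<longlonglongrightarrow> (LINT x|?M. \<bar>f x\<bar> * \<theta> x)"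
    proof (rule integral_dominated_convergence)
      show "(\<lambda>x. \<bar>f x\<bar> * \<theta> x) \<in> borel_measurable ?M"
        by (intro borel_measurable_times borel_measurable_abs fm \<theta>m)
      show "(\<lambda>x. f x * (s n x * \<theta> x)) \<in> borel_measurable ?M" for n
        by (intro borel_measurable_times fm \<theta>m continuous_lebesgue_measurable s)
      show "integrable ?M (\<lambda>x. \<bar>f x * \<theta> x\<bar>)"
        by (intro integrable_abs iQ) (use \<theta>b in \<open>auto simp: abs_le_iff intro: order_trans\<close>)
      show "AE x in ?M. (\<lambda>n. f x * (s n x * \<theta> x)) \<longlonglongrightarrow> \<bar>f x\<bar> * \<theta> x"
        using s(3)
      proof eventually_elim
        fix x assume "(\<lambda>n. s n x) \<longlonglongrightarrow> max (- 1) (min 1 (sgn (f x)))"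
        then have "(\<lambda>n. f x * (s n x * \<theta> x)) \<longlonglongrightarrow> f x * (sgn (f x) * \<theta> x)"
          unfolding clamp by (intro tendsto_intros)
        then show "(\<lambda>n. f x * (s n x * \<theta> x)) \<longlonglongrightarrow> \<bar>f x\<bar> * \<theta> x"
          by (simp add: abs_sgn mult.assoc)
      qed
      show "AE x in ?M. norm (f x * (s n x * \<theta> x)) \<le> \<bar>f x * \<theta> x\<bar>" for n
      proof (rule AE_I2)
        fix x
        have "\<bar>f x * \<theta> x\<bar> * \<bar>s n x\<bar> \<le> \<bar>f x * \<theta> x\<bar> * 1" by (intro mult_left_mono s) simp
        then show "norm (f x * (s n x * \<theta> x)) \<le> \<bar>f x * \<theta> x\<bar>" by (simp add: abs_mult ac_simps)
      qed
    qed
    moreover have "(LINT x|?M. f x * (s n x * \<theta> x)) = 0" for n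
      by (rule integral_against_continuous_zero[OF assms(1) f orth Q]) (auto intro!: continuous_on_mult s \<theta> simp: \<theta>0)
    ultimately have "(LINT x|?M. \<bar>f x\<bar> * \<theta> x) = 0" using LIMSEQ_unique[OF _ tendsto_const[of "0::real" sequentially]] by simp
    moreover have int: "integrable ?M (\<lambda>x. \<bar>f x\<bar> * \<theta> x)"
    proof -
      have "integrable ?M (\<lambda>x. \<bar>f x * \<theta> x\<bar>)"
        by (intro integrable_abs iQ) (use \<theta>b in \<open>auto simp: abs_le_iff intro: order_trans\<close>)
      then show ?thesis using \<theta>b by (simp add: abs_mult)
    qed
    ultimately have "AE x in ?M. \<bar>f x\<bar> * \<theta> x = 0"
      using integral_nonneg_eq_0_iff_AE[OF int] \<theta>b by simp
    then show ?thesis by eventually_elim (use \<theta>1 in auto)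
  qed
  show ?thesis
  proof (rule open_Union_compact_subsets[OF assms(1)])
    fix C :: "nat \<Rightarrow> 'a set" assume C: "\<And>n. compact (C n)" "\<And>n. C n \<subseteq> \<Gamma>" "\<Union> (range C) = \<Gamma>"
    have "AE x in ?M. \<forall>n. x \<in> C n \<longrightarrow> f x = 0"
      unfolding AE_all_countable using on_compact[OF C(1,2)] by blast
    moreover have "AE x in ?M. x \<in> \<Gamma>" by (rule AE_I2) simp
    ultimately show ?thesis by eventually_elim (use C(3) in blast)
  qed
qed

lemma L2_approx_continuous_by_core:
  fixes g :: "'a::euclidean_space \<Rightarrow> real"
  assumes "open U" "closure U = UNIV" "open \<Gamma>"
    and Q: "compact Q" "Q \<subseteq> \<Gamma>" and g: "continuous_on UNIV g" "\<And>x. x \<notin> Q \<Longrightarrow> g x = 0" and "\<epsilon> > 0"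
  obtains \<phi> where "\<phi> \<in> core U \<Gamma>" "sq (lebesgue_on \<Gamma>) (\<lambda>x. g x - \<phi> x) < \<epsilon>"
proof -
  let ?M = "lebesgue_on \<Gamma>"
  have \<Gamma>: "\<Gamma> \<in> sets lebesgue" using assms(3) by simp
  define m where "m = (LINT x|?M. (indicator Q x :: real))"
  have m: "m \<ge> 0" by (simp add: m_def)
  define d where "d = sqrt (\<epsilon> / (2 * (m + 1)))"
  have d: "d > 0" "d\<^sup>2 = \<epsilon> / (2 * (m + 1))" using \<open>\<epsilon> > 0\<close> m by (auto simp: d_def)
  obtain \<phi> where \<phi>: "\<phi> \<in> core U \<Gamma>" "\<And>x. x \<notin> Q \<Longrightarrow> \<phi> x = 0" "\<And>x. \<bar>\<phi> x - g x\<bar> < d"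
    using core_uniform_approx[OF assms(1,2) Q g d(1)] by blast
  have "\<phi> \<in> test_functions \<Gamma>" using \<phi>(1) core_subset_test_functions by blast
  then have c: "continuous_on UNIV (\<lambda>x. g x - \<phi> x)"
    by (intro continuous_on_diff g test_function_continuous)
  have i: "integrable ?M (\<lambda>x. d\<^sup>2 * indicator Q x :: real)"
    by (intro integrable_mult_right integrable_indicator_compact Q \<Gamma>)
  have "sq ?M (\<lambda>x. g x - \<phi> x) \<le> (LINT x|?M. d\<^sup>2 * indicator Q x)"
  proof (rule integral_mono[OF _ i])
    show "integrable ?M (\<lambda>x. (norm (g x - \<phi> x))\<^sup>2)"
      by (rule L2v_integrable[OF L2v_continuous_compact_support[OF c Q \<Gamma>]]) (simp add: g \<phi>)
    show "(norm (g x - \<phi> x))\<^sup>2 \<le> d\<^sup>2 * indicator Q x" for x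
    proof (cases "x \<in> Q")
      case True
      then show ?thesis
        using \<phi>(3)[of x] power_mono[of "\<bar>g x - \<phi> x\<bar>" d 2] by (simp add: abs_minus_commute)
    qed (simp add: g \<phi>)
  qed
  also have "\<dots> = d\<^sup>2 * m" by (simp add: m_def)
  also have "\<dots> = \<epsilon> * (m / (2 * (m + 1)))" by (simp add: d(2))
  also have "\<dots> < \<epsilon> * 1"
    using \<open>\<epsilon> > 0\<close> m by (intro mult_strict_left_mono) (auto simp: divide_simps)
  finally show ?thesis using that \<phi>(1) by simp
qed

text \<open>The function is truncated in height and by cutoffs along an exhaustion of \<open>\<Gamma>\<close> by compact sets;
  the truncations are limits of continuous functions with a common compact support, and those are
  uniform limits of core functions with the same support.\<close>
lemma core_dense_L2:
  fixes f :: "'a::euclidean_space \<Rightarrow> real"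
  assumes U: "open U" "closure U = UNIV" and "open \<Gamma>"
    and f: "f \<in> L2v (lebesgue_on \<Gamma>)" and "\<epsilon> > 0"
  obtains \<phi> where "\<phi> \<in> core U \<Gamma>" "sq (lebesgue_on \<Gamma>) (\<lambda>x. f x - \<phi> x) < \<epsilon>"
proof (rule open_Union_compact_subsets[OF assms(3)])
  let ?M = "lebesgue_on \<Gamma>"
  have \<Gamma>: "\<Gamma> \<in> sets lebesgue" using assms(3) by simp
  note fm [measurable] = L2v_measurable[OF f]
  fix C :: "nat \<Rightarrow> 'a set" assume C: "\<And>n. compact (C n)" "\<And>n. C n \<subseteq> \<Gamma>" "\<And>n::nat. C n \<subseteq> interior (C (Suc n))"
    "\<Union> (range C) = \<Gamma>" "\<And>K. compact K \<Longrightarrow> K \<subseteq> \<Gamma> \<Longrightarrow> \<exists>N. \<forall>n\<ge>N. K \<subseteq> C n"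
  define P where "P n \<theta> Q \<longleftrightarrow> continuous_on UNIV \<theta> \<and> compact Q \<and> Q \<subseteq> \<Gamma> \<and> (\<forall>x. x \<notin> Q \<longrightarrow> \<theta> x = (0::real)) \<and>
      (\<forall>x\<in>C n. \<theta> x = 1) \<and> (\<forall>x. 0 \<le> \<theta> x \<and> \<theta> x \<le> 1)" for n \<theta> Q
  have "\<forall>n. \<exists>\<theta> Q. P n \<theta> Q"
  proof
    show "\<exists>\<theta> Q. P n \<theta> Q" for n
      unfolding P_def by (rule continuous_cutoff[OF assms(3) C(1,2)[of n]]) blast
  qed
  from choice[OF this] obtain \<theta> where "\<forall>n. \<exists>Q. P n (\<theta> n) Q" by blast
  from choice[OF this] obtain Q where "\<forall>n. P n (\<theta> n) (Q n)" by blast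
  then have \<theta>: "\<And>n. continuous_on UNIV (\<theta> n)" "\<And>n. compact (Q n)" "\<And>n. Q n \<subseteq> \<Gamma>"
    "\<And>n x. x \<notin> Q n \<Longrightarrow> \<theta> n x = (0::real)" "\<And>n x. x \<in> C n \<Longrightarrow> \<theta> n x = 1" "\<And>n x. 0 \<le> \<theta> n x \<and> \<theta> n x \<le> 1"
    by (simp_all add: P_def)
  note \<theta>m [measurable] = continuous_lebesgue_measurable[OF \<theta>(1)]
  define cl where "cl n x = max (- real n) (min (real n) (f x))" for n x
  have clm [measurable]: "cl n \<in> borel_measurable ?M" for n unfolding cl_def by measurable
  have cl_le: "\<bar>cl n x\<bar> \<le> \<bar>f x\<bar>" "\<bar>cl n x\<bar> \<le> real n" for n x by (auto simp: cl_def)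
  have \<theta>_le: "\<bar>a * \<theta> n x\<bar> \<le> \<bar>a\<bar>" for a n x
    using \<theta>(6)[of n x] by (simp add: abs_mult mult_left_le)
  have trunc: "(\<lambda>n. sq ?M (\<lambda>x. f x - cl n x * \<theta> n x)) \<longlonglongrightarrow> 0"
  proof (rule sq_dominated_tendsto_0)
    show "(\<lambda>x. f x - cl n x * \<theta> n x) \<in> borel_measurable ?M" for n by measurable
    show "integrable ?M (\<lambda>x. (2 * \<bar>f x\<bar>)\<^sup>2)" using L2v_integrable[OF f] by (simp add: power_mult_distrib)
    show "\<bar>f x - cl n x * \<theta> n x\<bar> \<le> 2 * \<bar>f x\<bar>" for n x
      using \<theta>_le[of "cl n x" n x] cl_le(1)[of n x] by linarith
    show "AE x in ?M. (\<lambda>n. f x - cl n x * \<theta> n x) \<longlonglongrightarrow> 0"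
    proof (rule AE_I2)
      fix x assume "x \<in> space ?M"
      then have "compact {x}" "{x} \<subseteq> \<Gamma>" by simp_all
      from C(5)[OF this] obtain N where N: "\<forall>n\<ge>N. {x} \<subseteq> C n" ..
      have "f x - cl n x * \<theta> n x = 0" if n: "n \<ge> max N (nat \<lceil>\<bar>f x\<bar>\<rceil>)" for n
      proof -
        have "x \<in> C n" using N n by simp
        then have "\<theta> n x = 1" by (rule \<theta>(5))
        moreover have "\<bar>f x\<bar> \<le> real n" using n by linarith
        ultimately show ?thesis by (auto simp: cl_def)
      qed
      then show "(\<lambda>n. f x - cl n x * \<theta> n x) \<longlonglongrightarrow> 0"
        by (intro tendsto_eventually eventually_sequentiallyI) 
    qed
  qed
  \<comment> \<open>the quasi-triangle inequality is used twice: \<open>2 * e + 2 * (2 * e + 2 * e) = 10 * e\<close>\<close>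
  define e where "e = \<epsilon> / 10"
  have e: "e > 0" using \<open>\<epsilon> > 0\<close> by (simp add: e_def)
  obtain k where k: "sq ?M (\<lambda>x. f x - cl k x * \<theta> k x) < e"
    using LIMSEQ_D[OF trunc e] by auto
  obtain s where s: "\<And>n::nat. continuous_on UNIV (s n)" "\<And>n x. \<bar>s n x\<bar> \<le> real k"
      "AE x in ?M. (\<lambda>n. s n x) \<longlonglongrightarrow> max (- real k) (min (real k) (f x))"
    using clamp_continuous_tendsto[OF \<Gamma> fm, of "real k"] by auto
  note sm [measurable] = continuous_lebesgue_measurable[OF s(1)]
  have cont: "(\<lambda>n. sq ?M (\<lambda>x. cl k x * \<theta> k x - s n x * \<theta> k x)) \<longlonglongrightarrow> 0"
  proof (rule sq_dominated_tendsto_0)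
    show "(\<lambda>x. cl k x * \<theta> k x - s n x * \<theta> k x) \<in> borel_measurable ?M" for n by measurable
    have "(2 * real k * indicator (Q k) x)\<^sup>2 = (2 * real k)\<^sup>2 * indicator (Q k) x" for x
      by (auto simp: indicator_def)
    then show "integrable ?M (\<lambda>x. (2 * real k * indicator (Q k) x)\<^sup>2)"
      using integrable_indicator_compact[OF \<theta>(2,3) \<Gamma>, of k] by simp
    show "\<bar>cl k x * \<theta> k x - s n x * \<theta> k x\<bar> \<le> 2 * real k * indicator (Q k) x" for n x
    proof (cases "x \<in> Q k")
      case True
      then show ?thesis
        using \<theta>_le[of "cl k x" k x] \<theta>_le[of "s n x" k x] cl_le(2)[of k x] s(2)[of n x] by simp
    qed (simp add: \<theta>(4))
    show "AE x in ?M. (\<lambda>n. cl k x * \<theta> k x - s n x * \<theta> k x) \<longlonglongrightarrow> 0"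
      using s(3)
    proof eventually_elim
      fix x assume "(\<lambda>n. s n x) \<longlonglongrightarrow> max (- real k) (min (real k) (f x))"
      then have "(\<lambda>n. cl k x * \<theta> k x - s n x * \<theta> k x) \<longlonglongrightarrow> cl k x * \<theta> k x - cl k x * \<theta> k x"
        unfolding cl_def by (intro tendsto_intros)
      then show "(\<lambda>n. cl k x * \<theta> k x - s n x * \<theta> k x) \<longlonglongrightarrow> 0" by simp
    qed
  qed
  obtain n where n: "sq ?M (\<lambda>x. cl k x * \<theta> k x - s n x * \<theta> k x) < e"
    using LIMSEQ_D[OF cont e] by auto
  have c: "continuous_on UNIV (\<lambda>x. s n x * \<theta> k x)" by (intro continuous_on_mult s \<theta>)
  have z: "s n x * \<theta> k x = 0" if "x \<notin> Q k" for x using \<theta>(4)[OF that] by simp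
  obtain \<phi> where \<phi>: "\<phi> \<in> core U \<Gamma>" "sq ?M (\<lambda>x. s n x * \<theta> k x - \<phi> x) < e"
    using L2_approx_continuous_by_core[OF U assms(3) \<theta>(2,3) c z e] by blast
  have L1: "(\<lambda>x. s n x * \<theta> k x) \<in> L2v ?M"
    by (rule L2v_continuous_compact_support[OF c \<theta>(2,3) \<Gamma> z])
  have L2: "(\<lambda>x. cl k x * \<theta> k x) \<in> L2v ?M"
  proof (rule L2v_I[OF _ L2v_integrable[OF f]])
    show "(\<lambda>x. cl k x * \<theta> k x) \<in> borel_measurable ?M" by measurable
    have "\<bar>cl k x * \<theta> k x\<bar> \<le> \<bar>f x\<bar>" for x
      using \<theta>_le[of "cl k x" k x] cl_le(1)[of k x] by linarith
    then show "AE x in ?M. (norm (cl k x * \<theta> k x))\<^sup>2 \<le> (norm (f x))\<^sup>2"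
      by (intro AE_I2 power_mono) auto
  qed
  have L3: "\<phi> \<in> L2v ?M"
  proof -
    have t: "\<phi> \<in> test_functions \<Gamma>" using \<phi>(1) core_subset_test_functions by blast
    obtain K where "compact K" "K \<subseteq> \<Gamma>" "\<And>x. x \<notin> K \<Longrightarrow> \<phi> x = 0"
      using test_function_support[OF t] by blast
    then show ?thesis
      by (intro L2v_continuous_compact_support[OF test_function_continuous[OF t] _ _ \<Gamma>])
  qed
  have arith: "a < e \<Longrightarrow> b < e \<Longrightarrow> c < e \<Longrightarrow> w \<le> 2 * b + 2 * c \<Longrightarrow> v \<le> 2 * a + 2 * w \<Longrightarrow> v < 10 * e" for a b c v w
    by linarith
  have "sq ?M (\<lambda>x. f x - \<phi> x) < 10 * e"
    by (rule arith[OF k n \<phi>(2) sq_diff_triangle[OF L2 L1 L3] sq_diff_triangle[OF f L2 L3]])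
  also have "\<dots> = \<epsilon>" by (simp add: e_def)
  finally show ?thesis using that \<phi>(1) by blast
qed

section \<open>Weak gradients\<close>

lemma L2v_locally_integrable:
  fixes f :: "'a::euclidean_space \<Rightarrow> 'b::euclidean_space"
  assumes "open \<Gamma>" "f \<in> L2v (lebesgue_on \<Gamma>)"
  shows "locally_integrable \<Gamma> f"
  unfolding locally_integrable_def
proof (intro conjI allI impI)
  show fm: "f \<in> borel_measurable (lebesgue_on \<Gamma>)" by (rule L2v_measurable[OF assms(2)])
  fix K :: "'a set" assume K: "compact K \<and> K \<subseteq> \<Gamma>"
  have \<Gamma>: "\<Gamma> \<in> sets lebesgue" using assms(1) by simp
  have Km: "K \<in> sets lebesgue" using lmeasurable_compact[of K] K by auto
  then have KM: "K \<in> sets (lebesgue_on \<Gamma>)" using K \<Gamma> by (subst sets_restrict_space_iff) auto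
  have bound: "norm a \<le> 1 + (norm a)\<^sup>2" for a :: 'b
  proof -
    have "\<bar>norm a \<bullet> (1::real)\<bar> \<le> 1 * (norm (norm a))\<^sup>2 + (norm (1::real))\<^sup>2 / 1"
      by (rule L2v_inner_bound) simp
    then show ?thesis by simp
  qed
  have "integrable (lebesgue_on \<Gamma>) (\<lambda>x. indicator K x *\<^sub>R f x)"
  proof (rule Bochner_Integration.integrable_bound)
    show "integrable (lebesgue_on \<Gamma>) (\<lambda>x. indicator K x + (norm (f x))\<^sup>2 :: real)"
      using K \<Gamma> by (intro Bochner_Integration.integrable_add integrable_indicator_compact L2v_integrable assms) auto
    show "(\<lambda>x. indicator K x *\<^sub>R f x) \<in> borel_measurable (lebesgue_on \<Gamma>)"
      using KM fm by measurable
    show "AE x in lebesgue_on \<Gamma>. norm (indicator K x *\<^sub>R f x) \<le> norm (indicator K x + (norm (f x))\<^sup>2 :: real)"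
      using bound by (intro AE_I2) (auto simp: indicator_def)
  qed
  then have "integrable lebesgue (\<lambda>x. indicator \<Gamma> x *\<^sub>R (indicator K x *\<^sub>R f x))"
    using \<Gamma> by (subst (asm) integrable_restrict_space) auto
  moreover have "(\<lambda>x. indicator \<Gamma> x *\<^sub>R (indicator K x *\<^sub>R f x)) = (\<lambda>x. indicator K x *\<^sub>R f x)"
    using K by (auto simp: indicator_def fun_eq_iff)
  ultimately have "integrable lebesgue (\<lambda>x. indicator K x *\<^sub>R f x)" by (simp only:)
  then show "integrable (lebesgue_on K) f"
    using Km by (subst integrable_restrict_space) auto
qed

lemma locally_integrable_inner:
  fixes g :: "'a::euclidean_space \<Rightarrow> 'b::euclidean_space"
  assumes "locally_integrable \<Gamma> g" shows "locally_integrable \<Gamma> (\<lambda>x. g x \<bullet> b)"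
  using assms unfolding locally_integrable_def
  by (auto intro: borel_measurable_inner integrable_inner_left)

lemma integrable_mult_test_function:
  assumes "open \<Gamma>" "locally_integrable \<Gamma> (f :: 'a::euclidean_space \<Rightarrow> real)" "\<phi> \<in> test_functions \<Gamma>"
  shows "integrable (lebesgue_on \<Gamma>) (\<lambda>x. f x * \<phi> x)"
    and "integrable (lebesgue_on \<Gamma>) (\<lambda>x. f x * frechet_derivative \<phi> (at x) v)"
proof -
  obtain K where K: "compact K" "K \<subseteq> \<Gamma>" "\<And>x. x \<notin> K \<Longrightarrow> \<phi> x = 0"
    using test_function_support[OF assms(3)] by blast
  note c1 = test_function_continuous[OF assms(3), of UNIV]
  note c2 = test_function_derivative_continuous[OF assms(3), of v]
  have z: "frechet_derivative \<phi> (at x) v = 0" if "x \<notin> K" for x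
    by (rule frechet_derivative_outside_support[OF K(1,3) that])
  obtain B where "\<And>x. norm (\<phi> x) \<le> B" using continuous_compact_bounded[OF c1 K(1,3)] by blast
  then show "integrable (lebesgue_on \<Gamma>) (\<lambda>x. f x * \<phi> x)"
    by (intro locally_integrable_integrable_mult(1)[OF assms(1,2) K(1,2)
        continuous_lebesgue_measurable[OF c1] K(3)]) auto
  obtain B' where "\<And>x. norm (frechet_derivative \<phi> (at x) v) \<le> B'"
    using continuous_compact_bounded[OF c2 K(1) z] by blast
  then show "integrable (lebesgue_on \<Gamma>) (\<lambda>x. f x * frechet_derivative \<phi> (at x) v)"
    by (intro locally_integrable_integrable_mult(1)[OF assms(1,2) K(1,2)
        continuous_lebesgue_measurable[OF c2] z]) auto
qed

lemma weak_gradient_unique: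
  fixes u :: "'a::euclidean_space \<Rightarrow> real"
  assumes "open \<Gamma>" "has_weak_gradient \<Gamma> u g" "has_weak_gradient \<Gamma> u h"
  shows "AE x in lebesgue_on \<Gamma>. g x = h x"
proof -
  have g: "locally_integrable \<Gamma> g" and h: "locally_integrable \<Gamma> h"
    using assms unfolding has_weak_gradient_def by auto
  have "AE x in lebesgue_on \<Gamma>. \<forall>b\<in>Basis. (g x \<bullet> b) - (h x \<bullet> b) = 0"
  proof (rule AE_finite_allI[OF finite_Basis])
    fix b :: 'a assume b: "b \<in> Basis"
    note gb = locally_integrable_inner[OF g, of b] and hb = locally_integrable_inner[OF h, of b]
    show "AE x in lebesgue_on \<Gamma>. (g x \<bullet> b) - (h x \<bullet> b) = 0"
    proof (rule fundamental_lemma_of_variations[OF assms(1)])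
      show "locally_integrable \<Gamma> (\<lambda>x. g x \<bullet> b - h x \<bullet> b)"
        using gb hb unfolding locally_integrable_def by auto
      fix \<phi> assume \<phi>: "\<phi> \<in> test_functions \<Gamma>"
      have "(LINT x|lebesgue_on \<Gamma>. (g x \<bullet> b - h x \<bullet> b) * \<phi> x) =
          (LINT x|lebesgue_on \<Gamma>. (g x \<bullet> b) * \<phi> x) - (LINT x|lebesgue_on \<Gamma>. (h x \<bullet> b) * \<phi> x)"
        unfolding left_diff_distrib
        by (rule Bochner_Integration.integral_diff integrable_mult_test_function assms(1) gb hb \<phi>)+
      also have "(LINT x|lebesgue_on \<Gamma>. (g x \<bullet> b) * \<phi> x) = (LINT x|lebesgue_on \<Gamma>. (h x \<bullet> b) * \<phi> x)"
      proof -
        have e: "(LINT x|lebesgue_on \<Gamma>. u x * frechet_derivative \<phi> (at x) b) = - (LINT x|lebesgue_on \<Gamma>. (k x \<bullet> b) * \<phi> x)"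
          if "has_weak_gradient \<Gamma> u k" for k
          using that \<phi> b by (simp add: has_weak_gradient_def)
        show ?thesis using e[OF assms(2)] e[OF assms(3)] by linarith
      qed
      finally show "(LINT x|lebesgue_on \<Gamma>. (g x \<bullet> b - h x \<bullet> b) * \<phi> x) = 0" by simp
    qed
  qed
  then show ?thesis by eventually_elim (auto intro: euclidean_eqI)
qed

text \<open>Carrying the gradient along as an argument avoids the choice that is made in the definition of
  \<open>weak_gradient\<close>; by \<open>sobolev_gradient_unique\<close> it is determined almost everywhere.\<close>
definition sobolev :: "'a::euclidean_space set \<Rightarrow> ('a \<Rightarrow> real) \<Rightarrow> ('a \<Rightarrow> 'a) \<Rightarrow> bool" where
  "sobolev \<Gamma> u g \<longleftrightarrow> u \<in> L2v (lebesgue_on \<Gamma>) \<and> g \<in> L2v (lebesgue_on \<Gamma>) \<and> has_weak_gradient \<Gamma> u g"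

lemma sobolevD: "sobolev \<Gamma> u g \<Longrightarrow> u \<in> L2v (lebesgue_on \<Gamma>)" "sobolev \<Gamma> u g \<Longrightarrow> g \<in> L2v (lebesgue_on \<Gamma>)"
  "sobolev \<Gamma> u g \<Longrightarrow> has_weak_gradient \<Gamma> u g"
  by (auto simp: sobolev_def)

lemma sobolev_integral:
  "sobolev \<Gamma> u g \<Longrightarrow> \<phi> \<in> test_functions \<Gamma> \<Longrightarrow> b \<in> Basis \<Longrightarrow>
    (LINT x|lebesgue_on \<Gamma>. u x * frechet_derivative \<phi> (at x) b) = - (LINT x|lebesgue_on \<Gamma>. (g x \<bullet> b) * \<phi> x)"
  by (auto simp: sobolev_def has_weak_gradient_def)

lemma sobolevI:
  assumes "open \<Gamma>" "u \<in> L2v (lebesgue_on \<Gamma>)" "g \<in> L2v (lebesgue_on \<Gamma>)"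
    and "\<And>\<phi> b. \<phi> \<in> test_functions \<Gamma> \<Longrightarrow> b \<in> Basis \<Longrightarrow>
      (LINT x|lebesgue_on \<Gamma>. u x * frechet_derivative \<phi> (at x) b) = - (LINT x|lebesgue_on \<Gamma>. (g x \<bullet> b) * \<phi> x)"
  shows "sobolev \<Gamma> u g"
  using assms L2v_locally_integrable[OF assms(1,2)] L2v_locally_integrable[OF assms(1,3)]
  by (simp add: sobolev_def has_weak_gradient_def)

lemma sobolev_gradient_unique:
  "open \<Gamma> \<Longrightarrow> sobolev \<Gamma> u g \<Longrightarrow> sobolev \<Gamma> u h \<Longrightarrow> AE x in lebesgue_on \<Gamma>. g x = h x"
  using weak_gradient_unique by (auto simp: sobolev_def)

lemma sobolev_weak_gradient:
  assumes "open \<Gamma>" "sobolev \<Gamma> u g"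
  shows "sobolev \<Gamma> u (weak_gradient \<Gamma> u)"
proof -
  have wg: "has_weak_gradient \<Gamma> u (weak_gradient \<Gamma> u)"
    unfolding weak_gradient_def by (rule someI[of "has_weak_gradient \<Gamma> u" g, OF sobolevD(3)[OF assms(2)]])
  have "AE x in lebesgue_on \<Gamma>. g x = weak_gradient \<Gamma> u x"
    by (rule weak_gradient_unique[OF assms(1) sobolevD(3)[OF assms(2)] wg])
  moreover have "weak_gradient \<Gamma> u \<in> borel_measurable (lebesgue_on \<Gamma>)"
    using wg by (simp add: has_weak_gradient_def locally_integrable_def)
  ultimately have "weak_gradient \<Gamma> u \<in> L2v (lebesgue_on \<Gamma>)"
    by (intro L2v_cong_AE[OF sobolevD(2)[OF assms(2)]])
  then show ?thesis using wg sobolevD(1)[OF assms(2)] by (simp add: sobolev_def)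
qed

lemma H1_iff_sobolev:
  assumes "open \<Gamma>" shows "u \<in> H1 \<Gamma> \<longleftrightarrow> (\<exists>g. sobolev \<Gamma> u g)"
proof
  assume u: "u \<in> H1 \<Gamma>"
  then obtain g where "has_weak_gradient \<Gamma> u g" by (auto simp: H1_def)
  then have wg: "has_weak_gradient \<Gamma> u (weak_gradient \<Gamma> u)"
    unfolding weak_gradient_def by (rule someI[of "has_weak_gradient \<Gamma> u" g])
  then have "weak_gradient \<Gamma> u \<in> L2v (lebesgue_on \<Gamma>)"
    using u by (simp add: L2v_def H1_def has_weak_gradient_def locally_integrable_def)
  then show "\<exists>g. sobolev \<Gamma> u g"
    using wg u by (intro exI[of _ "weak_gradient \<Gamma> u"]) (simp add: sobolev_def H1_def L2_eq_L2v)
next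
  assume "\<exists>g. sobolev \<Gamma> u g"
  then obtain g where "sobolev \<Gamma> u g" by blast
  note sobolev_weak_gradient[OF assms this]
  then show "u \<in> H1 \<Gamma>"
    by (auto simp: H1_def L2_eq_L2v sobolev_def intro: L2v_integrable)
qed

lemma dirichlet_integral_sobolev:
  assumes "open \<Gamma>" "sobolev \<Gamma> u g" "sobolev \<Gamma> v h"
  shows "dirichlet_integral \<Gamma> u v = (LINT x|lebesgue_on \<Gamma>. g x \<bullet> h x)"
  unfolding dirichlet_integral_def
proof (rule integral_cong_AE)
  note gm = sobolev_weak_gradient[OF assms(1,2)] and hm = sobolev_weak_gradient[OF assms(1,3)]
  note [measurable] = sobolevD(2)[OF gm, THEN L2v_measurable] sobolevD(2)[OF hm, THEN L2v_measurable]
    sobolevD(2)[OF assms(2), THEN L2v_measurable] sobolevD(2)[OF assms(3), THEN L2v_measurable]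
  show "(\<lambda>x. weak_gradient \<Gamma> u x \<bullet> weak_gradient \<Gamma> v x) \<in> borel_measurable (lebesgue_on \<Gamma>)" by measurable
  show "(\<lambda>x. g x \<bullet> h x) \<in> borel_measurable (lebesgue_on \<Gamma>)" by measurable
  show "AE x in lebesgue_on \<Gamma>. weak_gradient \<Gamma> u x \<bullet> weak_gradient \<Gamma> v x = g x \<bullet> h x"
    using sobolev_gradient_unique[OF assms(1) gm assms(2)] sobolev_gradient_unique[OF assms(1) hm assms(3)]
    by eventually_elim simp
qed

lemma dirichlet_integral_self:
  assumes "open \<Gamma>" "sobolev \<Gamma> u g"
  shows "dirichlet_integral \<Gamma> u u = sq (lebesgue_on \<Gamma>) g"
  by (simp add: dirichlet_integral_sobolev[OF assms assms(2)] power2_norm_eq_inner)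

lemma sobolev_add:
  assumes "open \<Gamma>" "sobolev \<Gamma> u g" "sobolev \<Gamma> v h"
  shows "sobolev \<Gamma> (\<lambda>x. u x + v x) (\<lambda>x. g x + h x)"
proof (rule sobolevI[OF assms(1)])
  show "(\<lambda>x. u x + v x) \<in> L2v (lebesgue_on \<Gamma>)" "(\<lambda>x. g x + h x) \<in> L2v (lebesgue_on \<Gamma>)"
    using assms(2,3) by (auto intro!: L2v_add simp: sobolev_def)
  fix \<phi> and b :: 'a assume \<phi>: "\<phi> \<in> test_functions \<Gamma>" and b: "b \<in> Basis"
  have l: "locally_integrable \<Gamma> u" "locally_integrable \<Gamma> v" "locally_integrable \<Gamma> (\<lambda>x. g x \<bullet> b)" "locally_integrable \<Gamma> (\<lambda>x. h x \<bullet> b)"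
    using assms(2,3) by (auto intro!: L2v_locally_integrable[OF assms(1)] locally_integrable_inner simp: sobolev_def)
  note i = integrable_mult_test_function[OF assms(1) _ \<phi>]
  have "(LINT x|lebesgue_on \<Gamma>. (u x + v x) * frechet_derivative \<phi> (at x) b) =
      (LINT x|lebesgue_on \<Gamma>. u x * frechet_derivative \<phi> (at x) b) + (LINT x|lebesgue_on \<Gamma>. v x * frechet_derivative \<phi> (at x) b)"
    unfolding distrib_right by (intro Bochner_Integration.integral_add i l)
  also have "\<dots> = - ((LINT x|lebesgue_on \<Gamma>. (g x \<bullet> b) * \<phi> x) + (LINT x|lebesgue_on \<Gamma>. (h x \<bullet> b) * \<phi> x))"
    by (simp add: sobolev_integral[OF assms(2) \<phi> b] sobolev_integral[OF assms(3) \<phi> b])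
  also have "(LINT x|lebesgue_on \<Gamma>. (g x \<bullet> b) * \<phi> x) + (LINT x|lebesgue_on \<Gamma>. (h x \<bullet> b) * \<phi> x) =
      (LINT x|lebesgue_on \<Gamma>. ((g x + h x) \<bullet> b) * \<phi> x)"
    unfolding inner_add_left distrib_right by (intro Bochner_Integration.integral_add[symmetric] i l)
  finally show "(LINT x|lebesgue_on \<Gamma>. (u x + v x) * frechet_derivative \<phi> (at x) b) =
      - (LINT x|lebesgue_on \<Gamma>. ((g x + h x) \<bullet> b) * \<phi> x)" .
qed

lemma sobolev_scale:
  assumes "open \<Gamma>" "sobolev \<Gamma> u g"
  shows "sobolev \<Gamma> (\<lambda>x. c * u x) (\<lambda>x. c *\<^sub>R g x)"
proof (rule sobolevI[OF assms(1)])
  show "(\<lambda>x. c * u x) \<in> L2v (lebesgue_on \<Gamma>)" "(\<lambda>x. c *\<^sub>R g x) \<in> L2v (lebesgue_on \<Gamma>)"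
    using assms(2) by (auto intro!: L2v_mult L2v_scaleR simp: sobolev_def)
  fix \<phi> and b :: 'a assume \<phi>: "\<phi> \<in> test_functions \<Gamma>" and b: "b \<in> Basis"
  show "(LINT x|lebesgue_on \<Gamma>. (c * u x) * frechet_derivative \<phi> (at x) b) =
      - (LINT x|lebesgue_on \<Gamma>. ((c *\<^sub>R g x) \<bullet> b) * \<phi> x)"
    using sobolev_integral[OF assms(2) \<phi> b] by (simp add: mult.assoc)
qed

lemma sobolev_diff:
  assumes "open \<Gamma>" "sobolev \<Gamma> u g" "sobolev \<Gamma> v h"
  shows "sobolev \<Gamma> (\<lambda>x. u x - v x) (\<lambda>x. g x - h x)"
  using sobolev_add[OF assms(1,2) sobolev_scale[OF assms(1,3), of "-1"]] by simp

lemma sobolev_cong_AE: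
  assumes "open \<Gamma>" "sobolev \<Gamma> u g" "v \<in> borel_measurable (lebesgue_on \<Gamma>)" "AE x in lebesgue_on \<Gamma>. u x = v x"
  shows "sobolev \<Gamma> v g"
proof (rule sobolevI[OF assms(1)])
  note um = sobolevD(1)[OF assms(2), THEN L2v_measurable]
  show "v \<in> L2v (lebesgue_on \<Gamma>)" by (rule L2v_cong_AE[OF sobolevD(1)[OF assms(2)] assms(3,4)])
  show "g \<in> L2v (lebesgue_on \<Gamma>)" by (rule sobolevD(2)[OF assms(2)])
  fix \<phi> and b :: 'a assume \<phi>: "\<phi> \<in> test_functions \<Gamma>" and b: "b \<in> Basis"
  note dm = continuous_lebesgue_measurable[OF test_function_derivative_continuous[OF \<phi>, of b]]
  have "(LINT x|lebesgue_on \<Gamma>. v x * frechet_derivative \<phi> (at x) b) = (LINT x|lebesgue_on \<Gamma>. u x * frechet_derivative \<phi> (at x) b)"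
    by (intro integral_cong_AE borel_measurable_times um assms(3) dm) (use assms(4) in eventually_elim, simp)
  then show "(LINT x|lebesgue_on \<Gamma>. v x * frechet_derivative \<phi> (at x) b) = - (LINT x|lebesgue_on \<Gamma>. (g x \<bullet> b) * \<phi> x)"
    using sobolev_integral[OF assms(2) \<phi> b] by simp
qed

definition gradient :: "('a::euclidean_space \<Rightarrow> real) \<Rightarrow> 'a \<Rightarrow> 'a" where
  "gradient \<phi> x = (\<Sum>b\<in>Basis. frechet_derivative \<phi> (at x) b *\<^sub>R b)"

lemma gradient_inner_Basis: "b \<in> Basis \<Longrightarrow> gradient \<phi> x \<bullet> b = frechet_derivative \<phi> (at x) b"
  unfolding gradient_def by (rule inner_sum_left_Basis)

lemma gradient_continuous:
  assumes "\<phi> \<in> test_functions \<Gamma>" shows "continuous_on UNIV (gradient \<phi>)"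
  unfolding gradient_def[abs_def]
  by (intro continuous_on_sum continuous_on_scaleR test_function_derivative_continuous[OF assms] continuous_on_const)

lemma gradient_add:
  assumes "Ck (Suc 0) \<phi>" "Ck (Suc 0) \<psi>"
  shows "gradient (\<lambda>x. \<phi> x + \<psi> x) x = gradient \<phi> x + gradient \<psi> x"
  by (simp add: gradient_def frechet_derivative_add_Ck[OF assms] scaleR_add_left sum.distrib)

lemma gradient_compose:
  fixes \<psi> :: "real \<Rightarrow> real"
  assumes "(\<psi> has_real_derivative D) (at (\<phi> x))" "Ck (Suc 0) \<phi>"
  shows "gradient (\<lambda>x. \<psi> (\<phi> x)) x = D *\<^sub>R gradient \<phi> x"
proof -
  have "((\<lambda>x. \<psi> (\<phi> x)) has_derivative (\<lambda>v. D * frechet_derivative \<phi> (at x) v)) (at x)"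
    using has_derivative_compose[OF Ck_Suc_has_derivative[OF assms(2)] assms(1)[unfolded has_field_derivative_def]] .
  then have "frechet_derivative (\<lambda>x. \<psi> (\<phi> x)) (at x) = (\<lambda>v. D * frechet_derivative \<phi> (at x) v)"
    by (rule frechet_derivative_at[symmetric])
  then show ?thesis by (simp add: gradient_def scaleR_sum_right)
qed

lemma gradient_scale:
  assumes "Ck (Suc 0) \<phi>" shows "gradient (\<lambda>x. c * \<phi> x) x = c *\<^sub>R gradient \<phi> x"
proof -
  have "((\<lambda>t. c * t) has_real_derivative c) (at (\<phi> x))" by (auto intro!: derivative_eq_intros)
  from gradient_compose[OF this assms] show ?thesis .
qed

lemma test_function_sobolev:
  assumes "open \<Gamma>" "\<phi> \<in> test_functions \<Gamma>"
  shows "sobolev \<Gamma> \<phi> (gradient \<phi>)"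
proof (rule sobolevI[OF assms(1)])
  obtain K where K: "compact K" "K \<subseteq> \<Gamma>" "\<And>x. x \<notin> K \<Longrightarrow> \<phi> x = 0"
    using test_function_support[OF assms(2)] by blast
  have \<Gamma>: "\<Gamma> \<in> sets lebesgue" using assms(1) by simp
  show "\<phi> \<in> L2v (lebesgue_on \<Gamma>)"
    by (rule L2v_continuous_compact_support[OF test_function_continuous[OF assms(2)] K(1,2) \<Gamma> K(3)])
  have "gradient \<phi> x = 0" if "x \<notin> K" for x
    unfolding gradient_def using frechet_derivative_outside_support[OF K(1,3) that] by simp
  then show "gradient \<phi> \<in> L2v (lebesgue_on \<Gamma>)"
    by (rule L2v_continuous_compact_support[OF gradient_continuous[OF assms(2)] K(1,2) \<Gamma>])
  fix \<theta> and b :: 'a assume "\<theta> \<in> test_functions \<Gamma>" "b \<in> Basis"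
  then show "(LINT x|lebesgue_on \<Gamma>. \<phi> x * frechet_derivative \<theta> (at x) b) = - (LINT x|lebesgue_on \<Gamma>. (gradient \<phi> x \<bullet> b) * \<theta> x)"
    by (simp add: gradient_inner_Basis test_function_integration_by_parts[OF assms(2) _ assms(1)])
qed

text \<open>Both sides of the defining identity are \<open>L\<^sup>2\<close> inner products with a fixed function and therefore
  continuous.\<close>
lemma sobolev_limit:
  assumes "open \<Gamma>" and s: "\<And>n. sobolev \<Gamma> (un n) (gn n)"
    and L: "u \<in> L2v (lebesgue_on \<Gamma>)" "g \<in> L2v (lebesgue_on \<Gamma>)"
    and lim: "(\<lambda>n. sq (lebesgue_on \<Gamma>) (\<lambda>x. un n x - u x)) \<longlonglongrightarrow> 0"
      "(\<lambda>n. sq (lebesgue_on \<Gamma>) (\<lambda>x. gn n x - g x)) \<longlonglongrightarrow> 0"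
  shows "sobolev \<Gamma> u g"
proof (rule sobolevI[OF assms(1) L])
  fix \<phi> and b :: 'a assume \<phi>: "\<phi> \<in> test_functions \<Gamma>" and b: "b \<in> Basis"
  let ?M = "lebesgue_on \<Gamma>"
  have \<Gamma>: "\<Gamma> \<in> sets lebesgue" using assms(1) by simp
  obtain K where K: "compact K" "K \<subseteq> \<Gamma>" "\<And>x. x \<notin> K \<Longrightarrow> \<phi> x = 0"
    using test_function_support[OF \<phi>] by blast
  have 1: "(\<lambda>x. frechet_derivative \<phi> (at x) b) \<in> L2v ?M"
    by (rule L2v_continuous_compact_support[OF test_function_derivative_continuous[OF \<phi>] K(1,2) \<Gamma>])
       (rule frechet_derivative_outside_support[OF K(1,3)])
  have 2: "(\<lambda>x. \<phi> x *\<^sub>R b) \<in> L2v ?M"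
    by (rule L2v_continuous_compact_support[OF _ K(1,2) \<Gamma>])
       (auto intro!: continuous_on_scaleR test_function_continuous[OF \<phi>] simp: K(3))
  have A: "(\<lambda>n. LINT x|?M. un n x * frechet_derivative \<phi> (at x) b) \<longlonglongrightarrow> (LINT x|?M. u x * frechet_derivative \<phi> (at x) b)"
    using sq_tendsto_inner[OF sobolevD(1)[OF s] L(1) 1 lim(1)] by simp
  have B: "(\<lambda>n. - (LINT x|?M. (gn n x \<bullet> b) * \<phi> x)) \<longlonglongrightarrow> - (LINT x|?M. (g x \<bullet> b) * \<phi> x)"
    using tendsto_minus[OF sq_tendsto_inner[OF sobolevD(2)[OF s] L(2) 2 lim(2)]] by (simp add: mult.commute)
  show "(LINT x|?M. u x * frechet_derivative \<phi> (at x) b) = - (LINT x|?M. (g x \<bullet> b) * \<phi> x)"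
    using LIMSEQ_unique[OF A] B unfolding sobolev_integral[OF s \<phi> b] by blast
qed

section \<open>The closure of the core\<close>

definition core_closure :: "real set \<Rightarrow> 'a::euclidean_space set \<Rightarrow> ('a \<Rightarrow> real) \<Rightarrow> ('a \<Rightarrow> 'a) \<Rightarrow> bool" where
  "core_closure U \<Gamma> u g \<longleftrightarrow> sobolev \<Gamma> u g \<and> (\<forall>\<epsilon>>0. \<exists>\<phi>\<in>core U \<Gamma>.
     sq (lebesgue_on \<Gamma>) (\<lambda>x. u x - \<phi> x) < \<epsilon> \<and> sq (lebesgue_on \<Gamma>) (\<lambda>x. g x - gradient \<phi> x) < \<epsilon>)"

definition core_domain :: "real set \<Rightarrow> 'a::euclidean_space set \<Rightarrow> ('a \<Rightarrow> real) set" where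
  "core_domain U \<Gamma> = {u. \<exists>g. core_closure U \<Gamma> u g}"

lemma core_closure_sobolev: "core_closure U \<Gamma> u g \<Longrightarrow> sobolev \<Gamma> u g"
  by (simp add: core_closure_def)

lemma core_closure_approx:
  assumes "core_closure U \<Gamma> u g" "\<epsilon> > 0"
  obtains \<phi> where "\<phi> \<in> core U \<Gamma>" "sq (lebesgue_on \<Gamma>) (\<lambda>x. u x - \<phi> x) < \<epsilon>"
    "sq (lebesgue_on \<Gamma>) (\<lambda>x. g x - gradient \<phi> x) < \<epsilon>"
  using assms unfolding core_closure_def by blast

lemma core_Ck: "\<phi> \<in> core U \<Gamma> \<Longrightarrow> Ck k \<phi>"
  unfolding core_def by (blast intro: smooth_flat_Ck)

lemma core_sobolev: "open \<Gamma> \<Longrightarrow> \<phi> \<in> core U \<Gamma> \<Longrightarrow> sobolev \<Gamma> \<phi> (gradient \<phi>)"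
  using core_subset_test_functions test_function_sobolev by blast

lemma core_closure_core:
  assumes "open \<Gamma>" "\<phi> \<in> core U \<Gamma>" shows "core_closure U \<Gamma> \<phi> (gradient \<phi>)"
  unfolding core_closure_def
proof (intro conjI allI impI)
  show "\<exists>\<theta>\<in>core U \<Gamma>. sq (lebesgue_on \<Gamma>) (\<lambda>x. \<phi> x - \<theta> x) < \<epsilon> \<and> sq (lebesgue_on \<Gamma>) (\<lambda>x. gradient \<phi> x - gradient \<theta> x) < \<epsilon>"
    if "\<epsilon> > 0" for \<epsilon> :: real
    using that by (intro bexI[OF _ assms(2)]) simp
qed (rule core_sobolev[OF assms])

text \<open>The closure of a set is closed; the gradients pass to the limit by \<open>sobolev_limit\<close>.\<close>
lemma core_closure_limit:
  assumes "open \<Gamma>" and s: "\<And>n. core_closure U \<Gamma> (un n) (gn n)"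
    and L: "u \<in> L2v (lebesgue_on \<Gamma>)" "g \<in> L2v (lebesgue_on \<Gamma>)"
    and lim: "(\<lambda>n. sq (lebesgue_on \<Gamma>) (\<lambda>x. un n x - u x)) \<longlonglongrightarrow> 0"
      "(\<lambda>n. sq (lebesgue_on \<Gamma>) (\<lambda>x. gn n x - g x)) \<longlonglongrightarrow> 0"
  shows "core_closure U \<Gamma> u g"
  unfolding core_closure_def
proof (intro conjI allI impI)
  let ?M = "lebesgue_on \<Gamma>"
  note sob = core_closure_sobolev[OF s]
  show "sobolev \<Gamma> u g" by (rule sobolev_limit[OF assms(1) sob L lim])
  fix \<epsilon> :: real assume "\<epsilon> > 0"
  then have e: "\<epsilon> / 4 > 0" by simp
  obtain N1 where N1: "\<forall>n\<ge>N1. norm (sq ?M (\<lambda>x. un n x - u x) - 0) < \<epsilon> / 4" using LIMSEQ_D[OF lim(1) e] ..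
  obtain N2 where N2: "\<forall>n\<ge>N2. norm (sq ?M (\<lambda>x. gn n x - g x) - 0) < \<epsilon> / 4" using LIMSEQ_D[OF lim(2) e] ..
  define n where "n = max N1 N2"
  have n: "sq ?M (\<lambda>x. un n x - u x) < \<epsilon> / 4" "sq ?M (\<lambda>x. gn n x - g x) < \<epsilon> / 4"
    using N1[rule_format, of n] N2[rule_format, of n] by (simp_all add: n_def)
  obtain \<phi> where \<phi>: "\<phi> \<in> core U \<Gamma>" "sq ?M (\<lambda>x. un n x - \<phi> x) < \<epsilon> / 4" "sq ?M (\<lambda>x. gn n x - gradient \<phi> x) < \<epsilon> / 4"
    using core_closure_approx[OF s e] .
  note p = core_sobolev[OF assms(1) \<phi>(1)]
  have arith: "a < \<epsilon> / 4 \<Longrightarrow> b < \<epsilon> / 4 \<Longrightarrow> c \<le> 2 * a + 2 * b \<Longrightarrow> c < \<epsilon>" for a b c by linarith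
  have "sq ?M (\<lambda>x. u x - \<phi> x) < \<epsilon>"
    by (rule arith[OF _ \<phi>(2) sq_diff_triangle[OF L(1) sobolevD(1)[OF sob] sobolevD(1)[OF p]]])
       (subst sq_minus_commute, rule n)
  moreover have "sq ?M (\<lambda>x. g x - gradient \<phi> x) < \<epsilon>"
    by (rule arith[OF _ \<phi>(3) sq_diff_triangle[OF L(2) sobolevD(2)[OF sob] sobolevD(2)[OF p]]])
       (subst sq_minus_commute, rule n)
  ultimately show "\<exists>\<phi>\<in>core U \<Gamma>. sq ?M (\<lambda>x. u x - \<phi> x) < \<epsilon> \<and> sq ?M (\<lambda>x. g x - gradient \<phi> x) < \<epsilon>"
    using \<phi>(1) by (intro bexI[of _ \<phi>] conjI)
qed

lemma core_closure_add:
  assumes "open \<Gamma>" "core_closure U \<Gamma> u g" "core_closure U \<Gamma> v h"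
  shows "core_closure U \<Gamma> (\<lambda>x. u x + v x) (\<lambda>x. g x + h x)"
  unfolding core_closure_def
proof (intro conjI allI impI)
  let ?M = "lebesgue_on \<Gamma>"
  note u = core_closure_sobolev[OF assms(2)] and v = core_closure_sobolev[OF assms(3)]
  show "sobolev \<Gamma> (\<lambda>x. u x + v x) (\<lambda>x. g x + h x)" by (rule sobolev_add[OF assms(1) u v])
  fix \<epsilon> :: real assume "\<epsilon> > 0"
  then have e: "\<epsilon> / 4 > 0" by simp
  obtain \<phi> where \<phi>: "\<phi> \<in> core U \<Gamma>" "sq ?M (\<lambda>x. u x - \<phi> x) < \<epsilon> / 4" "sq ?M (\<lambda>x. g x - gradient \<phi> x) < \<epsilon> / 4"
    using core_closure_approx[OF assms(2) e] .
  obtain \<psi> where \<psi>: "\<psi> \<in> core U \<Gamma>" "sq ?M (\<lambda>x. v x - \<psi> x) < \<epsilon> / 4" "sq ?M (\<lambda>x. h x - gradient \<psi> x) < \<epsilon> / 4"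
    using core_closure_approx[OF assms(3) e] .
  note p = core_sobolev[OF assms(1) \<phi>(1)] and q = core_sobolev[OF assms(1) \<psi>(1)]
  have arith: "a < \<epsilon> / 4 \<Longrightarrow> b < \<epsilon> / 4 \<Longrightarrow> c \<le> 2 * a + 2 * b \<Longrightarrow> c < \<epsilon>" for a b c by linarith
  have C: "Ck (Suc 0) \<phi>" "Ck (Suc 0) \<psi>"
    by (rule core_Ck[OF \<phi>(1)], rule core_Ck[OF \<psi>(1)])
  have gr: "gradient (\<lambda>x. \<phi> x + \<psi> x) x = gradient \<phi> x + gradient \<psi> x" for x
    by (rule gradient_add[OF C])
  have "sq ?M (\<lambda>x. (u x - \<phi> x) + (v x - \<psi> x)) < \<epsilon>"
    by (rule arith[OF \<phi>(2) \<psi>(2) sq_add_le2[OF L2v_diff L2v_diff]]) (rule sobolevD[OF u] sobolevD[OF v] sobolevD[OF p] sobolevD[OF q])+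
  moreover have "sq ?M (\<lambda>x. (g x - gradient \<phi> x) + (h x - gradient \<psi> x)) < \<epsilon>"
    by (rule arith[OF \<phi>(3) \<psi>(3) sq_add_le2[OF L2v_diff L2v_diff]]) (rule sobolevD[OF u] sobolevD[OF v] sobolevD[OF p] sobolevD[OF q])+
  ultimately show "\<exists>\<theta>\<in>core U \<Gamma>. sq ?M (\<lambda>x. u x + v x - \<theta> x) < \<epsilon> \<and> sq ?M (\<lambda>x. g x + h x - gradient \<theta> x) < \<epsilon>"
    by (intro bexI[OF _ core_add[OF \<phi>(1) \<psi>(1)]]) (simp add: gr add_diff_add)
qed

lemma core_closure_scale:
  assumes "open \<Gamma>" "core_closure U \<Gamma> u g"
  shows "core_closure U \<Gamma> (\<lambda>x. c * u x) (\<lambda>x. c *\<^sub>R g x)"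
  unfolding core_closure_def
proof (intro conjI allI impI)
  let ?M = "lebesgue_on \<Gamma>"
  note u = core_closure_sobolev[OF assms(2)]
  show "sobolev \<Gamma> (\<lambda>x. c * u x) (\<lambda>x. c *\<^sub>R g x)" by (rule sobolev_scale[OF assms(1) u])
  fix \<epsilon> :: real assume "\<epsilon> > 0"
  define e where "e = \<epsilon> / (c\<^sup>2 + 1)"
  have c: "c\<^sup>2 + 1 > 0" by (simp add: add_nonneg_pos)
  have e: "e > 0" using \<open>\<epsilon> > 0\<close> c by (simp add: e_def)
  obtain \<phi> where \<phi>: "\<phi> \<in> core U \<Gamma>" "sq ?M (\<lambda>x. u x - \<phi> x) < e" "sq ?M (\<lambda>x. g x - gradient \<phi> x) < e"
    using core_closure_approx[OF assms(2) e] .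
  have C: "Ck (Suc 0) \<phi>" by (rule core_Ck[OF \<phi>(1)])
  have small: "c\<^sup>2 * a < \<epsilon>" if "a < e" for a
  proof -
    have "c\<^sup>2 * a \<le> c\<^sup>2 * e" using that by (intro mult_left_mono) auto
    also have "\<dots> < (c\<^sup>2 + 1) * e" using e by (simp add: distrib_right)
    also have "\<dots> = \<epsilon>" using c by (simp add: e_def)
    finally show ?thesis .
  qed
  have "sq ?M (\<lambda>x. c * u x - c * \<phi> x) < \<epsilon>"
    using small[OF \<phi>(2)] unfolding right_diff_distrib[symmetric] sq_mult .
  moreover have "sq ?M (\<lambda>x. c *\<^sub>R g x - gradient (\<lambda>x. c * \<phi> x) x) < \<epsilon>"
    using small[OF \<phi>(3)] unfolding gradient_scale[OF C] scaleR_diff_right[symmetric] sq_scaleR .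
  ultimately show "\<exists>\<theta>\<in>core U \<Gamma>. sq ?M (\<lambda>x. c * u x - \<theta> x) < \<epsilon> \<and> sq ?M (\<lambda>x. c *\<^sub>R g x - gradient \<theta> x) < \<epsilon>"
    by (intro bexI[OF _ core_scale[OF \<phi>(1)]] conjI)
qed

lemma core_closure_cong_AE:
  assumes "open \<Gamma>" "core_closure U \<Gamma> u g" "v \<in> borel_measurable (lebesgue_on \<Gamma>)" "AE x in lebesgue_on \<Gamma>. u x = v x"
  shows "core_closure U \<Gamma> v g"
  unfolding core_closure_def
proof (intro conjI allI impI)
  let ?M = "lebesgue_on \<Gamma>"
  note u = core_closure_sobolev[OF assms(2)]
  show "sobolev \<Gamma> v g" by (rule sobolev_cong_AE[OF assms(1) u assms(3,4)])
  fix \<epsilon> :: real assume e: "\<epsilon> > 0"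
  obtain \<phi> where \<phi>: "\<phi> \<in> core U \<Gamma>" "sq ?M (\<lambda>x. u x - \<phi> x) < \<epsilon>" "sq ?M (\<lambda>x. g x - gradient \<phi> x) < \<epsilon>"
    using core_closure_approx[OF assms(2) e] .
  note [measurable] = L2v_measurable[OF sobolevD(1)[OF core_sobolev[OF assms(1) \<phi>(1)]]]
    L2v_measurable[OF sobolevD(1)[OF u]] assms(3)
  have "sq ?M (\<lambda>x. u x - \<phi> x) = sq ?M (\<lambda>x. v x - \<phi> x)"
  proof (rule sq_cong_AE)
    show "(\<lambda>x. u x - \<phi> x) \<in> borel_measurable ?M" "(\<lambda>x. v x - \<phi> x) \<in> borel_measurable ?M" by measurable
    show "AE x in ?M. u x - \<phi> x = v x - \<phi> x" using assms(4) by eventually_elim simp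
  qed
  then show "\<exists>\<phi>\<in>core U \<Gamma>. sq ?M (\<lambda>x. v x - \<phi> x) < \<epsilon> \<and> sq ?M (\<lambda>x. g x - gradient \<phi> x) < \<epsilon>"
    using \<phi> by (intro bexI[OF _ \<phi>(1)]) simp
qed

text \<open>Weak compactness in the Hilbert space \<open>H\<^sup>1\<close> would give this by the Banach-Saks theorem; here is the
  underlying elementary argument. Among the elements of the closure within \<open>L\<^sup>2\<close>-distance \<open>sqrt (r n)\<close> of
  \<open>v\<close>, a convex set, let \<open>m n\<close> be the infimum of the energies and let \<open>c n\<close> almost attain it. Midpoints of
  \<open>c n\<close> and \<open>c k\<close> have energy at least \<open>m n\<close>, so by the parallelogram law the gradients of the \<open>c n\<close> form a
  Cauchy sequence, because \<open>m\<close> increases and is bounded by \<open>B\<close>.\<close>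
lemma core_closure_lower_semicontinuous:
  fixes \<Gamma> :: "'a::euclidean_space set"
  assumes "open \<Gamma>" and w: "\<And>n. core_closure U \<Gamma> (w n) (g n)" and v: "v \<in> L2v (lebesgue_on \<Gamma>)"
    and lim: "(\<lambda>n. sq (lebesgue_on \<Gamma>) (\<lambda>x. w n x - v x)) \<longlonglongrightarrow> 0"
    and B: "\<And>n. sq (lebesgue_on \<Gamma>) (g n) \<le> B"
  obtains h where "core_closure U \<Gamma> v h" "sq (lebesgue_on \<Gamma>) h \<le> B"
proof -
  let ?M = "lebesgue_on \<Gamma>"
  define r where "r n = inverse (real (Suc n))" for n
  have r: "r n > 0" for n by (simp add: r_def)
  have r_mono: "r k \<le> r n" if "n \<le> k" for n k using that by (simp add: r_def le_imp_inverse_le)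
  have r0: "r \<longlonglongrightarrow> 0" unfolding r_def by (rule LIMSEQ_inverse_real_of_nat)
  define A where "A n = {sq ?M h |c h. core_closure U \<Gamma> c h \<and> sq ?M (\<lambda>x. c x - v x) \<le> r n}" for n
  define m where "m n = Inf (A n)" for n
  have bdd: "bdd_below (A n)" for n by (rule bdd_belowI[of _ 0]) (auto simp: A_def)
  have Aex: "\<exists>k. sq ?M (g k) \<in> A n" for n
  proof -
    obtain k where "norm (sq ?M (\<lambda>x. w k x - v x) - 0) < r n" using LIMSEQ_D[OF lim r] by blast
    then have "sq ?M (\<lambda>x. w k x - v x) \<le> r n" by simp
    then show ?thesis using w[of k] unfolding A_def by blast
  qed
  have A_mono: "A k \<subseteq> A n" if "n \<le> k" for n k
    using r_mono[OF that] unfolding A_def by (blast intro: order_trans)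
  have m_le: "m n \<le> a" if "a \<in> A n" for a n unfolding m_def by (rule cInf_lower[OF that bdd])
  have m_mono: "m n \<le> m k" if "n \<le> k" for n k
    unfolding m_def using Aex[of k] by (intro cInf_superset_mono bdd A_mono that) auto
  have m_B: "m n \<le> B" for n
  proof -
    obtain k where "sq ?M (g k) \<in> A n" using Aex by blast
    then show ?thesis using m_le B[of k] by (blast intro: order_trans)
  qed
  have B0: "B \<ge> 0" using B[of 0] sq_nonneg[of ?M "g 0"] by linarith
  have "\<exists>c h. core_closure U \<Gamma> c h \<and> sq ?M (\<lambda>x. c x - v x) \<le> r n \<and> sq ?M h < m n + r n" for n
  proof -
    have "Inf (A n) < m n + r n" using r[of n] by (simp add: m_def)
    moreover have "A n \<noteq> {}" using Aex[of n] by blast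
    ultimately obtain a where "a \<in> A n" "a < m n + r n" using cInf_lessD by blast
    then show ?thesis unfolding A_def by blast
  qed
  then have "\<forall>n. \<exists>p. core_closure U \<Gamma> (fst p) (snd p) \<and> sq ?M (\<lambda>x. fst p x - v x) \<le> r n \<and> sq ?M (snd p) < m n + r n"
    by simp
  from choice[OF this] obtain p where p: "\<forall>n. core_closure U \<Gamma> (fst (p n)) (snd (p n)) \<and>
      sq ?M (\<lambda>x. fst (p n) x - v x) \<le> r n \<and> sq ?M (snd (p n)) < m n + r n" ..
  define c where "c n = fst (p n)" for n
  define h where "h n = snd (p n)" for n
  have ch: "core_closure U \<Gamma> (c n) (h n)" and cv: "sq ?M (\<lambda>x. c n x - v x) \<le> r n"
    and hm: "sq ?M (h n) < m n + r n" for n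
    using p by (simp_all add: c_def h_def)
  note sob = core_closure_sobolev[OF ch]
  note cL = sobolevD(1)[OF sob] and hL = sobolevD(2)[OF sob]
  have close: "sq ?M (\<lambda>x. h n x - h k x) \<le> 2 * (m k - m n) + 4 * r n" if nk: "n \<le> k" for n k
  proof -
    have mid: "core_closure U \<Gamma> (\<lambda>x. (1/2) * (c n x + c k x)) (\<lambda>x. (1/2) *\<^sub>R (h n x + h k x))"
      by (intro core_closure_scale core_closure_add assms(1) ch)
    have "sq ?M (\<lambda>x. (1/2) * (c n x + c k x) - v x) \<le> r n"
    proof -
      have eq: "(1/2) * (c n x + c k x) - v x = (1/2) * ((c n x - v x) + (c k x - v x))" for x
        by (simp add: field_simps)
      have "sq ?M (\<lambda>x. (1/2) * (c n x + c k x) - v x) = (1/2)\<^sup>2 * sq ?M (\<lambda>x. (c n x - v x) + (c k x - v x))"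
        unfolding eq by (rule sq_mult)
      also have "\<dots> \<le> (1/2)\<^sup>2 * (2 * sq ?M (\<lambda>x. c n x - v x) + 2 * sq ?M (\<lambda>x. c k x - v x))"
        by (intro mult_left_mono sq_add_le2 L2v_diff cL v) simp
      also have "\<dots> \<le> (1/2)\<^sup>2 * (2 * r n + 2 * r n)"
        using cv[of n] order_trans[OF cv[of k] r_mono[OF nk]] by (intro mult_left_mono add_mono) simp_all
      also have "\<dots> = r n" by (simp add: power2_eq_square)
      finally show ?thesis .
    qed
    then have "sq ?M (\<lambda>x. (1/2) *\<^sub>R (h n x + h k x)) \<in> A n"
      unfolding A_def mem_Collect_eq by - (rule exI, rule exI, rule conjI[OF refl], rule conjI[OF mid])
    then have "m n \<le> (1/2)\<^sup>2 * sq ?M (\<lambda>x. h n x + h k x)" unfolding sq_scaleR by (rule m_le)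
    moreover have "(1/2::real)\<^sup>2 = 1/4" by (simp add: power2_eq_square)
    ultimately have lower: "4 * m n \<le> sq ?M (\<lambda>x. h n x + h k x)" by simp
    have arith: "a + d = 2 * x + 2 * y \<Longrightarrow> 4 * p \<le> a \<Longrightarrow> x < p + s \<Longrightarrow> y < q + t \<Longrightarrow> t \<le> s \<Longrightarrow>
        d \<le> 2 * (q - p) + 4 * s" for a d x y p q s t :: real by argo
    show ?thesis by (rule arith[OF sq_parallelogram[OF hL hL] lower hm hm r_mono[OF nk]])
  qed
  obtain l where l: "m \<longlonglongrightarrow> l" "\<forall>n. m n \<le> l"
    using incseq_convergent[of m B] m_mono m_B by (auto simp: incseq_def)
  have cauchy: "\<exists>N. \<forall>i\<ge>N. \<forall>j\<ge>N. sq ?M (\<lambda>x. h i x - h j x) < \<epsilon>" if "\<epsilon> > 0" for \<epsilon>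
  proof -
    have "(\<lambda>n. 2 * (l - m n) + 4 * r n) \<longlonglongrightarrow> 2 * (l - l) + 4 * 0" by (intro tendsto_intros l r0)
    then have "(\<lambda>n. 2 * (l - m n) + 4 * r n) \<longlonglongrightarrow> 0" by simp
    from order_tendstoD(2)[OF this that] obtain N where N: "\<forall>n\<ge>N. 2 * (l - m n) + 4 * r n < \<epsilon>"
      unfolding eventually_sequentially ..
    have *: "sq ?M (\<lambda>x. h i x - h j x) < \<epsilon>" if "N \<le> i" "i \<le> j" for i j
    proof -
      have "sq ?M (\<lambda>x. h i x - h j x) \<le> 2 * (m j - m i) + 4 * r i" by (rule close[OF that(2)])
      also have "\<dots> \<le> 2 * (l - m i) + 4 * r i" using l(2) by simp
      also have "\<dots> < \<epsilon>" using N that(1) by blast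
      finally show ?thesis .
    qed
    have "sq ?M (\<lambda>x. h i x - h j x) < \<epsilon>" if "N \<le> i" "N \<le> j" for i j
    proof (cases "i \<le> j")
      case False
      then show ?thesis using *[of j i] that by (subst sq_minus_commute) simp
    qed (use * that in blast)
    then show ?thesis by blast
  qed
  obtain k where k: "k \<in> L2v ?M" "(\<lambda>n. sq ?M (\<lambda>x. h n x - k x)) \<longlonglongrightarrow> 0"
    using L2v_complete[OF hL cauchy] .
  have cv0: "(\<lambda>n. sq ?M (\<lambda>x. c n x - v x)) \<longlonglongrightarrow> 0"
  proof (rule tendsto_sandwich[OF _ _ tendsto_const r0])
    show "\<forall>\<^sub>F n in sequentially. 0 \<le> sq ?M (\<lambda>x. c n x - v x)" by (intro always_eventually allI sq_nonneg)
    show "\<forall>\<^sub>F n in sequentially. sq ?M (\<lambda>x. c n x - v x) \<le> r n" by (intro always_eventually allI cv)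
  qed
  have 1: "core_closure U \<Gamma> v k" by (rule core_closure_limit[OF assms(1) ch v k(1) cv0 k(2)])
  have "(\<lambda>n. B + r n) \<longlonglongrightarrow> B + 0" by (intro tendsto_intros r0)
  then have b: "(\<lambda>n. B + r n) \<longlonglongrightarrow> B" by simp
  have "sq ?M k \<le> B"
  proof (rule sq_lsc[OF hL k _ b B0])
    show "sq ?M (h n) \<le> B + r n" for n
      by (rule order_trans[OF less_imp_le[OF hm] add_right_mono[OF m_B]])
  qed
  with 1 show ?thesis using that by blast
qed

text \<open>If core functions \<open>\<phi> n\<close> converge to \<open>u\<close>, then the compositions of \<open>\<phi> n\<close> with ever sharper smooth
  cuts belong to the core, converge in \<open>L\<^sup>2\<close> to the unit contraction of \<open>u\<close>, and have no more energy than
  the \<open>\<phi> n\<close>. Lower semicontinuity bounds the energy of the limit by \<open>sq g + e\<close> for every \<open>e > 0\<close>.\<close>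
lemma core_closure_unit_contraction:
  assumes "open \<Gamma>" "core_closure U \<Gamma> u g"
  obtains h where "core_closure U \<Gamma> (\<lambda>x. min 1 (max 0 (u x))) h" "sq (lebesgue_on \<Gamma>) h \<le> sq (lebesgue_on \<Gamma>) g"
proof -
  let ?M = "lebesgue_on \<Gamma>"
  let ?\<tau> = "\<lambda>t::real. min 1 (max 0 t)"
  note u = core_closure_sobolev[OF assms(2)]
  note uL = sobolevD(1)[OF u] and gL = sobolevD(2)[OF u]
  note [measurable] = L2v_measurable[OF uL]
  define r where "r n = inverse (real (Suc n))" for n
  have r: "r n > 0" for n by (simp add: r_def)
  have r0: "r \<longlonglongrightarrow> 0" unfolding r_def by (rule LIMSEQ_inverse_real_of_nat)
  let ?\<psi> = "\<lambda>n. smooth_unit_cut (r n)"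
  have \<psi>_le: "\<bar>?\<psi> n t\<bar> \<le> \<bar>t\<bar>" for n t
    using smooth_unit_cut_lipschitz[OF r, of n t 0] by (simp add: smooth_unit_cut_0)
  have \<tau>L: "(\<lambda>x. ?\<tau> (u x)) \<in> L2v ?M"
  proof (rule L2v_I[OF _ L2v_integrable[OF uL]])
    show "AE x in ?M. (norm (?\<tau> (u x)))\<^sup>2 \<le> (norm (u x))\<^sup>2" by (intro AE_I2 power_mono) auto
  qed measurable
  have \<psi>m: "(\<lambda>x. ?\<psi> n (u x)) \<in> borel_measurable ?M" for n
    by (rule measurable_compose[OF L2v_measurable[OF uL]
        borel_measurable_continuous_onI[OF Ck_continuous_on[OF Ck_smooth_unit_cut[OF r]]]])
  have \<psi>L: "(\<lambda>x. ?\<psi> n (u x)) \<in> L2v ?M" for n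
  proof (rule L2v_I[OF \<psi>m L2v_integrable[OF uL]])
    show "AE x in ?M. (norm (?\<psi> n (u x)))\<^sup>2 \<le> (norm (u x))\<^sup>2" using \<psi>_le by (intro AE_I2 power_mono) auto
  qed
  have "\<forall>n. \<exists>\<phi>. \<phi> \<in> core U \<Gamma> \<and> sq ?M (\<lambda>x. u x - \<phi> x) < r n \<and> sq ?M (\<lambda>x. g x - gradient \<phi> x) < r n"
    using assms(2) r unfolding core_closure_def by blast
  from choice[OF this] obtain \<phi> where \<phi>': "\<forall>n. \<phi> n \<in> core U \<Gamma> \<and> sq ?M (\<lambda>x. u x - \<phi> n x) < r n \<and>
      sq ?M (\<lambda>x. g x - gradient (\<phi> n) x) < r n" ..
  then have \<phi>: "\<phi> n \<in> core U \<Gamma>" "sq ?M (\<lambda>x. u x - \<phi> n x) < r n" "sq ?M (\<lambda>x. g x - gradient (\<phi> n) x) < r n" for n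
    by simp_all
  define w where "w n x = ?\<psi> n (\<phi> n x)" for n x
  have wc: "w n \<in> core U \<Gamma>" for n
    unfolding w_def by (rule core_compose[OF Ck_smooth_unit_cut[OF r] smooth_unit_cut_0 \<phi>(1)])
  note W = core_closure_core[OF assms(1) wc]
  note p = core_sobolev[OF assms(1) \<phi>(1)] and q = core_sobolev[OF assms(1) wc]
  have grad_le: "sq ?M (gradient (w n)) \<le> sq ?M (gradient (\<phi> n))" for n
  proof (rule integral_mono[OF L2v_integrable[OF sobolevD(2)[OF q]] L2v_integrable[OF sobolevD(2)[OF p]]])
    fix x
    have "gradient (w n) x = smooth_unit_cut' (r n) (\<phi> n x) *\<^sub>R gradient (\<phi> n) x"
      unfolding w_def by (rule gradient_compose[OF smooth_unit_cut_has_derivative[OF r] core_Ck[OF \<phi>(1)]])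
    moreover have "\<bar>smooth_unit_cut' (r n) (\<phi> n x)\<bar> * norm (gradient (\<phi> n) x) \<le> 1 * norm (gradient (\<phi> n) x)"
      using smooth_unit_cut'_bounds[OF r, of n "\<phi> n x"] by (intro mult_right_mono) auto
    ultimately have "norm (gradient (w n) x) \<le> norm (gradient (\<phi> n) x)" by simp
    then show "(norm (gradient (w n) x))\<^sup>2 \<le> (norm (gradient (\<phi> n) x))\<^sup>2" by (rule power_mono) simp
  qed
  have lim1: "(\<lambda>n. sq ?M (\<lambda>x. ?\<psi> n (u x) - ?\<tau> (u x))) \<longlonglongrightarrow> 0"
  proof (rule sq_dominated_tendsto_0)
    show "(\<lambda>x. ?\<psi> n (u x) - ?\<tau> (u x)) \<in> borel_measurable ?M" for n
      by (rule borel_measurable_diff[OF \<psi>m]) measurable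
    show "integrable ?M (\<lambda>x. (2 * \<bar>u x\<bar>)\<^sup>2)" using L2v_integrable[OF uL] by (simp add: power_mult_distrib)
    show "\<bar>?\<psi> n (u x) - ?\<tau> (u x)\<bar> \<le> 2 * \<bar>u x\<bar>" for n x
    proof -
      have "\<bar>?\<tau> (u x)\<bar> \<le> \<bar>u x\<bar>" by auto
      then show ?thesis using \<psi>_le[of n "u x"] by linarith
    qed
    show "AE x in ?M. (\<lambda>n. ?\<psi> n (u x) - ?\<tau> (u x)) \<longlonglongrightarrow> 0"
    proof (rule AE_I2)
      fix x
      have "(\<lambda>n. 4 * r n) \<longlonglongrightarrow> 4 * 0" by (intro tendsto_intros r0)
      then have "(\<lambda>n. 4 * r n) \<longlonglongrightarrow> 0" by simp
      then show "(\<lambda>n. ?\<psi> n (u x) - ?\<tau> (u x)) \<longlonglongrightarrow> 0"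
        by (rule Lim_null_comparison[rotated]) (use smooth_unit_cut_approx[OF r] in \<open>auto intro!: always_eventually\<close>)
    qed
  qed
  have lim2: "(\<lambda>n. sq ?M (\<lambda>x. w n x - ?\<tau> (u x))) \<longlonglongrightarrow> 0"
  proof (rule tendsto_sandwich[OF _ _ tendsto_const])
    show "\<forall>\<^sub>F n in sequentially. 0 \<le> sq ?M (\<lambda>x. w n x - ?\<tau> (u x))" by simp
    show "\<forall>\<^sub>F n in sequentially. sq ?M (\<lambda>x. w n x - ?\<tau> (u x)) \<le> 2 * r n + 2 * sq ?M (\<lambda>x. ?\<psi> n (u x) - ?\<tau> (u x))"
    proof (rule always_eventually, rule allI)
      fix n
      have "sq ?M (\<lambda>x. w n x - ?\<psi> n (u x)) \<le> sq ?M (\<lambda>x. u x - \<phi> n x)"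
      proof (rule integral_mono)
        show "integrable ?M (\<lambda>x. (norm (w n x - ?\<psi> n (u x)))\<^sup>2)"
          by (intro L2v_integrable L2v_diff \<psi>L sobolevD(1)[OF q])
        show "integrable ?M (\<lambda>x. (norm (u x - \<phi> n x))\<^sup>2)"
          by (intro L2v_integrable L2v_diff uL sobolevD(1)[OF p])
        show "(norm (w n x - ?\<psi> n (u x)))\<^sup>2 \<le> (norm (u x - \<phi> n x))\<^sup>2" for x
          unfolding w_def using smooth_unit_cut_lipschitz[OF r, of n "\<phi> n x" "u x"]
          by (intro power_mono) (simp_all add: abs_minus_commute)
      qed
      then have 1: "sq ?M (\<lambda>x. w n x - ?\<psi> n (u x)) \<le> r n"
        using less_imp_le[OF \<phi>(2)] by (rule order_trans)
      have arith: "a \<le> 2 * b + 2 * c \<Longrightarrow> b \<le> r n \<Longrightarrow> a \<le> 2 * r n + 2 * c" for a b c by linarith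
      show "sq ?M (\<lambda>x. w n x - ?\<tau> (u x)) \<le> 2 * r n + 2 * sq ?M (\<lambda>x. ?\<psi> n (u x) - ?\<tau> (u x))"
        by (rule arith[OF sq_diff_triangle[OF sobolevD(1)[OF q] \<psi>L \<tau>L] 1])
    qed
    have "(\<lambda>n. 2 * r n + 2 * sq ?M (\<lambda>x. ?\<psi> n (u x) - ?\<tau> (u x))) \<longlonglongrightarrow> 2 * 0 + 2 * 0"
      by (intro tendsto_add tendsto_mult tendsto_const r0 lim1)
    then show "(\<lambda>n. 2 * r n + 2 * sq ?M (\<lambda>x. ?\<psi> n (u x) - ?\<tau> (u x))) \<longlonglongrightarrow> 0" by simp
  qed
  have ex: "\<exists>h. core_closure U \<Gamma> (\<lambda>x. ?\<tau> (u x)) h \<and> sq ?M h \<le> sq ?M g + e" if e: "e > 0" for e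
  proof -
    let ?G = "sq ?M g"
    have G: "?G \<ge> 0" by (rule sq_nonneg)
    \<comment> \<open>\<open>t\<close> and then \<open>N\<close> are chosen so that each of the two error terms costs at most \<open>e / 2\<close>\<close>
    define t where "t = e / (2 * (?G + 1))"
    have t: "t > 0" unfolding t_def by (intro divide_pos_pos mult_pos_pos add_nonneg_pos G e) simp_all
    have tG: "t * ?G \<le> e / 2"
    proof -
      have "t * ?G = e / 2 * (?G / (?G + 1))" by (simp add: t_def)
      also have "\<dots> \<le> e / 2 * 1"
      proof (rule mult_left_mono)
        have "x / (x + 1) \<le> 1" if "x \<ge> 0" for x :: real using that by simp
        from this[OF G] show "?G / (?G + 1) \<le> 1" .
      qed (use e in simp)
      finally show ?thesis by simp
    qed
    have s: "1 + 1/t > 0" using t by (simp add: add_pos_pos)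
    have "e / (2 * (1 + 1/t)) > 0" using e s by simp
    from order_tendstoD(2)[OF r0 this] obtain N where N: "\<forall>n\<ge>N. r n < e / (2 * (1 + 1/t))"
      unfolding eventually_sequentially ..
    have bound: "sq ?M (gradient (w (n + N))) \<le> ?G + e" for n
    proof -
      let ?n = "n + N"
      have "sq ?M (gradient (w ?n)) \<le> sq ?M (gradient (\<phi> ?n))" by (rule grad_le)
      also have "\<dots> = sq ?M (\<lambda>x. g x + (gradient (\<phi> ?n) x - g x))" by simp
      also have "\<dots> \<le> (1 + t) * ?G + (1 + 1/t) * sq ?M (\<lambda>x. gradient (\<phi> ?n) x - g x)"
        by (intro sq_add_le gL L2v_diff sobolevD(2)[OF p] t)
      also have "\<dots> \<le> (1 + t) * ?G + (1 + 1/t) * (e / (2 * (1 + 1/t)))"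
      proof (intro add_left_mono mult_left_mono)
        show "sq ?M (\<lambda>x. gradient (\<phi> ?n) x - g x) \<le> e / (2 * (1 + 1/t))"
          using less_trans[OF \<phi>(3)[of ?n]] N by (subst sq_minus_commute) (simp add: less_imp_le)
      qed (use s in simp)
      also have "(1 + 1/t) * (e / (2 * (1 + 1/t))) = e / 2"
      proof -
        have "x * (e / (2 * x)) = e / 2" if "x > 0" for x using that by simp
        from this[OF s] show ?thesis .
      qed
      also have "(1 + t) * ?G + e / 2 \<le> ?G + e"
      proof -
        have "(1 + t) * x + e / 2 \<le> x + e" if "t * x \<le> e / 2" for x
          using that unfolding distrib_right by linarith
        from this[OF tG] show ?thesis .
      qed
      finally show ?thesis .
    qed
    have lim3: "(\<lambda>n. sq ?M (\<lambda>x. w (n + N) x - ?\<tau> (u x))) \<longlonglongrightarrow> 0"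
      by (rule LIMSEQ_ignore_initial_segment[OF lim2])
    obtain h where "core_closure U \<Gamma> (\<lambda>x. ?\<tau> (u x)) h" "sq ?M h \<le> ?G + e"
      using core_closure_lower_semicontinuous[OF assms(1) W \<tau>L lim3 bound] .
    then show ?thesis by blast
  qed
  obtain h where h: "core_closure U \<Gamma> (\<lambda>x. ?\<tau> (u x)) h" using ex[OF zero_less_one] by blast
  \<comment> \<open>the gradients \<open>k\<close> obtained for different \<open>e\<close> agree with \<open>h\<close> almost everywhere\<close>
  have "sq ?M h \<le> sq ?M g"
  proof (rule field_le_epsilon)
    fix e :: real assume "e > 0"
    then obtain k where k: "core_closure U \<Gamma> (\<lambda>x. ?\<tau> (u x)) k" "sq ?M k \<le> sq ?M g + e" using ex by blast
    note hs = core_closure_sobolev[OF h] and ks = core_closure_sobolev[OF k(1)]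
    have "sq ?M h = sq ?M k"
      by (intro sq_cong_AE L2v_measurable sobolevD(2)[OF hs] sobolevD(2)[OF ks] sobolev_gradient_unique[OF assms(1) hs ks])
    then show "sq ?M h \<le> sq ?M g + e" using k(2) by simp
  qed
  then show ?thesis using that h by blast
qed

section \<open>Regular Dirichlet forms generated by the core\<close>

lemma L2_norm_square: "(L2_norm M u)\<^sup>2 = sq M u"
  by (simp add: L2_norm_def)

lemma L2_norm_eq: "L2_norm M u = sqrt (sq M u)"
  by (simp add: L2_norm_def)

lemma form_norm_dirichlet:
  assumes "open \<Gamma>" "sobolev \<Gamma> u g"
  shows "form_norm (lebesgue_on \<Gamma>) (dirichlet_integral \<Gamma>) u =
      sqrt (sq (lebesgue_on \<Gamma>) g + sq (lebesgue_on \<Gamma>) u)"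
    and "form_norm (lebesgue_on \<Gamma>) (\<lambda>u v. 1/2 * dirichlet_integral \<Gamma> u v) u =
      sqrt (1/2 * sq (lebesgue_on \<Gamma>) g + sq (lebesgue_on \<Gamma>) u)"
  by (simp_all only: form_norm_def L2_norm_square dirichlet_integral_self[OF assms])

lemma core_domain_cases:
  assumes "u \<in> core_domain U \<Gamma>" obtains g where "core_closure U \<Gamma> u g"
  using assms by (auto simp: core_domain_def)

lemma core_domainI: "core_closure U \<Gamma> u g \<Longrightarrow> u \<in> core_domain U \<Gamma>"
  by (auto simp: core_domain_def)

lemma H10_eq_core_domain:
  fixes \<Gamma> :: "'a::euclidean_space set"
  assumes "open \<Gamma>" shows "H10 \<Gamma> = core_domain UNIV \<Gamma>"
proof (intro set_eqI iffI)
  let ?M = "lebesgue_on \<Gamma>"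
  fix u :: "'a \<Rightarrow> real"
  {
    assume u: "u \<in> H10 \<Gamma>"
    then obtain g where g: "sobolev \<Gamma> u g" using H1_iff_sobolev[OF assms] by (auto simp: H10_def)
    have "core_closure UNIV \<Gamma> u g"
      unfolding core_closure_def
    proof (intro conjI allI impI g)
      fix \<epsilon> :: real assume "\<epsilon> > 0"
      then have "sqrt \<epsilon> > 0" by simp
      then obtain \<phi> where \<phi>: "\<phi> \<in> test_functions \<Gamma>" "form_norm ?M (dirichlet_integral \<Gamma>) (\<lambda>x. u x - \<phi> x) < sqrt \<epsilon>"
        using u unfolding H10_def by blast
      have "sq ?M (\<lambda>x. g x - gradient \<phi> x) + sq ?M (\<lambda>x. u x - \<phi> x) < \<epsilon>"
        using \<phi>(2) unfolding form_norm_dirichlet(1)[OF assms sobolev_diff[OF assms g test_function_sobolev[OF assms \<phi>(1)]]]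
        by (simp only: real_sqrt_less_iff)
      moreover have "0 \<le> sq ?M (\<lambda>x. g x - gradient \<phi> x)" "0 \<le> sq ?M (\<lambda>x. u x - \<phi> x)" by (rule sq_nonneg)+
      moreover have "a + b < \<epsilon> \<Longrightarrow> 0 \<le> a \<Longrightarrow> 0 \<le> b \<Longrightarrow> b < \<epsilon> \<and> a < \<epsilon>" for a b by linarith
      ultimately have "sq ?M (\<lambda>x. u x - \<phi> x) < \<epsilon> \<and> sq ?M (\<lambda>x. g x - gradient \<phi> x) < \<epsilon>" by blast
      then show "\<exists>\<phi>\<in>core UNIV \<Gamma>. sq ?M (\<lambda>x. u x - \<phi> x) < \<epsilon> \<and> sq ?M (\<lambda>x. g x - gradient \<phi> x) < \<epsilon>"
        using \<phi>(1) unfolding core_UNIV by (intro bexI[of _ \<phi>])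
    qed
    then show "u \<in> core_domain UNIV \<Gamma>" by (rule core_domainI)
  next
    assume "u \<in> core_domain UNIV \<Gamma>"
    then obtain g where c: "core_closure UNIV \<Gamma> u g" by (rule core_domain_cases)
    note g = core_closure_sobolev[OF c]
    have "\<exists>\<phi>\<in>test_functions \<Gamma>. form_norm ?M (dirichlet_integral \<Gamma>) (\<lambda>x. u x - \<phi> x) < \<epsilon>" if "\<epsilon> > 0" for \<epsilon>
    proof -
      have "\<epsilon>\<^sup>2 / 2 > 0" using that by simp
      then obtain \<phi> where \<phi>: "\<phi> \<in> core UNIV \<Gamma>" "sq ?M (\<lambda>x. u x - \<phi> x) < \<epsilon>\<^sup>2 / 2" "sq ?M (\<lambda>x. g x - gradient \<phi> x) < \<epsilon>\<^sup>2 / 2"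
        using core_closure_approx[OF c] by blast
      have "sqrt (sq ?M (\<lambda>x. g x - gradient \<phi> x) + sq ?M (\<lambda>x. u x - \<phi> x)) < sqrt (\<epsilon>\<^sup>2)"
        unfolding real_sqrt_less_iff by (rule order_less_le_trans[OF add_strict_mono[OF \<phi>(3,2)]]) simp
      then have "form_norm ?M (dirichlet_integral \<Gamma>) (\<lambda>x. u x - \<phi> x) < \<epsilon>"
        unfolding form_norm_dirichlet(1)[OF assms sobolev_diff[OF assms g core_sobolev[OF assms \<phi>(1)]]]
        using that by simp
      then show ?thesis using \<phi>(1) unfolding core_UNIV by (intro bexI[of _ \<phi>])
    qed
    then show "u \<in> H10 \<Gamma>" using g H1_iff_sobolev[OF assms] by (auto simp: H10_def)
  }
qed

lemma core_subset_Cc: "core U \<Gamma> \<subseteq> Cc \<Gamma>"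
proof
  fix \<phi> :: "'a \<Rightarrow> real" assume \<phi>: "\<phi> \<in> core U \<Gamma>"
  then obtain K where "compact K" "K \<subseteq> \<Gamma>" "\<forall>x. x \<notin> K \<longrightarrow> \<phi> x = 0" unfolding core_iff by blast
  then show "\<phi> \<in> Cc \<Gamma>" unfolding Cc_def using Ck_continuous_on[OF core_Ck[OF \<phi>, of 0]] by blast
qed

text \<open>Elements of \<open>Cc \<Gamma>\<close> are constrained on \<open>\<Gamma>\<close> only and have to be extended by zero before
  they can be approximated globally.\<close>
lemma Cc_extension_continuous:
  fixes f :: "'a::euclidean_space \<Rightarrow> real"
  assumes "open \<Gamma>" "continuous_on \<Gamma> f" "compact K" "K \<subseteq> \<Gamma>" "\<forall>x\<in>\<Gamma> - K. f x = 0"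
  shows "continuous_on UNIV (\<lambda>x. if x \<in> K then f x else 0)"
proof -
  have 1: "continuous_on \<Gamma> (\<lambda>x. if x \<in> K then f x else 0)"
    by (rule continuous_on_eq[OF assms(2)]) (use assms(5) in auto)
  have 2: "continuous_on (- K) (\<lambda>x. if x \<in> K then f x else 0)"
    by (rule continuous_on_eq[OF continuous_on_const[of _ 0]]) auto
  have "continuous_on (\<Gamma> \<union> - K) (\<lambda>x. if x \<in> K then f x else 0)"
    by (rule continuous_on_open_Un[OF assms(1) _ 1 2]) (use compact_imp_closed[OF assms(3)] in auto)
  moreover have "\<Gamma> \<union> - K = UNIV" using assms(4) by blast
  ultimately show ?thesis by simp
qed

text \<open>The parameter \<open>U\<close> lets this one result cover both \<open>H10 \<Gamma>\<close>, for \<open>U = UNIV\<close>, and a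
  proper subspace of it.\<close>
theorem core_domain_regular_dirichlet_form:
  fixes \<Gamma> :: "'a::euclidean_space set"
  assumes U: "open U" "closure U = UNIV" and "open \<Gamma>"
  shows "regular_dirichlet_form (lebesgue_on \<Gamma>) (\<lambda>u v. 1/2 * dirichlet_integral \<Gamma> u v) (core_domain U \<Gamma>)"
proof -
  note \<Gamma> = assms(3)
  let ?M = "lebesgue_on \<Gamma>" let ?F = "core_domain U \<Gamma>" let ?E = "\<lambda>u v. 1/2 * dirichlet_integral \<Gamma> u v"
  have D: "dirichlet_integral \<Gamma> u v = (LINT x|?M. g x \<bullet> h x)"
    if "core_closure U \<Gamma> u g" "core_closure U \<Gamma> v h" for u v g h
    by (rule dirichlet_integral_sobolev[OF \<Gamma> that[THEN core_closure_sobolev]])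
  have self: "dirichlet_integral \<Gamma> u u = sq ?M g" if "core_closure U \<Gamma> u g" for u g
    by (rule dirichlet_integral_self[OF \<Gamma> core_closure_sobolev[OF that]])
  have L2v: "u \<in> L2v ?M" "g \<in> L2v ?M" if "core_closure U \<Gamma> u g" for u g
    using sobolevD[OF core_closure_sobolev[OF that]] by auto
  have core_in: "core U \<Gamma> \<subseteq> ?F \<inter> Cc (space ?M)"
    using core_closure_core[OF \<Gamma>] core_subset_Cc by (fastforce simp: core_domain_def)
  show ?thesis
  proof
    show "?F \<subseteq> L2 ?M" using L2v(1) by (auto simp: core_domain_def L2_eq_L2v)
    show "v \<in> ?F" if "u \<in> ?F" "v \<in> borel_measurable ?M" "AE x in ?M. u x = v x" for u v
      using core_domainI[OF core_closure_cong_AE[OF \<Gamma> _ that(2,3)]] that(1) core_domain_cases by blast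
    show "(\<lambda>x. 0) \<in> ?F" using core_in core_zero by blast
    show "(\<lambda>x. u x + v x) \<in> ?F" if "u \<in> ?F" "v \<in> ?F" for u v
      using that core_closure_add[OF \<Gamma>] unfolding core_domain_def by blast
    show "(\<lambda>x. c * u x) \<in> ?F" if "u \<in> ?F" for c u
      using that core_closure_scale[OF \<Gamma>] unfolding core_domain_def by blast
    show "\<exists>u\<in>?F. L2_norm ?M (\<lambda>x. f x - u x) < \<epsilon>" if f: "f \<in> L2 ?M" and e: "\<epsilon> > 0" for f \<epsilon>
    proof -
      have "\<epsilon>\<^sup>2 > 0" using e by simp
      then obtain \<phi> where \<phi>: "\<phi> \<in> core U \<Gamma>" "sq ?M (\<lambda>x. f x - \<phi> x) < \<epsilon>\<^sup>2"
        using core_dense_L2[OF U \<Gamma> f[unfolded L2_eq_L2v]] by blast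
      have "sqrt (sq ?M (\<lambda>x. f x - \<phi> x)) < sqrt (\<epsilon>\<^sup>2)" unfolding real_sqrt_less_iff by (rule \<phi>(2))
      then have "L2_norm ?M (\<lambda>x. f x - \<phi> x) < \<epsilon>" unfolding L2_norm_eq using e by simp
      then show ?thesis using \<phi>(1) core_in by blast
    qed
    show "?E u v = ?E u' v" if "u \<in> ?F" "u' \<in> ?F" "v \<in> ?F" "AE x in ?M. u x = u' x" for u u' v
    proof -
      obtain g where g: "core_closure U \<Gamma> u g" using \<open>u \<in> ?F\<close> by (rule core_domain_cases)
      obtain g' where g': "core_closure U \<Gamma> u' g'" using \<open>u' \<in> ?F\<close> by (rule core_domain_cases)
      obtain h where h: "core_closure U \<Gamma> v h" using \<open>v \<in> ?F\<close> by (rule core_domain_cases)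
      have "core_closure U \<Gamma> u' g"
        by (rule core_closure_cong_AE[OF \<Gamma> g L2v_measurable[OF L2v(1)[OF g']] that(4)])
      then show ?thesis using D[OF g h] D[of u' g v h] h by simp
    qed
    show "?E u v = ?E v u" if "u \<in> ?F" "v \<in> ?F" for u v
      unfolding dirichlet_integral_def by (simp only: inner_commute)
    show "?E (\<lambda>x. u x + v x) w = ?E u w + ?E v w" if "u \<in> ?F" "v \<in> ?F" "w \<in> ?F" for u v w
    proof -
      obtain g where g: "core_closure U \<Gamma> u g" using \<open>u \<in> ?F\<close> by (rule core_domain_cases)
      obtain h where h: "core_closure U \<Gamma> v h" using \<open>v \<in> ?F\<close> by (rule core_domain_cases)
      obtain k where k: "core_closure U \<Gamma> w k" using \<open>w \<in> ?F\<close> by (rule core_domain_cases)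
      have "(LINT x|?M. (g x + h x) \<bullet> k x) = (LINT x|?M. g x \<bullet> k x) + (LINT x|?M. h x \<bullet> k x)"
        unfolding inner_add_left by (intro Bochner_Integration.integral_add L2v_inner_integrable L2v(2)[OF g] L2v(2)[OF h] L2v(2)[OF k])
      then show ?thesis
        unfolding D[OF core_closure_add[OF \<Gamma> g h] k] D[OF g k] D[OF h k] by simp
    qed
    show "?E (\<lambda>x. c * u x) v = c * ?E u v" if "u \<in> ?F" "v \<in> ?F" for c u v
    proof -
      obtain g where g: "core_closure U \<Gamma> u g" using \<open>u \<in> ?F\<close> by (rule core_domain_cases)
      obtain h where h: "core_closure U \<Gamma> v h" using \<open>v \<in> ?F\<close> by (rule core_domain_cases)
      show ?thesis unfolding D[OF core_closure_scale[OF \<Gamma> g] h] D[OF g h] by simp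
    qed
    show "?E u u \<ge> 0" if "u \<in> ?F" for u
    proof -
      obtain g where g: "core_closure U \<Gamma> u g" using \<open>u \<in> ?F\<close> by (rule core_domain_cases)
      show ?thesis unfolding self[OF g] by simp
    qed
    show "\<exists>w\<in>?F. (\<lambda>n. form_norm ?M ?E (\<lambda>x. s n x - w x)) \<longlonglongrightarrow> 0"
      if s: "\<And>n::nat. s n \<in> ?F"
        and cauchy: "\<And>\<epsilon>. \<epsilon> > 0 \<Longrightarrow> \<exists>N. \<forall>m\<ge>N. \<forall>n\<ge>N. form_norm ?M ?E (\<lambda>x. s m x - s n x) < \<epsilon>" for s
    proof -
      have "\<forall>n. \<exists>g. core_closure U \<Gamma> (s n) g" using s by (simp add: core_domain_def)
      from choice[OF this] obtain g where g: "\<And>n. core_closure U \<Gamma> (s n) (g n)" by blast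
      note sob = core_closure_sobolev[OF g]
      have fn: "form_norm ?M ?E (\<lambda>x. s m x - s n x) =
          sqrt (1/2 * sq ?M (\<lambda>x. g m x - g n x) + sq ?M (\<lambda>x. s m x - s n x))" for m n
        by (rule form_norm_dirichlet(2)[OF \<Gamma> sobolev_diff[OF \<Gamma> sob sob]])
      have c: "\<exists>N. \<forall>m\<ge>N. \<forall>n\<ge>N. sq ?M (\<lambda>x. s m x - s n x) < \<epsilon> \<and> sq ?M (\<lambda>x. g m x - g n x) < \<epsilon>" if "\<epsilon> > 0" for \<epsilon>
      proof -
        have "sqrt (\<epsilon> / 2) > 0" using that by simp
        from cauchy[OF this] obtain N where N: "\<forall>m\<ge>N. \<forall>n\<ge>N. form_norm ?M ?E (\<lambda>x. s m x - s n x) < sqrt (\<epsilon> / 2)" ..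
        have "sq ?M (\<lambda>x. s m x - s n x) < \<epsilon> \<and> sq ?M (\<lambda>x. g m x - g n x) < \<epsilon>" if "m \<ge> N" "n \<ge> N" for m n
        proof -
          have "1/2 * sq ?M (\<lambda>x. g m x - g n x) + sq ?M (\<lambda>x. s m x - s n x) < \<epsilon> / 2"
            using N[rule_format, OF that] unfolding fn real_sqrt_less_iff .
          moreover have "0 \<le> sq ?M (\<lambda>x. s m x - s n x)" "0 \<le> sq ?M (\<lambda>x. g m x - g n x)" by (rule sq_nonneg)+
          moreover have "1/2 * a + b < \<epsilon> / 2 \<Longrightarrow> 0 \<le> b \<Longrightarrow> 0 \<le> a \<Longrightarrow> b < \<epsilon> \<and> a < \<epsilon>" for a b using \<open>\<epsilon> > 0\<close> by linarith
          ultimately show ?thesis by blast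
        qed
        then show ?thesis by blast
      qed
      have c1: "\<exists>N. \<forall>m\<ge>N. \<forall>n\<ge>N. sq ?M (\<lambda>x. s m x - s n x) < \<epsilon>" if "\<epsilon> > 0" for \<epsilon> using c[OF that] by blast
      have c2: "\<exists>N. \<forall>m\<ge>N. \<forall>n\<ge>N. sq ?M (\<lambda>x. g m x - g n x) < \<epsilon>" if "\<epsilon> > 0" for \<epsilon> using c[OF that] by blast
      obtain w where w: "w \<in> L2v ?M" "(\<lambda>n. sq ?M (\<lambda>x. s n x - w x)) \<longlonglongrightarrow> 0"
        using L2v_complete[OF sobolevD(1)[OF sob] c1] .
      obtain k where k: "k \<in> L2v ?M" "(\<lambda>n. sq ?M (\<lambda>x. g n x - k x)) \<longlonglongrightarrow> 0"
        using L2v_complete[OF sobolevD(2)[OF sob] c2] .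
      have wk: "core_closure U \<Gamma> w k" by (rule core_closure_limit[OF \<Gamma> g w(1) k(1) w(2) k(2)])
      have "(\<lambda>n. sqrt (1/2 * sq ?M (\<lambda>x. g n x - k x) + sq ?M (\<lambda>x. s n x - w x))) \<longlonglongrightarrow> sqrt (1/2 * 0 + 0)"
        by (intro tendsto_real_sqrt tendsto_add tendsto_mult tendsto_const k(2) w(2))
      moreover have "form_norm ?M ?E (\<lambda>x. s n x - w x) = sqrt (1/2 * sq ?M (\<lambda>x. g n x - k x) + sq ?M (\<lambda>x. s n x - w x))" for n
        by (rule form_norm_dirichlet(2)[OF \<Gamma> sobolev_diff[OF \<Gamma> sob core_closure_sobolev[OF wk]]])
      ultimately have "(\<lambda>n. form_norm ?M ?E (\<lambda>x. s n x - w x)) \<longlonglongrightarrow> 0" by simp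
      then show ?thesis using core_domainI[OF wk] by blast
    qed
    show "(\<lambda>x. min 1 (max 0 (u x))) \<in> ?F \<and> ?E (\<lambda>x. min 1 (max 0 (u x))) (\<lambda>x. min 1 (max 0 (u x))) \<le> ?E u u"
      if "u \<in> ?F" for u
    proof -
      obtain g where g: "core_closure U \<Gamma> u g" using \<open>u \<in> ?F\<close> by (rule core_domain_cases)
      obtain h where h: "core_closure U \<Gamma> (\<lambda>x. min 1 (max 0 (u x))) h" "sq ?M h \<le> sq ?M g"
        using core_closure_unit_contraction[OF \<Gamma> g] .
      show ?thesis using core_domainI[OF h(1)] h(2) unfolding self[OF h(1)] self[OF g] by simp
    qed
    show "\<exists>f\<in>?F \<inter> Cc (space ?M). form_norm ?M ?E (\<lambda>x. u x - f x) < \<epsilon>" if "u \<in> ?F" and e: "\<epsilon> > 0" for u \<epsilon>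
    proof -
      obtain g where g: "core_closure U \<Gamma> u g" using \<open>u \<in> ?F\<close> by (rule core_domain_cases)
      have "\<epsilon>\<^sup>2 / 2 > 0" using e by simp
      then obtain \<phi> where \<phi>: "\<phi> \<in> core U \<Gamma>" "sq ?M (\<lambda>x. u x - \<phi> x) < \<epsilon>\<^sup>2 / 2" "sq ?M (\<lambda>x. g x - gradient \<phi> x) < \<epsilon>\<^sup>2 / 2"
        using core_closure_approx[OF g] by blast
      have arith: "a < b / 2 \<Longrightarrow> c < b / 2 \<Longrightarrow> 0 \<le> c \<Longrightarrow> 1/2 * c + a < b" for a b c :: real by linarith
      have "sqrt (1/2 * sq ?M (\<lambda>x. g x - gradient \<phi> x) + sq ?M (\<lambda>x. u x - \<phi> x)) < sqrt (\<epsilon>\<^sup>2)"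
        unfolding real_sqrt_less_iff by (rule arith[OF \<phi>(2,3) sq_nonneg])
      then have "form_norm ?M ?E (\<lambda>x. u x - \<phi> x) < \<epsilon>"
        unfolding form_norm_dirichlet(2)[OF \<Gamma> sobolev_diff[OF \<Gamma> core_closure_sobolev[OF g] core_sobolev[OF \<Gamma> \<phi>(1)]]]
        using e by simp
      then show ?thesis using \<phi>(1) core_in by blast
    qed
    show "\<exists>f\<in>?F \<inter> Cc (space ?M). \<forall>x\<in>space ?M. \<bar>g x - f x\<bar> < \<epsilon>" if "g \<in> Cc (space ?M)" and e: "\<epsilon> > 0" for g \<epsilon>
    proof -
      obtain K where K: "continuous_on \<Gamma> g" "compact K" "K \<subseteq> \<Gamma>" "\<forall>x\<in>\<Gamma> - K. g x = 0"
        using \<open>g \<in> Cc (space ?M)\<close> by (auto simp: Cc_def)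
      have z: "(if x \<in> K then g x else 0) = 0" if "x \<notin> K" for x using that by simp
      obtain \<phi> where \<phi>: "\<phi> \<in> core U \<Gamma>" "\<And>x. x \<notin> K \<Longrightarrow> \<phi> x = 0" "\<And>x. \<bar>\<phi> x - (if x \<in> K then g x else 0)\<bar> < \<epsilon>"
        using core_uniform_approx[OF U K(2,3) Cc_extension_continuous[OF \<Gamma> K] z e] by blast
      have "\<bar>g x - \<phi> x\<bar> < \<epsilon>" if "x \<in> \<Gamma>" for x
        using \<phi>(3)[of x] K(4) that by (cases "x \<in> K") (auto simp: abs_minus_commute)
      then have "\<forall>x\<in>space ?M. \<bar>g x - \<phi> x\<bar> < \<epsilon>" by simp
      then show ?thesis using \<phi>(1) core_in by blast
    qed
  qed
qed

section \<open>Proper subspaces\<close>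

text \<open>The slab of thickness \<open>2 * r\<close> inside a cube of side \<open>2 * s\<close> is covered by a box whose side in
  direction \<open>b\<close> is \<open>2 * r\<close>.\<close>
lemma emeasure_lebesgue_slab:
  fixes p b :: "'a::euclidean_space" and q :: real
  assumes "b \<in> Basis" "s > 0" "r > 0"
  defines "l \<equiv> (\<Sum>i\<in>Basis. (if i = b then q - r else p \<bullet> i - s) *\<^sub>R i)"
    and "u \<equiv> (\<Sum>i\<in>Basis. (if i = b then q + r else p \<bullet> i + s) *\<^sub>R i)"
  shows "emeasure lebesgue (cbox l u) = ennreal (2 * r * (2 * s) ^ (DIM('a) - 1))"
    and "\<And>x. x \<in> cbox (p - s *\<^sub>R One) (p + s *\<^sub>R One) \<Longrightarrow> \<bar>x \<bullet> b - q\<bar> \<le> r \<Longrightarrow> x \<in> cbox l u"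
proof -
  have li: "l \<bullet> i = (if i = b then q - r else p \<bullet> i - s)" and ui: "u \<bullet> i = (if i = b then q + r else p \<bullet> i + s)"
    if "i \<in> Basis" for i
    using that unfolding l_def u_def by (simp_all only: inner_sum_left_Basis)
  have "emeasure lebesgue (cbox l u) = emeasure lborel (cbox l u)" by simp
  also have "\<dots> = ennreal (\<Prod>i\<in>Basis. (u - l) \<bullet> i)"
    by (rule emeasure_lborel_cbox) (use li ui assms(2,3) in auto)
  also have "(\<Prod>i\<in>Basis. (u - l) \<bullet> i) = (\<Prod>i\<in>Basis. if i = b then 2 * r else 2 * s)"
    by (rule prod.cong) (auto simp: inner_diff_left li ui)
  also have "\<dots> = 2 * r * (\<Prod>i\<in>Basis - {b}. if i = b then 2 * r else 2 * s)"
    using prod.remove[OF finite_Basis assms(1), of "\<lambda>i. if i = b then 2 * r else 2 * s"] by simp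
  also have "(\<Prod>i\<in>Basis - {b}. if i = b then 2 * r else 2 * s) = (\<Prod>i\<in>Basis - {b}. 2 * s)"
    by (rule prod.cong) auto
  also have "\<dots> = (2 * s) ^ (DIM('a) - 1)" using assms(1) by simp
  finally show "emeasure lebesgue (cbox l u) = ennreal (2 * r * (2 * s) ^ (DIM('a) - 1))" .
  fix x assume x: "x \<in> cbox (p - s *\<^sub>R One) (p + s *\<^sub>R One)" "\<bar>x \<bullet> b - q\<bar> \<le> r"
  show "x \<in> cbox l u"
    unfolding mem_box
  proof
    fix i :: 'a assume i: "i \<in> Basis"
    have "p \<bullet> i - s \<le> x \<bullet> i \<and> x \<bullet> i \<le> p \<bullet> i + s"
      using x(1) i by (simp add: mem_box inner_diff_left inner_add_left)
    then show "l \<bullet> i \<le> x \<bullet> i \<and> x \<bullet> i \<le> u \<bullet> i"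
      using x(2) by (auto simp: li[OF i] ui[OF i])
  qed
qed

text \<open>The union of intervals of rapidly decreasing lengths around the points of a countable dense set is open and
  dense. The slabs over these intervals cover at most half of the cube.\<close>
lemma open_dense_thin:
  fixes p b :: "'a::euclidean_space"
  assumes b: "b \<in> Basis" and s: "s > 0"
  obtains U where "open U" "closure U = UNIV"
    "emeasure lebesgue (cbox (p - s *\<^sub>R One) (p + s *\<^sub>R One) \<inter> {x. x \<bullet> b \<notin> U}) \<noteq> 0"
proof -
  let ?B = "cbox (p - s *\<^sub>R One) (p + s *\<^sub>R One)"
  obtain D :: "real set" where D: "countable D" "\<And>X. open X \<Longrightarrow> X \<noteq> {} \<Longrightarrow> \<exists>d\<in>D. d \<in> X"
    using countable_dense_setE[where ?'a = real] by blast
  have Dne: "D \<noteq> {}" using D(2)[OF open_UNIV] by auto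
  define q where "q = from_nat_into D"
  have q: "range q = D" unfolding q_def by (rule range_from_nat_into[OF Dne D(1)])
  \<comment> \<open>the interval lengths \<open>2 * r n\<close> add up to \<open>s\<close>, half the side of the cube\<close>
  define r where "r n = s / 2 * (1/2)^(Suc n)" for n
  have r: "r n > 0" for n using s by (simp add: r_def)
  define U where "U = (\<Union>n. ball (q n) (r n))"
  have "open U" unfolding U_def by blast
  moreover have "closure U = UNIV"
  proof (rule ccontr)
    assume "closure U \<noteq> UNIV"
    then have "- closure U \<noteq> {}" by blast
    then obtain d where "d \<in> D" "d \<in> - closure U" using D(2)[of "- closure U"] by auto
    moreover obtain n where "d = q n" using \<open>d \<in> D\<close> q by blast
    then have "d \<in> ball (q n) (r n)" using r[of n] by simp
    then have "d \<in> U" unfolding U_def by blast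
    ultimately show False using closure_subset by blast
  qed
  moreover have "emeasure lebesgue (?B \<inter> {x. x \<bullet> b \<notin> U}) \<noteq> 0"
  proof
    let ?Z = "?B \<inter> {x. x \<bullet> b \<notin> U}"
    assume Z0: "emeasure lebesgue ?Z = 0"
    define c where "c = (2 * s) ^ (DIM('a) - 1)"
    have c: "c > 0" using s by (simp add: c_def)
    define Q where "Q n = cbox (\<Sum>i\<in>Basis. (if i = b then q n - r n else p \<bullet> i - s) *\<^sub>R i)
        (\<Sum>i\<in>Basis. (if i = b then q n + r n else p \<bullet> i + s) *\<^sub>R i)" for n
    have Q: "emeasure lebesgue (Q n) = ennreal (2 * r n * c)" for n
      unfolding Q_def c_def by (rule emeasure_lebesgue_slab(1)[OF b s r])
    have Qs: "Q n \<in> sets lebesgue" for n by (simp add: Q_def)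
    have Zs: "?Z \<in> sets lebesgue"
    proof -
      have "closed {x. x \<bullet> b \<notin> U}"
        using continuous_closed_vimage[of "- U" "\<lambda>x. x \<bullet> b"] \<open>open U\<close>
        by (auto simp: vimage_def intro!: continuous_intros)
      then show ?thesis by (intro sets.Int) auto
    qed
    have sub: "?B \<subseteq> ?Z \<union> (\<Union>n. Q n)"
    proof
      fix x assume x: "x \<in> ?B"
      show "x \<in> ?Z \<union> (\<Union>n. Q n)"
      proof (cases "x \<bullet> b \<in> U")
        case True
        then obtain n where "x \<bullet> b \<in> ball (q n) (r n)" unfolding U_def by blast
        then have "\<bar>x \<bullet> b - q n\<bar> \<le> r n" by (simp add: dist_real_def abs_minus_commute)
        then have "x \<in> Q n" unfolding Q_def by (rule emeasure_lebesgue_slab(2)[OF b s r x])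
        then show ?thesis by blast
      qed (use x in blast)
    qed
    have sums: "(\<lambda>n. 2 * r n * c) sums (s * c)"
    proof -
      have "(\<lambda>n. (s * c) * (1/2::real)^(Suc n)) sums ((s * c) * 1)"
        by (rule sums_mult[OF power_half_series])
      moreover have "(s * c) * (1/2::real)^(Suc n) = 2 * r n * c" for n by (simp add: r_def)
      ultimately show ?thesis by (simp only: mult_1_right)
    qed
    have "emeasure lebesgue ?B \<le> emeasure lebesgue (?Z \<union> (\<Union>n. Q n))"
      using Zs Qs by (intro emeasure_mono sub sets.Un sets.countable_UN) auto
    also have "\<dots> \<le> emeasure lebesgue ?Z + emeasure lebesgue (\<Union>n. Q n)"
      using Zs Qs by (intro emeasure_subadditive sets.countable_UN) auto
    also have "\<dots> = emeasure lebesgue (\<Union>n. Q n)" using Z0 by simp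
    also have "\<dots> \<le> (\<Sum>n. emeasure lebesgue (Q n))"
      using Qs by (intro emeasure_subadditive_countably) auto
    also have "\<dots> = ennreal (s * c)"
    proof -
      have "0 \<le> 2 * r n * c" for n using r[of n] c by simp
      then show ?thesis unfolding Q using suminf_ennreal_eq[OF _ sums] by blast
    qed
    finally have "emeasure lebesgue ?B \<le> ennreal (s * c)" .
    moreover have "emeasure lebesgue ?B = ennreal (2 * s * c)"
    proof -
      \<comment> \<open>the cube itself is the slab around \<open>p \<bullet> b\<close> of thickness \<open>2 * s\<close>\<close>
      have "cbox (\<Sum>i\<in>Basis. (if i = b then p \<bullet> b - s else p \<bullet> i - s) *\<^sub>R i)
          (\<Sum>i\<in>Basis. (if i = b then p \<bullet> b + s else p \<bullet> i + s) *\<^sub>R i) = ?B"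
        by (rule arg_cong2[where f = cbox]; rule euclidean_eqI) (auto simp: inner_add_left inner_diff_left inner_sum_left_Basis)
      then show ?thesis
        using emeasure_lebesgue_slab(1)[OF b s s, of "p \<bullet> b" p] by (simp add: c_def)
    qed
    ultimately have "2 * s * c \<le> s * c" using s c by (simp add: ennreal_le_iff)
    then show False using s c by simp
  qed
  ultimately show ?thesis using that by blast
qed

lemma cbox_cube_subset_ball:
  fixes p :: "'a::euclidean_space"
  assumes "e > 0" "s = e / (2 * DIM('a))"
  shows "cbox (p - s *\<^sub>R One) (p + s *\<^sub>R One) \<subseteq> ball p e"
proof
  fix x assume x: "x \<in> cbox (p - s *\<^sub>R One) (p + s *\<^sub>R One)"
  have "norm (x - p) \<le> (\<Sum>i\<in>Basis. \<bar>(x - p) \<bullet> i\<bar>)" by (rule norm_le_l1)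
  also have "\<dots> \<le> (\<Sum>i\<in>(Basis::'a set). s)"
  proof (rule sum_mono)
    fix i :: 'a assume "i \<in> Basis"
    then have "p \<bullet> i - s \<le> x \<bullet> i \<and> x \<bullet> i \<le> p \<bullet> i + s"
      using x by (simp add: mem_box inner_diff_left inner_add_left)
    then show "\<bar>(x - p) \<bullet> i\<bar> \<le> s" by (auto simp: inner_diff_left)
  qed
  also have "\<dots> = e / 2" using assms(2) by simp
  finally show "x \<in> ball p e" using assms(1) by (simp add: dist_norm norm_minus_commute)
qed

lemma test_function_locally_linear:
  fixes \<Gamma> :: "'a::euclidean_space set"
  assumes "open \<Gamma>" "cball p e \<subseteq> \<Gamma>"
  obtains \<phi> where "\<phi> \<in> test_functions \<Gamma>" "\<And>x. x \<in> ball p e \<Longrightarrow> frechet_derivative \<phi> (at x) b = b \<bullet> b"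
proof -
  obtain \<theta> where \<theta>: "\<theta> \<in> test_functions \<Gamma>" "\<And>x. x \<in> cball p e \<Longrightarrow> \<theta> x = 1"
    using smooth_cutoff[OF assms(1) compact_cball assms(2)] by blast
  let ?\<phi> = "\<lambda>x. (x \<bullet> b) * \<theta> x"
  have "smooth_flat UNIV (\<lambda>x::'a. x \<bullet> b)" by (simp add: smooth_flat_def Ck_inner)
  then have t: "?\<phi> \<in> test_functions \<Gamma>" using core_mult \<theta>(1) unfolding core_UNIV[symmetric] by blast
  have d: "frechet_derivative ?\<phi> (at x) b = b \<bullet> b" if x: "x \<in> ball p e" for x
  proof -
    have "((\<lambda>x. x \<bullet> b) has_derivative (\<lambda>v. v \<bullet> b)) (at x)" by (auto intro!: derivative_eq_intros)
    then have "(?\<phi> has_derivative (\<lambda>v. v \<bullet> b)) (at x)"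
      by (rule has_derivative_transform_within_open[OF _ open_ball x]) (use \<theta>(2) in auto)
    from frechet_derivative_at[OF this] show ?thesis by metis
  qed
  show ?thesis using that[OF t d] .
qed

text \<open>The gradient of \<open>\<phi>\<close> and that of any core function differ by at least \<open>1\<close> on \<open>Z\<close>, so their
  squared \<open>L\<^sup>2\<close>-distance is at least the measure of \<open>Z\<close>.\<close>
lemma core_domain_proper:
  fixes \<Gamma> :: "'a::euclidean_space set"
  assumes "open \<Gamma>" and \<phi>: "\<phi> \<in> test_functions \<Gamma>" and b: "b \<in> Basis"
    and Z: "compact Z" "Z \<subseteq> \<Gamma>" "emeasure lebesgue Z \<noteq> 0"
    and flat: "\<And>x. x \<in> Z \<Longrightarrow> x \<bullet> b \<notin> U" and one: "\<And>x. x \<in> Z \<Longrightarrow> frechet_derivative \<phi> (at x) b = 1"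
  shows "\<phi> \<notin> core_domain U \<Gamma>"
proof
  let ?M = "lebesgue_on \<Gamma>"
  have \<Gamma>: "\<Gamma> \<in> sets lebesgue" using assms(1) by simp
  assume "\<phi> \<in> core_domain U \<Gamma>"
  then obtain g where g: "core_closure U \<Gamma> \<phi> g" by (rule core_domain_cases)
  have Zl: "Z \<in> lmeasurable" by (rule lmeasurable_compact[OF Z(1)])
  then have "measure lebesgue Z > 0"
    using Z(3) by (simp add: emeasure_eq_measure2 zero_less_measure_iff)
  then obtain \<psi> where \<psi>: "\<psi> \<in> core U \<Gamma>" "sq ?M (\<lambda>x. g x - gradient \<psi> x) < measure lebesgue Z"
    using core_closure_approx[OF g] by blast
  note sp = test_function_sobolev[OF assms(1) \<phi>] and sg = core_closure_sobolev[OF g] and sq = core_sobolev[OF assms(1) \<psi>(1)]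
  have "measure lebesgue Z = (LINT x|?M. indicator Z x)"
  proof -
    have "(LINT x|?M. indicator Z x :: real) = (LINT x|lebesgue. indicator Z x)"
      by (rule integral_lebesgue_on_eq_UNIV[OF \<Gamma>]) (use Z(2) in \<open>auto simp: indicator_def\<close>)
    then show ?thesis by simp
  qed
  also have "\<dots> \<le> sq ?M (\<lambda>x. gradient \<phi> x - gradient \<psi> x)"
  proof (rule integral_mono[OF integrable_indicator_compact[OF Z(1,2) \<Gamma>]
        L2v_integrable[OF L2v_diff[OF sobolevD(2)[OF sp] sobolevD(2)[OF sq]]]])
    fix x
    show "(indicator Z x :: real) \<le> (norm (gradient \<phi> x - gradient \<psi> x))\<^sup>2"
    proof (cases "x \<in> Z")
      case True
      have "frechet_derivative \<psi> (at x) b = 0"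
        using \<psi>(1) flat[OF True] b by (simp add: core_def smooth_flat_def)
      then have "(gradient \<phi> x - gradient \<psi> x) \<bullet> b = 1"
        by (simp add: inner_diff_left gradient_inner_Basis[OF b] one[OF True])
      then have "1 \<le> norm (gradient \<phi> x - gradient \<psi> x)"
        using Basis_le_norm[OF b, of "gradient \<phi> x - gradient \<psi> x"] by simp
      then show ?thesis using True power_mono[of 1 "norm (gradient \<phi> x - gradient \<psi> x)" 2] by simp
    qed simp
  qed
  also have "\<dots> = sq ?M (\<lambda>x. g x - gradient \<psi> x)"
  proof (rule sq_cong_AE)
    note [measurable] = sobolevD(2)[OF sp, THEN L2v_measurable] sobolevD(2)[OF sg, THEN L2v_measurable]
      sobolevD(2)[OF sq, THEN L2v_measurable]
    show "(\<lambda>x. gradient \<phi> x - gradient \<psi> x) \<in> borel_measurable ?M" "(\<lambda>x. g x - gradient \<psi> x) \<in> borel_measurable ?M"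
      by measurable
    show "AE x in ?M. gradient \<phi> x - gradient \<psi> x = g x - gradient \<psi> x"
      using sobolev_gradient_unique[OF assms(1) sp sg] by eventually_elim simp
  qed
  finally show False using \<psi>(2) by simp
qed

theorem proposition3p9:
  fixes \<Gamma> :: "'a::euclidean_space set"
  assumes "open \<Gamma>" and "connected \<Gamma>" and "\<Gamma> \<noteq> {}"
  shows "\<exists>\<E>' \<F>'. proper_regular_subspace (lebesgue_on \<Gamma>) \<E>' \<F>'
           (\<lambda>u v. 1/2 * dirichlet_integral \<Gamma> u v) (H10 \<Gamma>)"
proof -
  let ?E = "\<lambda>u v. 1/2 * dirichlet_integral \<Gamma> u v"
  obtain p where "p \<in> \<Gamma>" using assms(3) by blast
  then obtain e where e: "e > 0" "cball p e \<subseteq> \<Gamma>" using assms(1) open_contains_cball by blast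
  obtain b :: 'a where b: "b \<in> Basis" using nonempty_Basis by blast
  define s where "s = e / (2 * DIM('a))"
  have s: "s > 0" using e(1) by (simp add: s_def)
  let ?B = "cbox (p - s *\<^sub>R One) (p + s *\<^sub>R One)"
  have B: "?B \<subseteq> ball p e" by (rule cbox_cube_subset_ball[OF e(1) s_def])
  obtain U where U: "open U" "closure U = UNIV" "emeasure lebesgue (?B \<inter> {x. x \<bullet> b \<notin> U}) \<noteq> 0"
    using open_dense_thin[OF b s] .
  obtain \<phi> where \<phi>: "\<phi> \<in> test_functions \<Gamma>" "\<And>x. x \<in> ball p e \<Longrightarrow> frechet_derivative \<phi> (at x) b = b \<bullet> b"
    using test_function_locally_linear[OF assms(1) e(2), of b] by metis
  have bb: "b \<bullet> b = 1" using b by simp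
  have cl: "closed {x. x \<bullet> b \<notin> U}"
    using continuous_closed_vimage[of "- U" "\<lambda>x. x \<bullet> b"] U(1)
    by (auto simp: vimage_def intro!: continuous_intros)
  have "\<phi> \<notin> core_domain U \<Gamma>"
  proof (rule core_domain_proper[OF assms(1) \<phi>(1) b _ _ U(3)])
    show "compact (?B \<inter> {x. x \<bullet> b \<notin> U})" by (intro compact_Int_closed compact_cbox cl)
    show "?B \<inter> {x. x \<bullet> b \<notin> U} \<subseteq> \<Gamma>" using B ball_subset_cball e(2) by blast
    show "x \<bullet> b \<notin> U" if "x \<in> ?B \<inter> {x. x \<bullet> b \<notin> U}" for x using that by blast
    show "frechet_derivative \<phi> (at x) b = 1" if "x \<in> ?B \<inter> {x. x \<bullet> b \<notin> U}" for x
      using \<phi>(2)[of x] that B bb by auto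
  qed
  moreover have "\<phi> \<in> core_domain UNIV \<Gamma>"
    by (rule core_domainI[OF core_closure_core[OF assms(1) \<phi>(1)[folded core_UNIV]]])
  ultimately have ne: "core_domain U \<Gamma> \<noteq> core_domain UNIV \<Gamma>" by blast
  have "core U \<Gamma> \<subseteq> core UNIV \<Gamma>" by (auto simp: core_def smooth_flat_def)
  then have sub: "core_domain U \<Gamma> \<subseteq> core_domain UNIV \<Gamma>"
    unfolding core_domain_def core_closure_def by blast
  have "proper_regular_subspace (lebesgue_on \<Gamma>) ?E (core_domain U \<Gamma>) ?E (H10 \<Gamma>)"
    unfolding proper_regular_subspace_def regular_subspace_def H10_eq_core_domain[OF assms(1)]
    using core_domain_regular_dirichlet_form[OF open_UNIV closure_UNIV assms(1)]
      core_domain_regular_dirichlet_form[OF U(1,2) assms(1)] sub ne by simp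
  then show ?thesis by blast
qed

end
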